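(* Let $0<\zeta_3<\zeta_2<\zeta_1$, $b=4\zeta_1\zeta_2\zeta_3$, $c=2(\zeta_1^2+\zeta_2^2+\zeta_3^2)$, $\nu=\sqrt{\zeta_1^2-\zeta_3^2}$, $k=\sqrt{(\zeta_1^2-\zeta_2^2)/(\zeta_1^2-\zeta_3^2)}$, let $\alpha\in(0,K)$ be defined by $\mathrm{sn}(\alpha)=\sqrt{(\zeta_1-\zeta_3)/(\zeta_1+\zeta_2)}$, and let $\phi$ be the traveling periodic profile $$\phi(x)=\frac{2(\zeta_1+\zeta_3)(\zeta_2+\zeta_3)}{(\zeta_1+\zeta_3)-(\zeta_1-\zeta_2)\mathrm{sn}^2(\nu x)}-\zeta_1-\zeta_2-\zeta_3,$$ so that $u(x,t)=\phi(x+ct)$ solves the defocusing mKdV equation $u_t-6u^2u_x+u_{xxx}=0$. Define $$s_0=\zeta_2+\zeta_3-\zeta_1+2\sqrt{\zeta_1^2-\zeta_3^2}\,Z(\alpha),\qquad c_b=2(\zeta_1^2+\zeta_2^2+\zeta_3^2)-\frac{4\zeta_1\zeta_2\zeta_3}{\zeta_2+\zeta_3-\zeta_1+2\sqrt{\zeta_1^2-\zeta_3^2}\,Z(\alpha)},$$ and $\xi=x+ct$, $\eta=s_0(x+c_bt)$. Then for every $\eta_0\in\mathbb{R}$, $$u(x,t)=\frac{4\phi(\xi)\Theta^2(\nu\xi+\alpha)+e^{2(\eta+\eta_0)}\Theta^2(\nu\xi-\alpha)\bigl(2\phi(\xi)\phi'(\xi)-\phi''(\xi)-b\bigr)}{4\Theta^2(\nu\xi+\alpha)+e^{2(\eta+\eta_0)}\Theta^2(\nu\xi-\alpha)\bigl(c+2\phi'(\xi)-2\phi(\xi)^2\bigr)}$$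 is a bounded solution of the defocusing mKdV equation $u_t-6u^2u_x+u_{xxx}=0$ on $\mathbb{R}\times\mathbb{R}$ (a kink breather). Moreover $c_b<c$, $s_0>0$, and $$u(x,t)\to\begin{cases}\phi(\xi) & \text{as } \eta\to-\infty,\\ -\phi(\xi-2\nu^{-1}\alpha) & \text{as } \eta\to+\infty.\end{cases}$$
   Context: For $k\in(0,1)$: $K=K(k)$ is the complete elliptic integral of the first kind, $k'=\sqrt{1-k^2}$, $K'=K(k')$, $q=e^{-\pi K'/K}$, $\theta_4(y)=1+2\sum_{n\ge1}(-1)^nq^{n^2}\cos(2ny)$, $\Theta(x)=\theta_4\!\left(\frac{\pi x}{2K}\right)$, and Jacobi's zeta function is $Z(x)=\Theta'(x)/\Theta(x)$. $\mathrm{sn}$ is the Jacobi elliptic function of modulus $k$. *)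

theory Defs
  imports "HOL-Analysis.Analysis"
begin

definition ellK :: "real \<Rightarrow> real" where
  "ellK k = integral {0..pi/2} (\<lambda>t. 1 / sqrt (1 - k\<^sup>2 * (sin t)\<^sup>2))"

definition ellF :: "real \<Rightarrow> real \<Rightarrow> real" where
  "ellF k \<phi> = (if 0 \<le> \<phi> then integral {0..\<phi>} (\<lambda>t. 1 / sqrt (1 - k\<^sup>2 * (sin t)\<^sup>2))
               else - integral {\<phi>..0} (\<lambda>t. 1 / sqrt (1 - k\<^sup>2 * (sin t)\<^sup>2)))"

definition jam :: "real \<Rightarrow> real \<Rightarrow> real" where
  "jam k x = (THE \<phi>. ellF k \<phi> = x)"

definition jsn :: "real \<Rightarrow> real \<Rightarrow> real" where
  "jsn k x = sin (jam k x)"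

definition nome :: "real \<Rightarrow> real" where
  "nome k = exp (- pi * ellK (sqrt (1 - k\<^sup>2)) / ellK k)"

definition theta4 :: "real \<Rightarrow> real \<Rightarrow> real" where
  "theta4 k y = 1 + 2 * (\<Sum>n. (-1) ^ (Suc n) * nome k ^ ((Suc n)\<^sup>2) * cos (2 * real (Suc n) * y))"

definition jTheta :: "real \<Rightarrow> real \<Rightarrow> real" where
  "jTheta k x = theta4 k (pi * x / (2 * ellK k))"

definition jZeta :: "real \<Rightarrow> real \<Rightarrow> real" where
  "jZeta k x = deriv (jTheta k) x / jTheta k x"

end

theory Submission
  imports Defs "HOL-Complex_Analysis.Complex_Analysis"
begin

text \<open>The solution is a general solution of the Riccati equation \<open>u\<^sub>x = u\<^sup>2 - V\<close>, where \<open>V = \<phi>\<^sup>2 - \<phi>'\<close> is the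
  Miura transform of the travelling wave: it interpolates between the particular solutions \<open>\<phi>\<close> and
  \<open>\<phi> - 2 b / (c - 2 V) = - \<phi> (\<cdot> - 2 \<alpha> / \<nu>)\<close>, with a weight that is logistic in \<open>x\<close> and \<open>t\<close>. That the weight
  given by theta functions is the right one amounts to
  \<open>\<phi> \<xi> = s\<^sub>0 - \<nu> (Z (\<nu> \<xi> + \<alpha>) - Z (\<nu> \<xi> - \<alpha>))\<close>, which follows from \<open>Z' = const - k\<^sup>2 sn\<^sup>2\<close> and the addition
  formula for \<open>sn\<close>.

  To relate the theta series with \<open>q = e\<^bsup>-t\<^esup>\<close> to the inverse of the elliptic integral, rearranging double sums gives
  \<open>\<theta>\<^sub>3\<close> and \<open>\<theta>\<^sub>2\<close> bilinear relations between the parameters \<open>t\<close> and \<open>2 t\<close>. Their second derivatives show that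
  \<open>f = \<theta>\<^sub>2 / \<theta>\<^sub>3\<close> satisfies \<open>f f'' - f'\<^sup>2 = B (1 - f\<^sup>4)\<close>, whose solution is \<open>\<surd>k cd\<close> on the real axis and
  \<open>\<surd>k nd\<close> (of the complementary modulus) on the imaginary axis; matching the first zero and the first maximum gives \<open>K\<close>
  and \<open>K'\<close>, hence \<open>\<pi> K' / K = t\<close>. That these are the first ones follows from iterating \<open>t \<rightarrow> 2 t\<close>: a zero of a theta
  function would persist along \<open>2\<^sup>m t\<close>, where the series is dominated by its leading terms.\<close>

section \<open>Theta functions\<close>

text \<open>By definition \<open>jsn\<close> inverts an integral, while \<open>jTheta\<close> is a
  series in a nome computed from two complete integrals; nothing in the definitions links them. The
  link is therefore built backwards: start from \<open>t\<close>, form the modulus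
  \<open>tmod t\<close>, show that its nome is \<open>exp (- t)\<close>, and reach every modulus in
  (0,1) by the intermediate value theorem. Both limits of \<open>tmod\<close> come from one
  inequality, \<open>tmod (2 * t) <= (tmod t)^2\<close>. The equation
  \<open>f f'' - f'^2 = B (1 - f^4)\<close> degenerates at zeros of \<open>f\<close>. While
  \<open>f > 0\<close> it integrates once to a cubic second-order equation, for which uniqueness is
  elementary; hence the insistence on signs and first zeros. The same \<open>B\<close> governs both
  axes, and this is what ties K' to K. On the mKdV side, \<open>s0\<close> is an integration
  constant evaluated at 0, and \<open>cb\<close> is the speed for which
  \<open>s0 * (cc - cb) = bb\<close>, the condition that gives the weight its correct time
  derivative. The denominator \<open>c - 2 V\<close> is positive because its product with its own
  reflection \<open>x -> -x\<close> is.\<close>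

lemma summable_exp_minus_abs_int: "(\<lambda>n::int. exp (- \<bar>real_of_int n\<bar>)) summable_on UNIV"
proof -
  have nat: "(\<lambda>n::nat. exp (- real n)) summable_on UNIV"
  proof (rule norm_summable_imp_summable_on)
    have "(\<lambda>n::nat. exp (- real n)) = (\<lambda>n. exp (-1) ^ n)"
      by (simp add: fun_eq_iff flip: exp_of_nat_mult)
    then show "summable (\<lambda>n::nat. norm (exp (- real n)))"
      by (simp add: summable_geometric)
  qed
  have 1: "(\<lambda>n::int. exp (- \<bar>real_of_int n\<bar>)) summable_on range int"
    using nat by (subst summable_on_reindex) (auto simp: o_def)
  have 2: "(\<lambda>n::int. exp (- \<bar>real_of_int n\<bar>)) summable_on range (\<lambda>n. - int n)"
    using nat by (subst summable_on_reindex) (auto simp: o_def inj_on_def)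
  have "UNIV = range int \<union> range (\<lambda>n. - int n)"
    by (auto simp: image_iff) (metis int_cases2)
  then show ?thesis
    using summable_on_union[OF 1 2] by simp
qed

text \<open>Completing the square pushes the Gaussian below a constant times
  \<open>exp (- |n|)\<close>. The linear term \<open>r\<close> is there to absorb the imaginary part
  of the theta argument.\<close>

lemma summable_gauss_int:
  fixes a r t :: real
  assumes "t > 0"
  shows "(\<lambda>n::int. exp (r * \<bar>n + a\<bar> - t * (n + a)\<^sup>2)) summable_on UNIV"
proof (rule summable_on_comparison_test)
  let ?C = "exp ((r + 1)\<^sup>2 / (4 * t) + \<bar>a\<bar>)"
  show "(\<lambda>n::int. ?C * exp (- \<bar>real_of_int n\<bar>)) summable_on UNIV"
    by (intro summable_on_cmult_right summable_exp_minus_abs_int)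
  fix n :: int
  define x where "x = \<bar>n + a\<bar>"
  have "0 \<le> t * (x - (r + 1) / (2 * t))\<^sup>2"
    using assms by simp
  also have "\<dots> = t * x\<^sup>2 - (r + 1) * x + (r + 1)\<^sup>2 / (4 * t)"
    using assms by (simp add: field_simps power2_eq_square)
  finally have "r * x - t * x\<^sup>2 \<le> (r + 1)\<^sup>2 / (4 * t) - x"
    by (simp add: algebra_simps)
  moreover have "\<bar>real_of_int n\<bar> \<le> x + \<bar>a\<bar>" "x\<^sup>2 = (n + a)\<^sup>2"
    by (auto simp: x_def)
  ultimately have "r * \<bar>n + a\<bar> - t * (n + a)\<^sup>2 \<le> ((r + 1)\<^sup>2 / (4 * t) + \<bar>a\<bar>) + - \<bar>real_of_int n\<bar>"
    by (simp add: x_def)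
  then show "exp (r * \<bar>n + a\<bar> - t * (n + a)\<^sup>2) \<le> ?C * exp (- \<bar>real_of_int n\<bar>)"
    by (metis exp_add exp_le_cancel_iff)
qed auto

lemma abs_summable_times:
  fixes f g :: "'a \<Rightarrow> complex"
  assumes f: "(\<lambda>x. norm (f x)) summable_on A" and g: "(\<lambda>x. norm (g x)) summable_on B"
  shows "(\<lambda>p. norm (case p of (x, y) \<Rightarrow> f x * g y)) summable_on A \<times> B"
  unfolding Infinite_Sum.abs_summable_on_Sigma_iff using f g
  by (auto simp: norm_mult infsum_cmult_right' abs_mult
      intro!: summable_on_cmult_right summable_on_cmult_left)

lemma infsum_times:
  fixes f g :: "'a \<Rightarrow> complex"
  assumes f: "(\<lambda>x. norm (f x)) summable_on A" and g: "(\<lambda>x. norm (g x)) summable_on B"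
  shows "(\<Sum>\<^sub>\<infinity>(x, y)\<in>A \<times> B. f x * g y) = infsum f A * infsum g B"
proof -
  have "(\<lambda>(x, y). f x * g y) summable_on A \<times> B"
    by (rule abs_summable_summable[OF abs_summable_times[OF f g]])
  then have "(\<Sum>\<^sub>\<infinity>(x, y)\<in>A \<times> B. f x * g y) = (\<Sum>\<^sub>\<infinity>x\<in>A. \<Sum>\<^sub>\<infinity>y\<in>B. f x * g y)"
    by (subst infsum_Sigma_banach[symmetric]) auto
  then show ?thesis
    by (simp add: infsum_cmult_right' infsum_cmult_left')
qed

text \<open>With nome \<open>q = exp (-t)\<close>, \<open>th 0 t\<close> is \<open>\<theta>\<^sub>3\<close> and \<open>th (1/2) t\<close> is \<open>\<theta>\<^sub>2\<close>; the other two Jacobi theta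
  functions are their translates by \<open>\<pi>/2\<close>.\<close>

definition thterm :: "real \<Rightarrow> real \<Rightarrow> complex \<Rightarrow> int \<Rightarrow> complex" where
  "thterm a t z n = exp (of_real (- (t * (n + a)\<^sup>2)) + 2 * \<i> * of_real (n + a) * z)"

definition th :: "real \<Rightarrow> real \<Rightarrow> complex \<Rightarrow> complex" where
  "th a t z = infsum (thterm a t z) UNIV"

lemma norm_thterm: "norm (thterm a t z n) = exp (- (t * (n + a)\<^sup>2) - 2 * (n + a) * Im z)"
  by (simp add: thterm_def)

text \<open>A majorant uniform both in the strip of half-width \<open>R\<close> and in parameters at
  least \<open>\<delta>\<close>, so that one bound serves the Weierstrass test for holomorphy in
  \<open>z\<close> and for continuity in \<open>t\<close>.\<close>

lemma norm_thterm_le: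
  assumes "\<delta> \<le> t" "\<bar>Im z\<bar> \<le> R"
  shows "norm (thterm a t z n) \<le> exp (2 * R * \<bar>n + a\<bar> - \<delta> * (n + a)\<^sup>2)"
proof -
  have "- (2 * (n + a) * Im z) \<le> 2 * (\<bar>n + a\<bar> * \<bar>Im z\<bar>)"
    unfolding abs_mult[symmetric] mult.assoc using abs_ge_minus_self[of "(n + a) * Im z"] by linarith
  also have "\<dots> \<le> 2 * R * \<bar>n + a\<bar>"
    using mult_right_mono[OF assms(2), of "2 * \<bar>n + a\<bar>"] by (simp add: mult_ac)
  finally have "- (2 * (n + a) * Im z) \<le> 2 * R * \<bar>n + a\<bar>" .
  moreover have "\<delta> * (n + a)\<^sup>2 \<le> t * (n + a)\<^sup>2"
    by (intro mult_right_mono assms) auto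
  ultimately show ?thesis
    by (simp add: norm_thterm)
qed

lemma abs_summable_thterm: "t > 0 \<Longrightarrow> (\<lambda>n. norm (thterm a t z n)) summable_on A"
  by (rule Infinite_Sum.abs_summable_on_comparison_test'[OF summable_on_subset_banach[OF
        summable_gauss_int[of t "2 * \<bar>Im z\<bar>" a]]])
     (use norm_thterm_le[of t t z "\<bar>Im z\<bar>"] in auto)

lemma summable_thterm: "t > 0 \<Longrightarrow> thterm a t z summable_on A"
  by (rule abs_summable_summable[OF abs_summable_thterm])

lemma holomorphic_th:
  assumes "t > 0"
  shows "th a t holomorphic_on A"
proof -
  have "th a t holomorphic_on ball 0 R" for R
  proof (rule holomorphic_uniform_limit)
    show "uniform_limit (cball 0 R) (\<lambda>X z. \<Sum>n\<in>X. thterm a t z n) (th a t) (finite_subsets_at_top UNIV)"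
      unfolding th_def
    proof (rule Weierstrass_m_test_general)
      show "(\<lambda>n::int. exp (2 * R * \<bar>n + a\<bar> - t * (n + a)\<^sup>2)) summable_on UNIV"
        by (rule summable_gauss_int[OF assms])
      fix n :: int and z :: complex
      assume "z \<in> cball 0 R"
      then have "\<bar>Im z\<bar> \<le> R"
        using abs_Im_le_cmod[of z] by simp
      then show "norm (thterm a t z n) \<le> exp (2 * R * \<bar>n + a\<bar> - t * (n + a)\<^sup>2)"
        by (rule norm_thterm_le[OF order_refl])
    qed
    show "\<forall>\<^sub>F X in finite_subsets_at_top UNIV. continuous_on (cball 0 R) (\<lambda>z. \<Sum>n\<in>X. thterm a t z n)
        \<and> (\<lambda>z. \<Sum>n\<in>X. thterm a t z n) holomorphic_on ball 0 R"
      unfolding thterm_def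
      by (intro always_eventually allI conjI continuous_intros holomorphic_intros)
  qed auto
  then have "th a t holomorphic_on (\<Union>R. ball 0 R)"
    by (intro holomorphic_on_UN_open) auto
  moreover have "(\<Union>R. ball (0::complex) R) = UNIV"
    by (auto intro: gt_ex)
  ultimately show ?thesis
    by (metis holomorphic_on_subset subset_UNIV)
qed

text \<open>Needed for the intermediate value argument in \<open>tmod_surj\<close>.\<close>

lemma continuous_on_th_param: "continuous_on {0<..} (\<lambda>t. th a t z)"
proof -
  have "continuous_on {\<delta><..} (\<lambda>t. th a t z)" if "\<delta> > 0" for \<delta>
  proof (rule uniform_limit_theorem)
    show "uniform_limit {\<delta><..} (\<lambda>X t. \<Sum>n\<in>X. thterm a t z n) (\<lambda>t. th a t z) (finite_subsets_at_top UNIV)"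
      unfolding th_def
    proof (rule Weierstrass_m_test_general)
      show "(\<lambda>n::int. exp (2 * \<bar>Im z\<bar> * \<bar>n + a\<bar> - \<delta> * (n + a)\<^sup>2)) summable_on UNIV"
        by (rule summable_gauss_int[OF that])
    qed (auto intro: norm_thterm_le)
    show "\<forall>\<^sub>F X in finite_subsets_at_top UNIV. continuous_on {\<delta><..} (\<lambda>t. \<Sum>n\<in>X. thterm a t z n)"
      unfolding thterm_def by (intro always_eventually allI continuous_intros)
  qed auto
  then have "continuous_on (\<Union>\<delta>\<in>{0<..}. {\<delta><..}) (\<lambda>t. th a t z)"
    by (intro continuous_on_open_UN) auto
  moreover have "(\<Union>\<delta>\<in>{0<..}. {\<delta><..}) = ({0<..} :: real set)"
    by (auto simp: Bex_def intro: dense)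
  ultimately show ?thesis by simp
qed

section \<open>Symmetries of the theta series and translation by pi\<close>

lemma thterm_shift: "thterm (a + 1) t z n = thterm a t z (n + 1)"
  by (simp add: thterm_def algebra_simps)

lemma th_plus_one: "th (a + 1) t z = th a t z"
proof -
  have "bij (\<lambda>n::int. n + 1)"
    by (rule bij_plus_right)
  then show ?thesis
    unfolding th_def thterm_shift by (rule infsum_reindex_bij_betw)
qed

lemma th_uminus: "th a t (- z) = th (- a) t z"
proof -
  have "thterm a t (- z) = (\<lambda>n. thterm (- a) t z (- n))"
    by (simp add: fun_eq_iff thterm_def algebra_simps power2_eq_square)
  then show ?thesis
    unfolding th_def using infsum_reindex_bij_betw[OF bij_uminus, of "thterm (- a) t z"] by simp
qed

lemma cnj_th: "cnj (th a t z) = th (- a) t (cnj z)"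
proof -
  have "cnj (thterm a t z n) = thterm (- a) t (cnj z) (- n)" for n
    unfolding thterm_def exp_cnj by (rule arg_cong[of _ _ exp]) (simp add: algebra_simps power2_eq_square)
  then show ?thesis
    unfolding th_def infsum_cnj[symmetric]
    using infsum_reindex_bij_betw[OF bij_uminus, of "thterm (- a) t (cnj z)"] by simp
qed

lemma th0_uminus [simp]: "th 0 t (- z) = th 0 t z"
  by (simp add: th_uminus)

lemma th2_uminus [simp]: "th (1/2) t (- z) = th (1/2) t z"
  using th_plus_one[of "-1/2" t z] by (simp add: th_uminus)

lemma cnj_th0: "cnj (th 0 t z) = th 0 t (cnj z)"
  by (simp add: cnj_th)

lemma cnj_th2: "cnj (th (1/2) t z) = th (1/2) t (cnj z)"
  by (simp add: cnj_th flip: th_uminus)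

lemma th_plus_pi: "th a t (z + of_real pi) = exp (2 * pi * \<i> * a) * th a t z"
proof -
  have "thterm a t (z + of_real pi) = (\<lambda>n. exp (2 * pi * \<i> * a) * thterm a t z n)"
  proof
    fix n
    have "thterm a t (z + of_real pi) n = thterm a t z n * exp (2 * pi * \<i> * a) * exp (2 * pi * \<i> * n)"
      unfolding thterm_def exp_add[symmetric] by (rule arg_cong[of _ _ exp]) (simp add: algebra_simps)
    also have "exp (2 * pi * \<i> * n) = 1"
      using exp_integer_2pi[of "of_int n"] by (simp add: mult_ac)
    finally show "thterm a t (z + of_real pi) n = exp (2 * pi * \<i> * a) * thterm a t z n" by simp
  qed
  then show ?thesis
    by (simp add: th_def infsum_cmult_right')
qed

lemma th0_plus_pi: "th 0 t (z + of_real pi) = th 0 t z"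
  by (simp add: th_plus_pi)

lemma th2_plus_pi: "th (1/2) t (z + of_real pi) = - th (1/2) t z"
  by (simp add: th_plus_pi exp_pi_i')

section \<open>Bilinear relations between the parameters \<open>t\<close> and
  \<open>2 * t\<close>\<close>

lemma th_bilinear:
  assumes "t > 0"
  shows "th a t (x + y) * th a t (x - y) =
    th a (2*t) (2*x) * th 0 (2*t) (2*y) + th (a + 1/2) (2*t) (2*x) * th (1/2) (2*t) (2*y)"
proof -
  let ?P = "\<lambda>(m, n). thterm a t (x + y) m * thterm a t (x - y) n"
  \<comment> \<open>Index pairs are split by the parity of \<open>m + n\<close>. On the even part,
    \<open>(m + a)^2 + (n + a)^2 = 2 (j + a)^2 + 2 l^2\<close>; on the odd part the extra 1 in
    \<open>m\<close> shifts both \<open>j\<close> and \<open>l\<close> by 1/2.\<close>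
  let ?e = "\<lambda>(j, l). (j + l, j - l) :: int \<times> int" and ?o = "\<lambda>(j, l). (j + l + 1, j - l) :: int \<times> int"
  have summ: "(\<lambda>p. norm (?P p)) summable_on UNIV \<times> UNIV"
    by (intro abs_summable_times abs_summable_thterm assms)
  have inj: "inj ?e" "inj ?o"
    by (auto simp: inj_on_def)
  have cover: "UNIV \<times> UNIV = range ?e \<union> range ?o"
  proof (intro set_eqI iffI)
    fix p :: "int \<times> int"
    obtain m n where p: "p = (m, n)" by (cases p)
    show "p \<in> range ?e \<union> range ?o"
    proof (cases "even (m + n)")
      case True
      then have "p = ?e ((m + n) div 2, (m - n) div 2)"
        by (auto simp: p elim!: evenE) presburger+
      then show ?thesis by blast
    next
      case False
      then have "p = ?o ((m + n - 1) div 2, (m - n - 1) div 2)"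
        by (auto simp: p) presburger+
      then show ?thesis by blast
    qed
  qed auto
  have disj: "range ?e \<inter> range ?o = {}"
    by auto presburger
  have e: "?P (?e (j, l)) = thterm a (2*t) (2*x) j * thterm 0 (2*t) (2*y) l" for j l
    by (simp add: thterm_def algebra_simps power2_eq_square flip: exp_add)
  have o: "?P (?o (j, l)) = thterm (a + 1/2) (2*t) (2*x) j * thterm (1/2) (2*t) (2*y) l" for j l
    by (simp add: thterm_def algebra_simps power2_eq_square flip: exp_add)
  have "th a t (x + y) * th a t (x - y) = infsum ?P (UNIV \<times> UNIV)"
    unfolding th_def by (rule infsum_times[symmetric]; intro abs_summable_thterm assms)
  also have "\<dots> = infsum ?P (range ?e) + infsum ?P (range ?o)"
    unfolding cover using summ[THEN abs_summable_summable]
    by (intro infsum_Un_disjoint disj) (auto elim: summable_on_subset_banach)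
  also have "infsum ?P (range ?e) = infsum (\<lambda>(j, l). thterm a (2*t) (2*x) j * thterm 0 (2*t) (2*y) l) (UNIV \<times> UNIV)"
    unfolding infsum_reindex[OF inj(1)] using e by (simp add: o_def case_prod_unfold)
  also have "\<dots> = th a (2*t) (2*x) * th 0 (2*t) (2*y)"
    unfolding th_def using assms by (intro infsum_times abs_summable_thterm) auto
  also have "infsum ?P (range ?o) = infsum (\<lambda>(j, l). thterm (a + 1/2) (2*t) (2*x) j * thterm (1/2) (2*t) (2*y) l) (UNIV \<times> UNIV)"
    unfolding infsum_reindex[OF inj(2)] using o by (simp add: o_def case_prod_unfold)
  also have "\<dots> = th (a + 1/2) (2*t) (2*x) * th (1/2) (2*t) (2*y)"
    unfolding th_def using assms by (intro infsum_times abs_summable_thterm) auto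
  finally show ?thesis .
qed

lemma th0_bilinear:
  assumes "t > 0"
  shows "th 0 t (x + y) * th 0 t (x - y) =
    th 0 (2*t) (2*x) * th 0 (2*t) (2*y) + th (1/2) (2*t) (2*x) * th (1/2) (2*t) (2*y)"
  using th_bilinear[OF assms, of 0 x y] by simp

lemma th2_bilinear:
  assumes "t > 0"
  shows "th (1/2) t (x + y) * th (1/2) t (x - y) =
    th (1/2) (2*t) (2*x) * th 0 (2*t) (2*y) + th 0 (2*t) (2*x) * th (1/2) (2*t) (2*y)"
  using th_bilinear[OF assms, of "1/2" x y] th_plus_one[of 0 "2*t" "2*x"] by simp

lemma th0_duplication:
  assumes "t > 0"
  shows "th 0 t x * th 0 t 0 = (th 0 (2*t) x)\<^sup>2 + (th (1/2) (2*t) x)\<^sup>2"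
  using th0_bilinear[OF assms, of "x/2" "x/2"] by (simp add: power2_eq_square)

lemma th2_duplication:
  assumes "t > 0"
  shows "th (1/2) t x * th (1/2) t 0 = 2 * th 0 (2*t) x * th (1/2) (2*t) x"
  using th2_bilinear[OF assms, of "x/2" "x/2"] by (simp add: mult_ac)

text \<open>Evenness and the sign change under translation by pi make this value its own
  negative.\<close>

lemma th2_half_pi [simp]: "th (1/2) t (of_real (pi/2)) = 0"
proof -
  have *: "- of_real (pi/2) + of_real pi = (of_real (pi/2) :: complex)"
    by (simp add: field_simps)
  have "th (1/2) t (- of_real (pi/2) + of_real pi) = - th (1/2) t (of_real (pi/2))"
    unfolding th2_plus_pi th2_uminus ..
  then show ?thesis
    unfolding * by (simp del: of_real_divide)
qed

text \<open>Translated by pi/2, \<open>th 0\<close> is theta_4. With \<open>x = z + pi/4\<close> and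
  \<open>y = pi/4\<close> the second bilinear product contains theta_2 at its zero pi/2 and drops
  out, leaving a relation that doubles \<open>z\<close> together with \<open>t\<close>.\<close>

lemma th4_duplication:
  assumes "t > 0"
  shows "th 0 t (z + of_real (pi/2)) * th 0 t z = th 0 (2*t) (2*z + of_real (pi/2)) * th 0 (2*t) (of_real (pi/2))"
proof -
  have "2 * (of_real (pi/4) :: complex) = of_real (pi/2)" by simp
  then show ?thesis
    using th0_bilinear[OF assms, of "z + of_real (pi/4)" "of_real (pi/4)"]
    by (simp add: distrib_left add.assoc del: of_real_divide flip: of_real_add)
qed

section \<open>Reality, positivity and absence of zeros\<close>

lemma th_real:
  "th 0 t (of_real x) \<in> \<real>" "th (1/2) t (of_real x) \<in> \<real>"
  "th 0 t (\<i> * of_real x) \<in> \<real>" "th (1/2) t (\<i> * of_real x) \<in> \<real>"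
  by (simp_all add: Reals_cnj_iff cnj_th0 cnj_th2)

text \<open>Every term of the series is a positive real number on the imaginary axis.\<close>

lemma Re_th_imag_pos:
  assumes "t > 0"
  shows "Re (th a t (\<i> * of_real y)) > 0"
proof -
  have term_eq: "Re (thterm a t (\<i> * of_real y) n) = exp (- (t * (n + a)\<^sup>2) - 2 * (n + a) * y)" for n
    by (simp add: thterm_def Re_exp)
  have summ: "(\<lambda>n. Re (thterm a t (\<i> * of_real y) n)) summable_on UNIV"
    by (intro summable_on_Re summable_thterm assms)
  have "Re (th a t (\<i> * of_real y)) = infsum (\<lambda>n. Re (thterm a t (\<i> * of_real y) n)) UNIV"
    unfolding th_def by (rule infsum_Re[symmetric]) (rule summable_thterm[OF assms])
  moreover have "infsum (\<lambda>n. Re (thterm a t (\<i> * of_real y) n)) UNIV > 0"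
    using nonneg_infsum_le_0D[OF _ summ, of 0] by (force simp: term_eq)
  ultimately show ?thesis by simp
qed

lemma Re_th_zero_pos: "t > 0 \<Longrightarrow> Re (th a t 0) > 0"
  using Re_th_imag_pos[of t a 0] by simp

text \<open>Write \<open>T = (T - 1) + 1\<close>: the share \<open>T - 1\<close> of the exponent
  gives the decaying factor \<open>exp (- (T - 1) * \<delta>)\<close>, and the remaining share keeps
  the sum finite.\<close>

lemma tail_tendsto_0:
  fixes f :: "real \<Rightarrow> int \<Rightarrow> complex" and c :: "int \<Rightarrow> real"
  assumes \<delta>: "\<delta> > 0" "\<And>n. n \<in> A \<Longrightarrow> \<delta> \<le> c n"
    and summ: "(\<lambda>n. exp (- c n)) summable_on A"
    and f: "\<And>T n. T \<ge> 1 \<Longrightarrow> n \<in> A \<Longrightarrow> norm (f T n) \<le> exp (- T * c n)"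
  shows "((\<lambda>T. infsum (f T) A) \<longlongrightarrow> 0) at_top"
proof (rule Lim_null_comparison)
  let ?S = "infsum (\<lambda>n. exp (- c n)) A"
  have "norm (infsum (f T) A) \<le> exp (- (T - 1) * \<delta>) * ?S" if "T \<ge> 1" for T
  proof (rule norm_infsum_le[OF has_sum_infsum])
    have le: "norm (f T n) \<le> exp (- (T - 1) * \<delta>) * exp (- c n)" if "n \<in> A" for n
    proof -
      have "(T - 1) * \<delta> \<le> (T - 1) * c n"
        using \<open>T \<ge> 1\<close> \<delta>(2)[OF that] by (intro mult_left_mono) auto
      then have "exp (- T * c n) \<le> exp (- (T - 1) * \<delta>) * exp (- c n)"
        by (simp add: algebra_simps flip: exp_add)
      then show ?thesis using f[OF \<open>T \<ge> 1\<close> that] by simp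
    qed
    show "((\<lambda>n. exp (- (T - 1) * \<delta>) * exp (- c n)) has_sum exp (- (T - 1) * \<delta>) * ?S) A"
      by (intro has_sum_cmult_right has_sum_infsum summ)
    show "norm (f T n) \<le> exp (- (T - 1) * \<delta>) * exp (- c n)" if "n \<in> A" for n
      by (rule le[OF that])
    have "(\<lambda>n. norm (f T n)) summable_on A"
      by (rule Infinite_Sum.abs_summable_on_comparison_test'[OF summable_on_cmult_right[OF summ] le])
    then show "f T summable_on A"
      by (rule abs_summable_summable)
  qed
  then show "\<forall>\<^sub>F T in at_top. norm (infsum (f T) A) \<le> exp (- (T - 1) * \<delta>) * ?S"
    by (intro eventually_at_top_linorderI[of 1])
  have "((\<lambda>T. exp (- (T - 1) * \<delta>)) \<longlongrightarrow> 0) at_top"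
    using \<delta>(1) by real_asymp
  then show "((\<lambda>T. exp (- (T - 1) * \<delta>) * ?S) \<longlongrightarrow> 0) at_top"
    by (rule tendsto_mult_left_zero)
qed

lemma int_sq_ge_abs: "\<bar>real_of_int n\<bar> \<le> (real_of_int n)\<^sup>2"
proof -
  have "1 * \<bar>real_of_int n\<bar> \<le> \<bar>real_of_int n\<bar> * \<bar>real_of_int n\<bar>" if "n \<noteq> 0"
    using that by (intro mult_right_mono) auto
  then show ?thesis
    by (cases "n = 0") (auto simp: power2_eq_square)
qed

text \<open>The imaginary part is allowed to grow like \<open>T\<close> because
  \<open>th4_duplication\<close> doubles the argument along with the parameter. For
  \<open>|a| < 1/2\<close> the exponent \<open>n^2 - 2 |a| |n|\<close> is positive for all nonzero
  \<open>n\<close>, so only the term \<open>n = 0\<close> survives.\<close>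

lemma th0_tendsto_1:
  assumes "\<bar>a\<bar> < 1/2"
  shows "((\<lambda>T. th 0 T (\<i> * of_real (a * T) + of_real x)) \<longlongrightarrow> 1) at_top"
proof -
  let ?f = "\<lambda>T. thterm 0 T (\<i> * of_real (a * T) + of_real x)"
  have "((\<lambda>T. infsum (?f T) (- {0})) \<longlongrightarrow> 0) at_top"
  proof (rule tail_tendsto_0[where c = "\<lambda>n. (real_of_int n)\<^sup>2 - 2 * \<bar>a\<bar> * \<bar>real_of_int n\<bar>"])
    show "1 - 2 * \<bar>a\<bar> > 0" using assms by simp
    show "1 - 2 * \<bar>a\<bar> \<le> (real_of_int n)\<^sup>2 - 2 * \<bar>a\<bar> * \<bar>real_of_int n\<bar>" if "n \<in> - {0}" for n
    proof -
      have "1 \<le> \<bar>real_of_int n\<bar>" using that by auto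
      then have "(1 - 2 * \<bar>a\<bar>) * 1 \<le> (1 - 2 * \<bar>a\<bar>) * \<bar>real_of_int n\<bar>"
        using assms by (intro mult_left_mono) auto
      then show ?thesis using int_sq_ge_abs[of n] by (simp add: algebra_simps)
    qed
    show "(\<lambda>n. exp (- ((real_of_int n)\<^sup>2 - 2 * \<bar>a\<bar> * \<bar>real_of_int n\<bar>))) summable_on - {0}"
      using summable_on_subset_banach[OF summable_gauss_int[of 1 "2 * \<bar>a\<bar>" 0], of "- {0}"] by simp
    show "norm (?f T n) \<le> exp (- T * ((real_of_int n)\<^sup>2 - 2 * \<bar>a\<bar> * \<bar>real_of_int n\<bar>))" if "T \<ge> 1" for T n
      using norm_thterm_le[of T T "\<i> * of_real (a * T) + of_real x" "\<bar>a\<bar> * T" 0 n] that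
      by (simp add: abs_mult algebra_simps)
  qed
  then have "((\<lambda>T. 1 + infsum (?f T) (- {0})) \<longlongrightarrow> 1 + 0) at_top"
    by (intro tendsto_intros)
  moreover have "\<forall>\<^sub>F T in at_top. 1 + infsum (?f T) (- {0}) = th 0 T (\<i> * of_real (a * T) + of_real x)"
  proof (rule eventually_at_top_linorderI[of 1])
    fix T :: real assume "T \<ge> 1"
    then have "infsum (?f T) ({0} \<union> - {0}) = infsum (?f T) {0} + infsum (?f T) (- {0})"
      by (intro infsum_Un_disjoint summable_thterm) auto
    then show "1 + infsum (?f T) (- {0}) = th 0 T (\<i> * of_real (a * T) + of_real x)"
      by (simp add: th_def) (simp add: thterm_def)
  qed
  ultimately show ?thesis
    by (simp add: tendsto_cong)
qed

text \<open>The factor \<open>exp (T / 4)\<close> normalises the leading terms \<open>n = 0\<close>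
  and \<open>n = -1\<close>, which add up to \<open>2 * cos x\<close>; for all other
  \<open>n\<close> the square \<open>(n + 1/2)^2\<close> exceeds 1/4 by a fixed margin.\<close>

lemma th2_tendsto_cos:
  "((\<lambda>T. of_real (exp (T / 4)) * th (1/2) T (of_real x)) \<longlongrightarrow> of_real (2 * cos x)) at_top"
proof -
  let ?f = "\<lambda>T n. of_real (exp (T / 4)) * thterm (1/2) T (of_real x) n"
  have "((\<lambda>T. infsum (?f T) (- {0, -1})) \<longlongrightarrow> 0) at_top"
  proof (rule tail_tendsto_0[where c = "\<lambda>n. (real_of_int n + 1/2)\<^sup>2 - 1/4"])
    show "1 \<le> (real_of_int n + 1/2)\<^sup>2 - 1/4" if "n \<in> - {0, -1}" for n
    proof -
      have "n \<ge> 1 \<or> n \<le> -2" using that by auto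
      then have "3/2 \<le> \<bar>real_of_int n + 1/2\<bar>" by linarith
      from power_mono[OF this, of 2] show ?thesis by (simp add: power2_eq_square)
    qed
    show "(\<lambda>n. exp (- ((real_of_int n + 1/2)\<^sup>2 - 1/4))) summable_on - {0, -1}"
      using summable_on_cmult_right[OF summable_on_subset_banach[OF summable_gauss_int[of 1 0 "1/2"], of "- {0, -1}"],
          of "exp (1/4)"] by (simp flip: exp_add)
    show "norm (?f T n) \<le> exp (- T * ((real_of_int n + 1/2)\<^sup>2 - 1/4))" for T n
      by (simp add: norm_mult norm_thterm algebra_simps flip: exp_add)
  qed simp
  then have "((\<lambda>T. of_real (2 * cos x) + infsum (?f T) (- {0, -1})) \<longlongrightarrow> of_real (2 * cos x) + 0) at_top"
    by (intro tendsto_intros)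
  moreover have "\<forall>\<^sub>F T in at_top. of_real (2 * cos x) + infsum (?f T) (- {0, -1})
      = of_real (exp (T / 4)) * th (1/2) T (of_real x)"
  proof (rule eventually_at_top_linorderI[of 1])
    fix T :: real assume "T \<ge> 1"
    then have "infsum (?f T) ({0, -1} \<union> - {0, -1}) = infsum (?f T) {0, -1} + infsum (?f T) (- {0, -1})"
      by (intro infsum_Un_disjoint summable_on_cmult_right summable_thterm) auto
    moreover have "infsum (?f T) {0, -1} = of_real (2 * cos x)"
    proof -
      have "?f T 0 = exp (\<i> * x)" "?f T (-1) = exp (- (\<i> * x))"
        unfolding thterm_def exp_of_real[symmetric] exp_add[symmetric]
        by (rule arg_cong[of _ _ exp], simp add: field_simps power2_eq_square)+
      then show ?thesis
        by (simp add: complex_eq_iff Re_exp Im_exp)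
    qed
    ultimately show "of_real (2 * cos x) + infsum (?f T) (- {0, -1}) = of_real (exp (T / 4)) * th (1/2) T (of_real x)"
      by (simp add: th_def infsum_cmult_right')
  qed
  ultimately show ?thesis
    by (simp add: tendsto_cong)
qed

lemma filterlim_doubling: "t > 0 \<Longrightarrow> filterlim (\<lambda>m::nat. 2 ^ m * t :: real) at_top sequentially"
  by real_asymp

text \<open>On the real axis \<open>th0_duplication\<close> writes the value, up to the factor
  \<open>th 0 t 0\<close>, as a sum of two real squares. A zero at \<open>t\<close> thus forces a
  zero at \<open>2 * t\<close>, against the limit 1.\<close>

lemma th0_real_neq_0:
  assumes "t > 0"
  shows "th 0 t (of_real x) \<noteq> 0"
proof
  assume zero: "th 0 t (of_real x) = 0"
  have "th 0 (2 ^ m * t) (of_real x) = 0" for m :: nat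
  proof (induction m)
    case (Suc m)
    let ?t = "2 * (2 ^ m * t)"
    have "(th 0 ?t (of_real x))\<^sup>2 + (th (1/2) ?t (of_real x))\<^sup>2 = 0"
      using th0_duplication[of "2 ^ m * t" "of_real x"] Suc assms by simp
    moreover obtain u v where uv: "th 0 ?t (of_real x) = of_real u" "th (1/2) ?t (of_real x) = of_real v"
      by (metis Reals_cases th_real(1,2))
    ultimately have "u\<^sup>2 + v\<^sup>2 = 0"
      by (metis of_real_add of_real_eq_0_iff of_real_power)
    then show ?case using uv by (simp add: mult_ac sum_power2_eq_zero_iff)
  qed (use zero in simp)
  moreover have "(\<lambda>m. th 0 (2 ^ m * t) (of_real x)) \<longlonglongrightarrow> 1"
    using filterlim_compose[OF th0_tendsto_1[of 0 x] filterlim_doubling[OF assms]] by simp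
  ultimately show False
    by (simp add: LIMSEQ_const_iff)
qed

lemma Re_th0_real_pos:
  assumes "t > 0"
  shows "Re (th 0 t (of_real x)) > 0"
proof -
  obtain u v w z where uv: "th 0 (2*t) (of_real x) = of_real u" "th (1/2) (2*t) (of_real x) = of_real v"
      "th 0 t (of_real x) = of_real w" "th 0 t 0 = of_real z"
    by (metis Reals_cases th_real(1,2) of_real_0)
  have "w * z = u\<^sup>2 + v\<^sup>2"
    using th0_duplication[OF assms, of "of_real x"] unfolding uv
    by (metis of_real_add of_real_eq_iff of_real_mult of_real_power)
  then have "w * z \<ge> 0" by simp
  moreover have "z > 0" "w \<noteq> 0"
    using Re_th_zero_pos[OF assms, of 0] th0_real_neq_0[OF assms, of x] uv by auto
  ultimately show ?thesis
    using uv by (simp add: zero_le_mult_iff)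
qed

text \<open>Here a sign is propagated instead of a zero: the other factors in
  \<open>th2_duplication\<close> are positive, so a nonpositive value persists under doubling,
  against the limit \<open>2 * cos x > 0\<close>.\<close>

lemma Re_th2_real_pos:
  assumes "t > 0" "\<bar>x\<bar> < pi/2"
  shows "Re (th (1/2) t (of_real x)) > 0"
proof (rule ccontr)
  assume neg: "\<not> Re (th (1/2) t (of_real x)) > 0"
  have le: "Re (th (1/2) (2 ^ m * t) (of_real x)) \<le> 0" for m :: nat
  proof (induction m)
    case (Suc m)
    let ?s = "2 ^ m * t"
    have "?s > 0" using assms by simp
    obtain u v w z where uv: "th 0 (2 * ?s) (of_real x) = of_real u" "th (1/2) (2 * ?s) (of_real x) = of_real v"
        "th (1/2) ?s (of_real x) = of_real w" "th (1/2) ?s 0 = of_real z"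
      by (metis Reals_cases th_real(1,2) of_real_0)
    have "of_real (w * z) = (of_real (2 * u * v) :: complex)"
      using th2_duplication[OF \<open>?s > 0\<close>, of "of_real x"] unfolding uv by simp
    then have "w * z = 2 * u * v"
      by (simp only: of_real_eq_iff)
    moreover have "z > 0" "u > 0"
      using Re_th_zero_pos[OF \<open>?s > 0\<close>, of "1/2"] Re_th0_real_pos[of "2 * ?s" x] \<open>?s > 0\<close> uv by auto
    moreover have "w \<le> 0" using Suc uv by simp
    ultimately have "u * v \<le> 0"
      by (metis (no_types, lifting) mult.assoc mult_le_0_iff less_eq_real_def mult_nonpos_nonneg zero_less_numeral not_less)
    then have "v \<le> 0" using \<open>u > 0\<close> by (simp add: mult_le_0_iff)
    then show ?case using uv by (simp add: mult_ac)
  qed (use neg in simp)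
  have "(\<lambda>m. Re (of_real (exp (2 ^ m * t / 4)) * th (1/2) (2 ^ m * t) (of_real x))) \<longlonglongrightarrow> Re (of_real (2 * cos x))"
    by (intro tendsto_Re filterlim_compose[OF th2_tendsto_cos filterlim_doubling] assms)
  then have "Re (of_real (2 * cos x)) \<le> 0"
    by (rule LIMSEQ_le_const2) (use le in \<open>auto intro!: mult_nonneg_nonpos exI[of _ 0]\<close>)
  moreover have "- (pi/2) < x" "x < pi/2"
    using assms(2) by linarith+
  ultimately show False
    using cos_gt_zero_pi[of x] by simp
qed

text \<open>Theta_4 on the imaginary axis below height \<open>t/2\<close>. The ratio
  \<open>y / t\<close> is invariant under doubling, so \<open>th0_tendsto_1\<close> applies with
  \<open>a = y / t\<close>.\<close>

lemma th4_imag_neq_0: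
  assumes "t > 0" "\<bar>y\<bar> < t/2"
  shows "th 0 t (\<i> * of_real y + of_real (pi/2)) \<noteq> 0"
proof
  assume zero: "th 0 t (\<i> * of_real y + of_real (pi/2)) = 0"
  have zeros: "th 0 (2 ^ m * t) (\<i> * of_real (2 ^ m * y) + of_real (pi/2)) = 0" for m :: nat
  proof (induction m)
    case (Suc m)
    let ?s = "2 ^ m * t"
    have "?s > 0" using assms by simp
    then have "th 0 (2 * ?s) (of_real (pi/2)) \<noteq> 0"
      by (intro th0_real_neq_0) simp
    then have "th 0 (2 * ?s) (2 * (\<i> * of_real (2 ^ m * y)) + of_real (pi/2)) = 0"
      using th4_duplication[OF \<open>?s > 0\<close>, of "\<i> * of_real (2 ^ m * y)"] Suc
      by (metis mult_eq_0_iff)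
    then show ?case by (simp add: mult_ac)
  qed (use zero in simp)
  have "\<bar>y / t\<bar> < 1/2" using assms by (simp add: field_simps)
  then have "(\<lambda>m. th 0 (2 ^ m * t) (\<i> * of_real (y / t * (2 ^ m * t)) + of_real (pi/2))) \<longlonglongrightarrow> 1"
    by (intro filterlim_compose[OF th0_tendsto_1 filterlim_doubling] assms)
  moreover have "y / t * (2 ^ m * t) = 2 ^ m * y" for m using assms by simp
  ultimately show False
    by (simp only: zeros LIMSEQ_const_iff) simp
qed

section \<open>Differential relations between theta_3 and theta_2\<close>

lemma bilinear_second_deriv:
  fixes H P Q :: "complex \<Rightarrow> complex"
  assumes holo: "H holomorphic_on UNIV" "P holomorphic_on UNIV" "Q holomorphic_on UNIV"
    and eq: "\<And>y. H (x + y) * H (x - y) = u * P y + v * Q y"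
  shows "2 * (H x * deriv (deriv H) x - (deriv H x)\<^sup>2) = u * deriv (deriv P) 0 + v * deriv (deriv Q) 0"
proof -
  have D1: "(f has_field_derivative deriv f z) (at z)" if "f holomorphic_on UNIV" for f :: "complex \<Rightarrow> complex" and z
    using holomorphic_derivI[OF that, of z UNIV] by simp
  have D2: "(deriv f has_field_derivative deriv (deriv f) z) (at z)" if "f holomorphic_on UNIV" for f :: "complex \<Rightarrow> complex" and z
    by (rule D1) (intro holomorphic_deriv that open_UNIV)
  have add: "((\<lambda>y. f (x + y)) has_field_derivative f') (at y)" if "(f has_field_derivative f') (at (x + y))" for f f' y
    using that DERIV_shift[of f f' y x] by (simp add: add.commute)
  have sub: "((\<lambda>y. f (x - y)) has_field_derivative - f') (at y)" if "(f has_field_derivative f') (at (x - y))" for f f' y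
  proof -
    have "((\<lambda>y. x - y) has_field_derivative -1) (at y)"
      by (auto intro!: derivative_eq_intros)
    from DERIV_chain2[where f = f, OF that this] show ?thesis by simp
  qed
  note D = D1[OF holo(1)] D2[OF holo(1)] D1[OF holo(2)] D2[OF holo(2)] D1[OF holo(3)] D2[OF holo(3)]
  have 1: "deriv H (x + y) * H (x - y) - H (x + y) * deriv H (x - y) = u * deriv P y + v * deriv Q y" for y
  proof (rule DERIV_unique)
    show "((\<lambda>y. H (x + y) * H (x - y)) has_field_derivative
        deriv H (x + y) * H (x - y) - H (x + y) * deriv H (x - y)) (at y)"
      by (rule derivative_eq_intros add sub D refl)+ simp
    show "((\<lambda>y. H (x + y) * H (x - y)) has_field_derivative u * deriv P y + v * deriv Q y) (at y)"
      unfolding eq by (rule derivative_eq_intros D refl)+ simp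
  qed
  \<comment> \<open>Second derivative in \<open>y\<close> at 0. The two factors move in opposite
    directions, so the left side collapses to \<open>2 (H H'' - H'^2)\<close>.\<close>
  have 2: "deriv (deriv H) (x + 0) * H (x - 0) - 2 * deriv H (x + 0) * deriv H (x - 0) + H (x + 0) * deriv (deriv H) (x - 0)
      = u * deriv (deriv P) 0 + v * deriv (deriv Q) 0"
  proof (rule DERIV_unique)
    show "((\<lambda>y. deriv H (x + y) * H (x - y) - H (x + y) * deriv H (x - y)) has_field_derivative
        deriv (deriv H) (x + 0) * H (x - 0) - 2 * deriv H (x + 0) * deriv H (x - 0) + H (x + 0) * deriv (deriv H) (x - 0)) (at 0)"
      by (rule derivative_eq_intros add sub D refl)+ (simp add: algebra_simps)
    show "((\<lambda>y. deriv H (x + y) * H (x - y) - H (x + y) * deriv H (x - y)) has_field_derivative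
        u * deriv (deriv P) 0 + v * deriv (deriv Q) 0) (at 0)"
      unfolding 1 by (rule derivative_eq_intros D refl)+ simp
  qed
  then show ?thesis
    by (simp add: power2_eq_square algebra_simps)
qed

text \<open>Along the line the imaginary part vanishes identically, hence so does its derivative.
  Used with \<open>\<omega>\<close> equal to 1 and to \<open>\<i>\<close>.\<close>

lemma restrict_to_line:
  assumes "H holomorphic_on UNIV" and real: "\<And>y. H (\<omega> * of_real y) \<in> \<real>"
  shows "((\<lambda>y. Re (H (\<omega> * of_real y))) has_real_derivative Re (\<omega> * deriv H (\<omega> * of_real y))) (at y)"
    and "\<omega> * deriv H (\<omega> * of_real y) \<in> \<real>"
proof -
  have "((\<lambda>z. H (\<omega> * z)) has_field_derivative \<omega> * deriv H (\<omega> * of_real y)) (at (of_real y))"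
  proof -
    have "((\<lambda>z. \<omega> * z) has_field_derivative \<omega>) (at (of_real y))"
      by (auto intro!: derivative_eq_intros)
    from DERIV_chain2[where f = H, OF holomorphic_derivI[OF assms(1) open_UNIV UNIV_I] this]
    show ?thesis by (simp only: mult.commute)
  qed
  then have D: "((\<lambda>y. H (\<omega> * of_real y)) has_vector_derivative \<omega> * deriv H (\<omega> * of_real y)) (at y)"
    by (rule has_vector_derivative_real_field)
  show "((\<lambda>y. Re (H (\<omega> * of_real y))) has_real_derivative Re (\<omega> * deriv H (\<omega> * of_real y))) (at y)"
    using bounded_linear.has_vector_derivative[OF bounded_linear_Re D]
    by (simp add: has_real_derivative_iff_has_vector_derivative)
  have "((\<lambda>y. Im (H (\<omega> * of_real y))) has_real_derivative Im (\<omega> * deriv H (\<omega> * of_real y))) (at y)"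
    using bounded_linear.has_vector_derivative[OF bounded_linear_Im D]
    by (simp add: has_real_derivative_iff_has_vector_derivative)
  moreover have "(\<lambda>y. Im (H (\<omega> * of_real y))) = (\<lambda>_. 0)"
    using real by (auto simp: complex_is_Real_iff)
  ultimately have "Im (\<omega> * deriv H (\<omega> * of_real y)) = 0"
    using DERIV_unique[OF _ DERIV_const] by metis
  then show "\<omega> * deriv H (\<omega> * of_real y) \<in> \<real>"
    by (simp only: complex_is_Real_iff)
qed

lemma restrict_to_line2:
  assumes H: "H holomorphic_on UNIV" and real: "\<And>y. H (\<omega> * of_real y) \<in> \<real>"
  shows "((\<lambda>y. Re (\<omega> * deriv H (\<omega> * of_real y))) has_real_derivative Re (\<omega>\<^sup>2 * deriv (deriv H) (\<omega> * of_real y))) (at y)"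
    and "\<omega>\<^sup>2 * deriv (deriv H) (\<omega> * of_real y) \<in> \<real>"
proof -
  have holo: "(\<lambda>z. \<omega> * deriv H z) holomorphic_on UNIV"
    by (intro holomorphic_intros holomorphic_deriv H open_UNIV)
  have "deriv H field_differentiable at z" for z
    using holomorphic_deriv[OF H open_UNIV] by (simp add: holomorphic_on_def)
  then have "deriv (\<lambda>z. \<omega> * deriv H z) = (\<lambda>z. \<omega> * deriv (deriv H) z)"
    by (intro ext deriv_cmult)
  then show "((\<lambda>y. Re (\<omega> * deriv H (\<omega> * of_real y))) has_real_derivative Re (\<omega>\<^sup>2 * deriv (deriv H) (\<omega> * of_real y))) (at y)"
    and "\<omega>\<^sup>2 * deriv (deriv H) (\<omega> * of_real y) \<in> \<real>"
    using restrict_to_line[of "\<lambda>z. \<omega> * deriv H z" \<omega> y, OF holo restrict_to_line(2)[OF H real]]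
    by (simp_all add: power2_eq_square mult.assoc)
qed

lemma th_real_on_axes:
  assumes "\<omega> \<in> {1, \<i>}"
  shows "th 0 t (\<omega> * of_real y) \<in> \<real>" "th (1/2) t (\<omega> * of_real y) \<in> \<real>"
  using assms th_real by auto

lemma th4_zero_square:
  assumes "t > 0"
  shows "(th 0 t (of_real (pi/2)))\<^sup>2 = (th 0 (2*t) 0)\<^sup>2 - (th (1/2) (2*t) 0)\<^sup>2"
  using th0_bilinear[OF assms, of "of_real (pi/2)" 0] th0_plus_pi[of "2*t" 0] th2_plus_pi[of "2*t" 0]
  by (simp add: power2_eq_square)

text \<open>All squares are expressed through the thetas of parameter \<open>2 * t\<close>, which
  leaves a polynomial identity. It shows that theta_2/theta_3 can take the value
  theta_3(0)/theta_2(0) only where theta_4 vanishes.\<close>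

lemma th4_square:
  assumes "t > 0"
  shows "(th 0 t (of_real (pi/2)))\<^sup>2 * (th 0 t (z + of_real (pi/2)))\<^sup>2
    = (th 0 t 0)\<^sup>2 * (th 0 t z)\<^sup>2 - (th (1/2) t 0)\<^sup>2 * (th (1/2) t z)\<^sup>2"
proof -
  define X Y p r where XY: "X = th 0 (2*t) (2*z)" "Y = th (1/2) (2*t) (2*z)" "p = th 0 (2*t) 0" "r = th (1/2) (2*t) 0"
  have "2 * (z + of_real (pi/2)) = 2 * z + of_real pi" by simp
  then have "(th 0 t (z + of_real (pi/2)))\<^sup>2 = X * p - Y * r"
    using th0_bilinear[OF assms, of "z + of_real (pi/2)" 0] th0_plus_pi[of "2*t" "2*z"] th2_plus_pi[of "2*t" "2*z"]
    by (simp add: power2_eq_square XY)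
  moreover have "(th 0 t z)\<^sup>2 = X * p + Y * r" "(th (1/2) t z)\<^sup>2 = Y * p + X * r"
      "(th 0 t 0)\<^sup>2 = p * p + r * r" "(th (1/2) t 0)\<^sup>2 = 2 * p * r"
    using th0_bilinear[OF assms, of z 0] th2_bilinear[OF assms, of z 0]
      th0_bilinear[OF assms, of 0 0] th2_bilinear[OF assms, of 0 0] by (simp_all add: power2_eq_square XY)
  moreover have "(p\<^sup>2 - r\<^sup>2) * (X * p - Y * r) = (p * p + r * r) * (X * p + Y * r) - 2 * p * r * (Y * p + X * r)"
    by algebra
  ultimately show ?thesis
    unfolding th4_zero_square[OF assms] XY(3,4)[symmetric] by (simp only:)
qed

text \<open>The squares of the two thetas (the bilinear relations at \<open>y = 0\<close>) and the
  expressions \<open>H H'' - H'^2\<close> (their second \<open>y\<close>-derivative at 0) are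
  combinations of the same two functions \<open>X\<close> and \<open>Y\<close>. Eliminating these by
  Cramer's rule gives \<open>A\<close> and \<open>B\<close>; the determinant
  \<open>p^2 - r^2\<close> is the square of theta_4 at 0, hence nonzero.\<close>

lemma theta_second_deriv:
  assumes t: "t > 0"
  obtains A B :: real where
    "\<And>z. th 0 t z * deriv (deriv (th 0 t)) z - (deriv (th 0 t) z)\<^sup>2 = A * (th 0 t z)\<^sup>2 + B * (th (1/2) t z)\<^sup>2"
    "\<And>z. th (1/2) t z * deriv (deriv (th (1/2) t)) z - (deriv (th (1/2) t) z)\<^sup>2 = A * (th (1/2) t z)\<^sup>2 + B * (th 0 t z)\<^sup>2"
proof -
  let ?P = "\<lambda>y. th 0 (2*t) (2*y)" and ?Q = "\<lambda>y. th (1/2) (2*t) (2*y)"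
  have holo: "(\<lambda>y. th a (2*t) (2*y)) holomorphic_on UNIV" for a
  proof -
    have "th a (2*t) \<circ> (\<lambda>y. 2 * y) holomorphic_on UNIV"
      using t by (intro holomorphic_on_compose holomorphic_intros holomorphic_th) simp
    then show ?thesis by (simp add: o_def)
  qed
  have real2: "deriv (deriv f) 0 \<in> \<real>" if "f holomorphic_on UNIV" "\<And>y. f (of_real y) \<in> \<real>" for f
    using restrict_to_line2(2)[of f 1 0] that by simp
  obtain p r where pr: "?P 0 = of_real p" "?Q 0 = of_real r"
    using th_real(1,2)[of "2*t" 0] by (auto elim!: Reals_cases)
  obtain p2 r2 where pr2: "deriv (deriv ?P) 0 = of_real p2" "deriv (deriv ?Q) 0 = of_real r2"
    using real2[OF holo, of 0] real2[OF holo, of "1/2"] th_real(1,2)[of "2*t" "2 * _"]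
    by (auto elim!: Reals_cases)
  have ne: "p\<^sup>2 - r\<^sup>2 \<noteq> 0"
    using th4_zero_square[OF t] th0_real_neq_0[OF t, of "pi/2"] pr
    by (metis mult_zero_right of_real_0 of_real_diff of_real_power power_eq_0_iff)
  define A B where AB: "A = (p * p2 - r * r2) / (2 * (p\<^sup>2 - r\<^sup>2))" "B = (p * r2 - r * p2) / (2 * (p\<^sup>2 - r\<^sup>2))"
  have AB': "2 * A * (p\<^sup>2 - r\<^sup>2) = p * p2 - r * r2" "2 * B * (p\<^sup>2 - r\<^sup>2) = p * r2 - r * p2"
    using ne by (simp_all add: AB field_simps)
  have cAB: "2 * A * (p\<^sup>2 - r\<^sup>2) = p * complex_of_real p2 - r * r2" "2 * B * (p\<^sup>2 - r\<^sup>2) = p * complex_of_real r2 - r * p2"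
    using AB'[THEN arg_cong[of _ _ complex_of_real]] by simp_all
  have cancel: "L = R" if "2 * L = W" "2 * W * of_real (p\<^sup>2 - r\<^sup>2) = 2 * (2 * R) * of_real (p\<^sup>2 - r\<^sup>2)" for L R W :: complex
    using that ne by (metis mult_left_cancel mult_right_cancel of_real_eq_0_iff zero_neq_numeral)
  show thesis
  proof
    fix z
    define X Y where XY: "X = th 0 (2*t) (2*z)" "Y = th (1/2) (2*t) (2*z)"
    have sq: "(th 0 t z)\<^sup>2 = X * p + Y * r" "(th (1/2) t z)\<^sup>2 = Y * p + X * r"
      using th0_bilinear[OF t, of z 0] th2_bilinear[OF t, of z 0] pr by (simp_all add: power2_eq_square XY)
    have "2 * (th 0 t z * deriv (deriv (th 0 t)) z - (deriv (th 0 t) z)\<^sup>2) = X * p2 + Y * r2"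
      unfolding pr2[symmetric]
      by (rule bilinear_second_deriv[OF holomorphic_th[OF t] holo holo]) (simp add: th0_bilinear[OF t] XY)
    moreover have "2 * (X * p2 + Y * r2) * (p\<^sup>2 - r\<^sup>2) = 2 * (2 * (A * (X * p + Y * r) + B * (Y * p + X * r))) * (p\<^sup>2 - r\<^sup>2)"
      using cAB unfolding of_real_diff of_real_mult of_real_power of_real_numeral by algebra
    ultimately show "th 0 t z * deriv (deriv (th 0 t)) z - (deriv (th 0 t) z)\<^sup>2 = A * (th 0 t z)\<^sup>2 + B * (th (1/2) t z)\<^sup>2"
      unfolding sq by (rule cancel)
    have "2 * (th (1/2) t z * deriv (deriv (th (1/2) t)) z - (deriv (th (1/2) t) z)\<^sup>2) = Y * p2 + X * r2"
      unfolding pr2[symmetric]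
      by (rule bilinear_second_deriv[OF holomorphic_th[OF t] holo holo]) (simp add: th2_bilinear[OF t] XY)
    moreover have "2 * (Y * p2 + X * r2) * (p\<^sup>2 - r\<^sup>2) = 2 * (2 * (A * (Y * p + X * r) + B * (X * p + Y * r))) * (p\<^sup>2 - r\<^sup>2)"
      using cAB unfolding of_real_diff of_real_mult of_real_power of_real_numeral by algebra
    ultimately show "th (1/2) t z * deriv (deriv (th (1/2) t)) z - (deriv (th (1/2) t) z)\<^sup>2 = A * (th (1/2) t z)\<^sup>2 + B * (th 0 t z)\<^sup>2"
      unfolding sq by (rule cancel)
  qed
qed

text \<open>Half the imaginary quasi-period exchanges theta_3 and theta_2 at 0 up to a common
  factor, so that their quotient is inverted there.\<close>

lemma th_plus_half_period: "th a t (\<i> * of_real (t/2)) = of_real (exp (t/4)) * th (a + 1/2) t 0"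
proof -
  have "thterm a t (\<i> * of_real (t/2)) n = of_real (exp (t/4)) * thterm (a + 1/2) t 0 n" for n
    unfolding thterm_def exp_of_real[symmetric] exp_add[symmetric]
    by (rule arg_cong[of _ _ exp]) (simp add: field_simps power2_eq_square)
  then have "thterm a t (\<i> * of_real (t/2)) = (\<lambda>n. of_real (exp (t/4)) * thterm (a + 1/2) t 0 n)" ..
  then show ?thesis
    by (simp only: th_def infsum_cmult_right')
qed

section \<open>The modulus as a function of the parameter\<close>

definition tmod :: "real \<Rightarrow> real" where
  "tmod t = (Re (th (1/2) t 0) / Re (th 0 t 0))\<^sup>2"

lemma sqrt_tmod: "t > 0 \<Longrightarrow> sqrt (tmod t) = Re (th (1/2) t 0) / Re (th 0 t 0)"
  using Re_th_zero_pos[of t 0] Re_th_zero_pos[of t "1/2"] by (simp add: tmod_def)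

lemma tmod_pos: "t > 0 \<Longrightarrow> tmod t > 0"
  using Re_th_zero_pos[of t 0] Re_th_zero_pos[of t "1/2"] by (simp add: tmod_def)

lemma of_real_Re_th_zero: "of_real (Re (th 0 t 0)) = th 0 t 0" "of_real (Re (th (1/2) t 0)) = th (1/2) t 0"
  using th_real(1,2)[of t 0] by (auto simp: of_real_Re)

text \<open>A Landen transformation: at 0 the duplication formulas read
  \<open>F^2 = p^2 + r^2\<close> and \<open>G^2 = 2 p r\<close>.\<close>

lemma tmod_landen:
  assumes t: "t > 0"
  shows "tmod t = 2 * sqrt (tmod (2*t)) / (1 + tmod (2*t))"
proof -
  define p r F G where d: "p = Re (th 0 (2*t) 0)" "r = Re (th (1/2) (2*t) 0)" "F = Re (th 0 t 0)" "G = Re (th (1/2) t 0)"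
  have "of_real (F\<^sup>2) = (of_real (p\<^sup>2 + r\<^sup>2) :: complex)" "of_real (G\<^sup>2) = (of_real (2 * p * r) :: complex)"
    using th0_duplication[OF t, of 0] th2_duplication[OF t, of 0]
    by (simp_all add: d of_real_Re_th_zero power2_eq_square)
  then have "F\<^sup>2 = p\<^sup>2 + r\<^sup>2" "G\<^sup>2 = 2 * p * r"
    by (simp_all only: of_real_eq_iff)
  moreover have "p > 0" "r > 0"
    using t Re_th_zero_pos[of "2*t"] by (auto simp: d)
  moreover have "tmod t = G\<^sup>2 / F\<^sup>2" "tmod (2*t) = (r / p)\<^sup>2" "sqrt (tmod (2*t)) = r / p"
    using t sqrt_tmod[of "2*t"] by (simp_all add: tmod_def d power_divide)
  moreover have "1 + (r / p)\<^sup>2 = (p\<^sup>2 + r\<^sup>2) / p\<^sup>2"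
    using \<open>p > 0\<close> by (simp add: power_divide add_divide_distrib)
  ultimately show ?thesis
    by (simp add: power2_eq_square)
qed

text \<open>The difference of the two squares is the square of theta_4 at 0 for the parameter
  \<open>t/2\<close>, a nonzero real.\<close>

lemma tmod_less_1:
  assumes t: "t > 0"
  shows "tmod t < 1"
proof -
  have "t/2 > 0" using t by simp
  obtain w where w: "th 0 (t/2) (of_real (pi/2)) = of_real w"
    using th_real(1)[of "t/2" "pi/2"] by (auto elim: Reals_cases)
  then have "w \<noteq> 0" using th0_real_neq_0[OF \<open>t/2 > 0\<close>, of "pi/2"] by auto
  have "of_real (w\<^sup>2) = (of_real ((Re (th 0 t 0))\<^sup>2 - (Re (th (1/2) t 0))\<^sup>2) :: complex)"
    using th4_zero_square[OF \<open>t/2 > 0\<close>] w by (simp add: of_real_Re_th_zero)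
  then have "(Re (th 0 t 0))\<^sup>2 - (Re (th (1/2) t 0))\<^sup>2 = w\<^sup>2"
    by (simp only: of_real_eq_iff)
  then have "(Re (th (1/2) t 0))\<^sup>2 < (Re (th 0 t 0))\<^sup>2"
    using \<open>w \<noteq> 0\<close> by (smt (verit) zero_less_power2)
  then show ?thesis
    using Re_th_zero_pos[OF t, of 0] by (simp add: tmod_def power_divide)
qed

text \<open>The square of the Landen relation is \<open>4 * ?k / (1 + ?k)^2\<close>, and
  \<open>(1 + ?k)^2 <= 4\<close> since \<open>?k < 1\<close>. Iterated forwards this gives the limit
  0, backwards the limit 1.\<close>

lemma tmod_double_le:
  assumes t: "t > 0"
  shows "tmod (2*t) \<le> (tmod t)\<^sup>2"
proof -
  let ?k = "tmod (2*t)"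
  have k: "0 < ?k" "?k < 1" using t tmod_pos[of "2*t"] tmod_less_1[of "2*t"] by auto
  have "(tmod t)\<^sup>2 = 4 * ?k / (1 + ?k)\<^sup>2"
    unfolding tmod_landen[OF t] using k by (simp add: power_divide power_mult_distrib)
  moreover have "(1 + ?k)\<^sup>2 \<le> 2\<^sup>2"
    using k by (intro power_mono) auto
  then have "?k * (1 + ?k)\<^sup>2 \<le> ?k * 4"
    using k by (intro mult_left_mono) auto
  then have "?k \<le> 4 * ?k / (1 + ?k)\<^sup>2"
    using k by (subst pos_le_divide_eq) (auto simp: mult.commute)
  ultimately show ?thesis
    by simp
qed

lemma tmod_tendsto_0: "(\<lambda>m::nat. tmod (2 ^ m)) \<longlonglongrightarrow> 0"
proof (rule Lim_null_comparison)
  have le: "tmod (2 ^ m) \<le> tmod 1 ^ (2 ^ m)" for m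
  proof (induction m)
    case (Suc m)
    have "tmod (2 ^ Suc m) \<le> (tmod (2 ^ m))\<^sup>2"
      using tmod_double_le[of "2 ^ m"] by simp
    also have "\<dots> \<le> (tmod 1 ^ (2 ^ m))\<^sup>2"
      using Suc tmod_pos[of "2 ^ m"] by (intro power_mono) auto
    finally show ?case by (simp add: mult.commute flip: power_mult)
  qed simp
  also have "tmod 1 ^ (2 ^ m) \<le> tmod 1 ^ m" for m
    using tmod_pos[of 1] tmod_less_1[of 1] by (intro power_decreasing) (auto simp: less_imp_le)
  finally show "\<forall>\<^sub>F m in sequentially. norm (tmod (2 ^ m)) \<le> tmod 1 ^ m"
    by (simp add: abs_of_pos[OF tmod_pos])
  show "(\<lambda>m. tmod 1 ^ m) \<longlonglongrightarrow> 0"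
    using tmod_pos[of 1] tmod_less_1[of 1] by (intro LIMSEQ_power_zero) auto
qed

text \<open>Iterating the doubling inequality from \<open>1 / 2 ^ m\<close> up to 1 bounds
  \<open>tmod 1\<close> by the power \<open>2 ^ m\<close> of the modulus in question; the
  corresponding roots of a positive constant tend to 1.\<close>

lemma tmod_tendsto_1: "(\<lambda>m::nat. tmod (1 / 2 ^ m)) \<longlonglongrightarrow> 1"
proof (rule tendsto_sandwich)
  have le: "root (2 ^ m) (tmod 1) \<le> tmod (1 / 2 ^ m)" for m :: nat
  proof -
    have "tmod 1 \<le> tmod (1 / 2 ^ m) ^ (2 ^ m)"
    proof (induction m)
      case (Suc m)
      have "tmod (1 / 2 ^ m) \<le> (tmod (1 / 2 ^ Suc m))\<^sup>2"
        using tmod_double_le[of "1 / 2 ^ Suc m"] by simp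
      then have "tmod (1 / 2 ^ m) ^ (2 ^ m) \<le> ((tmod (1 / 2 ^ Suc m))\<^sup>2) ^ (2 ^ m)"
        using tmod_pos[of "1 / 2 ^ m"] by (intro power_mono) auto
      with Suc show ?case by (simp flip: power_mult)
    qed simp
    then have "root (2 ^ m) (tmod 1) \<le> root (2 ^ m) (tmod (1 / 2 ^ m) ^ (2 ^ m))"
      by (rule real_root_le_mono[rotated]) simp
    moreover have "root (2 ^ m) (tmod (1 / 2 ^ m) ^ (2 ^ m)) = tmod (1 / 2 ^ m)"
      using tmod_pos[of "1 / 2 ^ m"] by (intro real_root_power_cancel) auto
    ultimately show ?thesis
      by (simp only:)
  qed
  then show "\<forall>\<^sub>F m in sequentially. root (2 ^ m) (tmod 1) \<le> tmod (1 / 2 ^ m)"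
    by simp
  show "\<forall>\<^sub>F m in sequentially. tmod (1 / 2 ^ m) \<le> 1"
    using tmod_less_1 by (auto intro!: always_eventually less_imp_le)
  show "(\<lambda>m. root (2 ^ m) (tmod 1)) \<longlonglongrightarrow> 1"
  proof (rule filterlim_compose[of "\<lambda>n. root n (tmod 1)"])
    show "(\<lambda>n. root n (tmod 1)) \<longlonglongrightarrow> 1"
      by (rule LIMSEQ_root_const[OF tmod_pos]) simp
    show "filterlim (\<lambda>m::nat. 2 ^ m :: nat) sequentially sequentially"
      by (rule filterlim_subseq) (simp add: strict_mono_def)
  qed
qed simp

lemma tmod_surj:
  assumes "0 < k" "k < 1"
  obtains t where "t > 0" "tmod t = k"
proof -
  have cont: "continuous_on {0<..} tmod"
    unfolding tmod_def using Re_th_zero_pos[of _ 0]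
    by (intro continuous_intros continuous_on_th_param) (auto simp: less_le)
  obtain m1 where m1: "tmod (2 ^ m1) < k"
    using order_tendstoD(2)[OF tmod_tendsto_0 assms(1)] by (auto simp: eventually_sequentially)
  obtain m2 where m2: "tmod (1 / 2 ^ m2) > k"
    using order_tendstoD(1)[OF tmod_tendsto_1 assms(2)] by (auto simp: eventually_sequentially)
  have "\<exists>t\<ge>1 / 2 ^ m2. t \<le> 2 ^ m1 \<and> tmod t = k"
  proof (rule IVT2')
    show "1 / 2 ^ m2 \<le> (2 ^ m1 :: real)"
      by (rule order_trans[of _ 1]) auto
    show "continuous_on {1 / 2 ^ m2..2 ^ m1} tmod"
      by (rule continuous_on_subset[OF cont]) (auto intro: less_le_trans[of 0 "1 / 2 ^ m2"])
  qed (use m1 m2 in auto)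
  then obtain t where "t \<ge> 1 / 2 ^ m2" "tmod t = k" by blast
  moreover have "0 < 1 / (2 :: real) ^ m2" by simp
  ultimately show thesis
    using that[of t] by linarith
qed

section \<open>Jacobi elliptic functions on the real line\<close>

lemma abs_two_mult_le: "\<bar>2 * x * y\<bar> \<le> x\<^sup>2 + (y :: real)\<^sup>2"
  using sum_squares_bound[of x y] sum_squares_bound[of "- x" y] by (simp add: abs_le_iff)

text \<open>A Gronwall estimate for \<open>(u - v)^2 + (u1 - v1)^2\<close>: the difference of the
  cubics is \<open>u - v\<close> times the factor \<open>?q\<close>, bounded on compact intervals.
  The equation is assumed only before \<open>X\<close> because on the real axis it is available only
  up to the first zero of the solution; the endpoint follows by continuity.\<close>

lemma cubic_ode_unique:
  fixes u v :: "real \<Rightarrow> real"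
  assumes u: "\<And>x. (u has_real_derivative u1 x) (at x)" "\<And>x. (u1 has_real_derivative u2 x) (at x)"
    and v: "\<And>x. (v has_real_derivative v1 x) (at x)" "\<And>x. (v1 has_real_derivative v2 x) (at x)"
    and ode: "\<And>x. 0 \<le> x \<Longrightarrow> x < X \<Longrightarrow> u2 x = b + p * u x + r * u x ^ 3"
      "\<And>x. 0 \<le> x \<Longrightarrow> x < X \<Longrightarrow> v2 x = b + p * v x + r * v x ^ 3"
    and init: "u 0 = v 0" "u1 0 = v1 0"
    and x: "0 \<le> x" "x \<le> X"
  shows "u x = v x"
proof -
  have cont: "continuous_on S u" "continuous_on S v" for S
    using u(1) v(1) by (meson DERIV_continuous_on has_field_derivative_at_within)+
  have *: "u y = v y" if y: "0 \<le> y" "y < X" for y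
  proof -
    let ?q = "\<lambda>x. p + r * ((u x)\<^sup>2 + u x * v x + (v x)\<^sup>2)"
    have "compact (?q ` {0..y})"
      by (intro compact_continuous_image continuous_intros cont) auto
    then have "bounded (?q ` {0..y})"
      by (rule compact_imp_bounded)
    then obtain M where M: "\<forall>x\<in>{0..y}. \<bar>?q x\<bar> \<le> M"
      unfolding bounded_iff by auto
    define e where "e = (\<lambda>x. (u x - v x)\<^sup>2 + (u1 x - v1 x)\<^sup>2)"
    define e1 where "e1 = (\<lambda>x. 2 * (u x - v x) * (u1 x - v1 x) + 2 * (u1 x - v1 x) * (u2 x - v2 x))"
    define L where "L = 1 + M"
    have e1: "(e has_real_derivative e1 x) (at x)" for x
      unfolding e_def e1_def by (auto intro!: derivative_eq_intros u v simp: algebra_simps)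
    have growth: "e1 x \<le> L * e x" if "x \<in> {0..y}" for x
    proof -
      let ?D = "u x - v x" and ?E = "u1 x - v1 x"
      have "u2 x - v2 x = ?q x * ?D"
        using ode[of x] that y by (simp add: algebra_simps power2_eq_square power3_eq_cube)
      then have "e1 x = (1 + ?q x) * (2 * ?D * ?E)"
        unfolding e1_def by algebra
      also have "\<dots> \<le> \<bar>1 + ?q x\<bar> * \<bar>2 * ?D * ?E\<bar>"
        by (metis abs_ge_self abs_mult)
      also have "\<dots> \<le> L * e x"
      proof (intro mult_mono)
        show "\<bar>1 + ?q x\<bar> \<le> L" using bspec[OF M that] by (simp add: L_def)
        then show "0 \<le> L" by linarith
        show "\<bar>2 * ?D * ?E\<bar> \<le> e x"
          unfolding e_def by (rule abs_two_mult_le)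
      qed auto
      finally show ?thesis .
    qed
    have "e y * exp (- L * y) \<le> e 0 * exp (- L * 0)"
    proof (rule DERIV_nonpos_imp_nonincreasing[OF y(1)])
      fix x assume "0 \<le> x" "x \<le> y"
      have "((\<lambda>x. e x * exp (- L * x)) has_real_derivative (e1 x - L * e x) * exp (- L * x)) (at x)"
        by (auto intro!: derivative_eq_intros e1 simp: algebra_simps)
      moreover have "(e1 x - L * e x) * exp (- L * x) \<le> 0"
        using growth[of x] \<open>0 \<le> x\<close> \<open>x \<le> y\<close> by (intro mult_nonpos_nonneg) auto
      ultimately show "\<exists>d. ((\<lambda>x. e x * exp (- L * x)) has_real_derivative d) (at x) \<and> d \<le> 0" by blast
    qed
    then have "e y * exp (- L * y) \<le> 0"
      using init by (simp add: e_def)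
    then have "e y \<le> 0"
      by (simp add: mult_le_0_iff)
    then show ?thesis
      unfolding e_def by (simp add: sum_power2_le_zero_iff)
  qed
  show ?thesis
  proof (cases "x < X")
    case False
    then have "x = X" using x by simp
    show ?thesis
    proof (cases "X = 0")
      case False
      then have "X > 0" using x \<open>x = X\<close> by simp
      have "continuous_on (closure {0..<X}) (\<lambda>x. u x - v x)"
        by (intro continuous_intros cont)
      then have "u X - v X = 0"
        by (rule continuous_constant_on_closure[where S = "{0..<X}"]) (use * \<open>X > 0\<close> in auto)
      then show ?thesis using \<open>x = X\<close> by simp
    qed (use init \<open>x = X\<close> in simp)
  qed (use * x in auto)
qed

text \<open>While \<open>f > 0\<close>, the quantity \<open>(f'^2 + B (1 + f^4)) / f^2\<close> is
  conserved, and the data at 0 fix it as \<open>B (k + 1/k)\<close>. Substituting it back and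
  cancelling one factor \<open>f\<close> gives the cubic equation.\<close>

lemma first_integral:
  fixes f :: "real \<Rightarrow> real"
  assumes f: "\<And>x. (f has_real_derivative f1 x) (at x)" "\<And>x. (f1 has_real_derivative f2 x) (at x)"
    and eq: "\<And>x. f x * f2 x - (f1 x)\<^sup>2 = B * (1 - f x ^ 4)"
    and init: "f1 0 = 0" "(f 0)\<^sup>2 = k"
    and S: "convex S" "0 \<in> S" "\<And>x. x \<in> S \<Longrightarrow> f x > 0"
    and x: "x \<in> S"
  shows "f2 x = B * (k + 1 / k) * f x + (- 2 * B) * f x ^ 3"
proof -
  let ?J = "\<lambda>x. ((f1 x)\<^sup>2 + B * (1 + f x ^ 4)) / (f x)\<^sup>2"
  have "\<exists>c. \<forall>x\<in>S. ?J x = c"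
  proof (rule has_field_derivative_zero_constant[OF S(1)])
    fix x assume "x \<in> S"
    then have pos: "f x > 0" by (rule S(3))
    let ?d = "(((2 * f1 x * f2 x) + B * (4 * f x ^ 3 * f1 x)) * (f x)\<^sup>2 - ((f1 x)\<^sup>2 + B * (1 + f x ^ 4)) * (2 * f x * f1 x)) / ((f x)\<^sup>2)\<^sup>2"
    have "(?J has_real_derivative ?d) (at x)"
      using pos by (auto intro!: derivative_eq_intros f simp: power2_eq_square)
    moreover have "?d = 0"
    proof -
      have "((2 * f1 x * f2 x) + B * (4 * f x ^ 3 * f1 x)) * (f x)\<^sup>2 - ((f1 x)\<^sup>2 + B * (1 + f x ^ 4)) * (2 * f x * f1 x)
        = 2 * f x * f1 x * ((f x * f2 x - (f1 x)\<^sup>2) - B * (1 - f x ^ 4))"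
        by algebra
      then show ?thesis using eq[of x] by simp
    qed
    ultimately show "(?J has_real_derivative 0) (at x within S)"
      by (metis has_field_derivative_at_within)
  qed
  then have "?J x = ?J 0" using x S(2) by auto
  moreover have pos: "f x > 0" "f 0 > 0" using S x by auto
  moreover have "?J 0 = B * (k + 1 / k)"
  proof -
    have "k > 0" using pos init(2) by auto
    have "f 0 ^ 4 = k\<^sup>2" using init(2) by (simp add: power2_eq_square power4_eq_xxxx flip: init(2))
    then show ?thesis using init \<open>k > 0\<close> by (simp add: field_simps power2_eq_square)
  qed
  ultimately have "?J x = B * (k + 1 / k)"
    by simp
  then have "(f1 x)\<^sup>2 + B * (1 + f x ^ 4) = B * (k + 1 / k) * (f x)\<^sup>2"
    using pos by (simp add: divide_eq_eq)
  then have "f x * f2 x = f x * (B * (k + 1 / k) * f x + (- 2 * B) * f x ^ 3)"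
    using eq[of x] by algebra
  then show ?thesis using pos by simp
qed

lemma even_deriv_0:
  fixes f :: "real \<Rightarrow> real"
  assumes "(f has_real_derivative d) (at 0)" "\<And>x. f (- x) = f x"
  shows "d = 0"
proof -
  have "((\<lambda>x. f (- x)) has_real_derivative - d) (at 0)"
    using assms(1) by (simp flip: DERIV_mirror)
  then have "d = - d"
    using assms DERIV_unique by (metis (no_types, lifting) ext)
  then show ?thesis by simp
qed

section \<open>The elliptic integral and the amplitude\<close>

lemma one_minus_sin_pos:
  fixes k :: real
  assumes "k\<^sup>2 < 1"
  shows "1 - k\<^sup>2 * (sin x)\<^sup>2 > 0"
proof -
  have "k\<^sup>2 * (sin x)\<^sup>2 \<le> k\<^sup>2 * 1"
    by (intro mult_left_mono) (auto simp: abs_square_le_1)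
  then show ?thesis using assms by simp
qed

lemma ellF_deriv:
  assumes k: "k\<^sup>2 < 1"
  shows "(ellF k has_real_derivative 1 / sqrt (1 - k\<^sup>2 * (sin x)\<^sup>2)) (at x)"
proof -
  let ?w = "\<lambda>t. 1 / sqrt (1 - k\<^sup>2 * (sin t)\<^sup>2)"
  \<comment> \<open>A base point \<open>a\<close> to the left of both 0 and \<open>x\<close> merges
    the two branches of \<open>ellF\<close> into one integral, up to the constant
    \<open>integral {a..0}\<close>.\<close>
  define a b where ab: "a = - \<bar>x\<bar> - 1" "b = \<bar>x\<bar> + 1"
  have cont: "continuous_on S ?w" for S
    using one_minus_sin_pos[OF k] by (intro continuous_intros) (auto simp: less_le)
  have int: "?w integrable_on {c..d}" for c d
    by (rule integrable_continuous_interval[OF cont])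
  have eq: "integral {a..y} ?w - integral {a..0} ?w = ellF k y" if "y \<in> {a..b}" for y
  proof (cases "0 \<le> y")
    case True
    have "a \<le> 0" by (simp add: ab)
    then have "integral {a..0} ?w + integral {0..y} ?w = integral {a..y} ?w"
      by (rule Henstock_Kurzweil_Integration.integral_combine[OF _ True int])
    then show ?thesis
      using True by (simp add: ellF_def)
  next
    case False
    then have "y \<le> 0" by simp
    with that have "integral {a..y} ?w + integral {y..0} ?w = integral {a..0} ?w"
      by (intro Henstock_Kurzweil_Integration.integral_combine[OF _ _ int]) auto
    then show ?thesis
      using False by (simp add: ellF_def)
  qed
  have "((\<lambda>y. integral {a..y} ?w) has_real_derivative ?w x) (at x within {a..b})"
    by (rule integral_has_real_derivative[OF cont]) (auto simp: ab)
  then have "((\<lambda>y. integral {a..y} ?w - integral {a..0} ?w) has_real_derivative ?w x) (at x within {a..b})"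
    by (auto intro!: derivative_eq_intros)
  then have "((\<lambda>y. integral {a..y} ?w - integral {a..0} ?w) has_real_derivative ?w x) (at x)"
    by (subst (asm) at_within_interior) (auto simp: ab)
  moreover have "\<forall>\<^sub>F y in nhds x. integral {a..y} ?w - integral {a..0} ?w = ellF k y"
    by (rule eventually_mono[OF eventually_nhds_in_open[of "{a<..<b}" x]]) (use eq ab in auto)
  ultimately show ?thesis
    by (simp add: DERIV_cong_ev)
qed

lemma ellF_0 [simp]: "ellF k 0 = 0"
  by (simp add: ellF_def)

lemma ellF_half_pi: "ellF k (pi/2) = ellK k"
  by (simp add: ellF_def ellK_def)

lemma ellF_strict_mono:
  assumes k: "k\<^sup>2 < 1"
  shows "strict_mono (ellF k)"
proof (rule strict_monoI)
  fix x y :: real assume "x < y"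
  then show "ellF k x < ellF k y"
  proof (rule DERIV_pos_imp_increasing)
    fix z
    show "\<exists>d. (ellF k has_real_derivative d) (at z) \<and> 0 < d"
      using ellF_deriv[OF k, of z] one_minus_sin_pos[OF k, of z]
      by (intro exI[of _ "1 / sqrt (1 - k\<^sup>2 * (sin z)\<^sup>2)"]) simp
  qed
qed

lemma ellF_minus:
  assumes k: "k\<^sup>2 < 1"
  shows "ellF k (- x) = - ellF k x"
proof -
  have "ellF k x + ellF k (- x) = ellF k 0 + ellF k (- 0)"
  proof (rule DERIV_isconst_all[where f = "\<lambda>x. ellF k x + ellF k (- x)", OF allI])
    fix x
    have "((\<lambda>x. ellF k (- x)) has_real_derivative - (1 / sqrt (1 - k\<^sup>2 * (sin x)\<^sup>2))) (at x)"
      using ellF_deriv[OF k, of "- x"] by (simp flip: DERIV_mirror)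
    then show "((\<lambda>x. ellF k x + ellF k (- x)) has_real_derivative 0) (at x)"
      using DERIV_add[OF ellF_deriv[OF k, of x]] by fastforce
  qed
  then show ?thesis by simp
qed

lemma ellF_plus_pi:
  assumes k: "k\<^sup>2 < 1"
  shows "ellF k (x + pi) = ellF k x + 2 * ellK k"
proof -
  have 1: "ellF k (x + pi) - ellF k x = ellF k (y + pi) - ellF k y" for x y
  proof (rule DERIV_isconst_all[where f = "\<lambda>x. ellF k (x + pi) - ellF k x", OF allI])
    fix x
    have "((\<lambda>x. ellF k (x + pi)) has_real_derivative (1 / sqrt (1 - k\<^sup>2 * (sin x)\<^sup>2))) (at x)"
      using ellF_deriv[OF k, of "x + pi"] by (simp add: DERIV_shift[symmetric] power2_eq_square)
    then show "((\<lambda>x. ellF k (x + pi) - ellF k x) has_real_derivative 0) (at x)"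
      using DERIV_diff[OF _ ellF_deriv[OF k, of x]] by fastforce
  qed
  have "ellF k (x + pi) - ellF k x = 2 * ellK k"
    using 1[of x "- (pi/2)"] ellF_minus[OF k, of "pi/2"] ellF_half_pi[of k] by simp
  then show ?thesis by simp
qed

text \<open>The integrand is at least 1. This yields both the unbounded range of \<open>ellF\<close>
  and the positivity of \<open>ellK\<close>.\<close>

lemma ellF_ge:
  assumes k: "k\<^sup>2 < 1" and "x \<ge> 0"
  shows "ellF k x \<ge> x"
proof -
  have "ellF k 0 - 0 \<le> ellF k x - x"
  proof (rule DERIV_nonneg_imp_nondecreasing[OF assms(2)])
    fix y
    have "((\<lambda>x. ellF k x - x) has_real_derivative 1 / sqrt (1 - k\<^sup>2 * (sin y)\<^sup>2) - 1) (at y)"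
      by (auto intro!: derivative_eq_intros ellF_deriv k)
    moreover have "1 / sqrt (1 - k\<^sup>2 * (sin y)\<^sup>2) - 1 \<ge> 0"
      using one_minus_sin_pos[OF k, of y] by (simp add: le_divide_eq)
    ultimately show "\<exists>d. ((\<lambda>x. ellF k x - x) has_real_derivative d) (at y) \<and> 0 \<le> d" by blast
  qed
  then show ?thesis by simp
qed

lemma ellK_pos: "k\<^sup>2 < 1 \<Longrightarrow> ellK k > 0"
  using ellF_ge[of k "pi/2"] pi_gt_zero unfolding ellF_half_pi by linarith

lemma ellF_surj:
  assumes k: "k\<^sup>2 < 1"
  obtains \<phi> where "ellF k \<phi> = x"
proof -
  have cont: "continuous_on S (ellF k)" for S
    using ellF_deriv[OF k] by (meson DERIV_continuous_on has_field_derivative_at_within)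
  have "\<exists>\<phi>\<ge>- \<bar>x\<bar>. \<phi> \<le> \<bar>x\<bar> \<and> ellF k \<phi> = x"
  proof (rule IVT')
    show "ellF k (- \<bar>x\<bar>) \<le> x" using ellF_ge[OF k, of "\<bar>x\<bar>"] ellF_minus[OF k, of "\<bar>x\<bar>"] by linarith
    show "x \<le> ellF k \<bar>x\<bar>" using ellF_ge[OF k, of "\<bar>x\<bar>"] by linarith
  qed (auto intro: cont)
  then show thesis using that by blast
qed

lemma jam_ellF:
  assumes k: "k\<^sup>2 < 1"
  shows "jam k (ellF k \<phi>) = \<phi>"
  unfolding jam_def using ellF_strict_mono[OF k] by (auto simp: strict_mono_eq)

lemma ellF_jam:
  assumes k: "k\<^sup>2 < 1"
  shows "ellF k (jam k x) = x"
  by (metis ellF_surj[OF k] jam_ellF[OF k])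

lemma jam_strict_mono: "k\<^sup>2 < 1 \<Longrightarrow> strict_mono (jam k)"
  by (metis ellF_jam ellF_strict_mono strict_mono_def strict_mono_less)

lemma jam_deriv:
  assumes k: "k\<^sup>2 < 1"
  shows "(jam k has_real_derivative sqrt (1 - k\<^sup>2 * (sin (jam k x))\<^sup>2)) (at x)"
proof -
  have "(jam k has_real_derivative inverse (1 / sqrt (1 - k\<^sup>2 * (sin (jam k x))\<^sup>2))) (at x)"
  proof (rule DERIV_inverse_function[where f = "ellF k" and a = "x - 1" and b = "x + 1"])
    show "isCont (jam k) x"
    proof (rule isCont_inverse_function2[of "jam k x - 1" "jam k x" "jam k x + 1" "jam k" "ellF k", unfolded ellF_jam[OF k]])
      show "isCont (ellF k) z" for z
        by (rule DERIV_isCont[OF ellF_deriv[OF k]])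
    qed (use jam_ellF[OF k] in auto)
    show "1 / sqrt (1 - k\<^sup>2 * (sin (jam k x))\<^sup>2) \<noteq> 0"
      using one_minus_sin_pos[OF k] by (simp add: less_le)
  qed (use ellF_deriv[OF k] ellF_jam[OF k] in auto)
  then show ?thesis by simp
qed

lemma jam_0 [simp]: "k\<^sup>2 < 1 \<Longrightarrow> jam k 0 = 0"
  using jam_ellF[of k 0] by simp

lemma jam_K: "k\<^sup>2 < 1 \<Longrightarrow> jam k (ellK k) = pi/2"
  using jam_ellF[of k "pi/2"] by (simp add: ellF_half_pi)

lemma jam_minus: "k\<^sup>2 < 1 \<Longrightarrow> jam k (- x) = - jam k x"
  by (metis ellF_jam ellF_minus jam_ellF)

lemma jam_plus_2K: "k\<^sup>2 < 1 \<Longrightarrow> jam k (x + 2 * ellK k) = jam k x + pi"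
  by (metis ellF_jam ellF_plus_pi jam_ellF)

section \<open>The functions sn, cn, dn and the addition formula\<close>

definition jcn :: "real \<Rightarrow> real \<Rightarrow> real" where
  "jcn k x = cos (jam k x)"

definition jdn :: "real \<Rightarrow> real \<Rightarrow> real" where
  "jdn k x = sqrt (1 - k\<^sup>2 * (jsn k x)\<^sup>2)"

lemma jsn_jcn_sq: "(jcn k x)\<^sup>2 = 1 - (jsn k x)\<^sup>2"
  by (simp add: jcn_def jsn_def cos_squared_eq)

lemma jsn_sq_le_1: "(jsn k x)\<^sup>2 \<le> 1"
  by (simp add: jsn_def abs_square_le_1)

lemma jdn_pos: "k\<^sup>2 < 1 \<Longrightarrow> jdn k x > 0"
  using one_minus_sin_pos[of k "jam k x"] by (simp add: jdn_def jsn_def)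

lemma jdn_sq: "k\<^sup>2 < 1 \<Longrightarrow> (jdn k x)\<^sup>2 = 1 - k\<^sup>2 * (jsn k x)\<^sup>2"
  using one_minus_sin_pos[of k "jam k x"] by (simp add: jdn_def jsn_def)

lemma jsn_deriv: "k\<^sup>2 < 1 \<Longrightarrow> (jsn k has_real_derivative jcn k x * jdn k x) (at x)"
  unfolding jsn_def jcn_def jdn_def by (auto intro!: derivative_eq_intros jam_deriv)

lemma jcn_deriv: "k\<^sup>2 < 1 \<Longrightarrow> (jcn k has_real_derivative - (jsn k x * jdn k x)) (at x)"
  unfolding jsn_def jcn_def jdn_def by (auto intro!: derivative_eq_intros jam_deriv)

lemma jdn_deriv:
  assumes k: "k\<^sup>2 < 1"
  shows "(jdn k has_real_derivative - (k\<^sup>2 * jsn k x * jcn k x)) (at x)"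
proof -
  have "((\<lambda>x. 1 - k\<^sup>2 * (jsn k x)\<^sup>2) has_real_derivative - (2 * k\<^sup>2 * jsn k x * (jcn k x * jdn k x))) (at x)"
    by (auto intro!: derivative_eq_intros jsn_deriv[OF k])
  from DERIV_chain2[OF DERIV_real_sqrt this] show ?thesis
    using one_minus_sin_pos[OF k, of "jam k x"] jdn_pos[OF k, of x]
    unfolding jdn_def jsn_def by (simp add: field_simps)
qed

lemma jsn_minus: "k\<^sup>2 < 1 \<Longrightarrow> jsn k (- x) = - jsn k x"
  by (simp add: jsn_def jam_minus)

lemma jcn_minus: "k\<^sup>2 < 1 \<Longrightarrow> jcn k (- x) = jcn k x"
  by (simp add: jcn_def jam_minus)

lemma jdn_minus: "k\<^sup>2 < 1 \<Longrightarrow> jdn k (- x) = jdn k x"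
  by (simp add: jdn_def jsn_minus)

lemma jacobi_at_0: "k\<^sup>2 < 1 \<Longrightarrow> jsn k 0 = 0" "k\<^sup>2 < 1 \<Longrightarrow> jcn k 0 = 1" "k\<^sup>2 < 1 \<Longrightarrow> jdn k 0 = 1"
  by (simp_all add: jsn_def jcn_def jdn_def)

lemma jsn_plus_2K: "k\<^sup>2 < 1 \<Longrightarrow> jsn k (x + 2 * ellK k) = - jsn k x"
  by (simp add: jsn_def jam_plus_2K)

lemma jcn_plus_2K: "k\<^sup>2 < 1 \<Longrightarrow> jcn k (x + 2 * ellK k) = - jcn k x"
  by (simp add: jcn_def jam_plus_2K)

lemma jdn_plus_2K: "k\<^sup>2 < 1 \<Longrightarrow> jdn k (x + 2 * ellK k) = jdn k x"
  by (simp add: jdn_def jsn_plus_2K)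

lemma jam_between:
  assumes k: "k\<^sup>2 < 1" and x: "0 < x" "x < ellK k"
  shows "0 < jam k x" "jam k x < pi/2"
  using strict_monoD[OF jam_strict_mono[OF k] x(1)] strict_monoD[OF jam_strict_mono[OF k] x(2)]
  by (simp_all add: k jam_K)

lemma jacobi_between:
  assumes k: "k\<^sup>2 < 1" and x: "0 < x" "x < ellK k"
  shows "jsn k x > 0" "jcn k x > 0"
  using jam_between[OF assms] by (auto simp: jsn_def jcn_def intro!: sin_gt_zero cos_gt_zero)

text \<open>For fixed \<open>u + v\<close> the quotient below does not depend on \<open>v\<close>; at \<open>v = 0\<close> it is \<open>sn (u + v)\<close>.\<close>

lemma jsn_add:
  assumes k: "k\<^sup>2 < 1"
  shows "jsn k (u + v) = (jsn k u * jcn k v * jdn k v + jsn k v * jcn k u * jdn k u) / (1 - k\<^sup>2 * (jsn k u)\<^sup>2 * (jsn k v)\<^sup>2)"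
proof -
  define a where "a = u + v"
  define N where "N = (\<lambda>v. jsn k (a - v) * jcn k v * jdn k v + jsn k v * jcn k (a - v) * jdn k (a - v))"
  define E where "E = (\<lambda>v. 1 - k\<^sup>2 * (jsn k (a - v))\<^sup>2 * (jsn k v)\<^sup>2)"
  have Epos: "E v > 0" for v
  proof -
    have "(jsn k (a - v))\<^sup>2 * (jsn k v)\<^sup>2 \<le> 1 * 1"
      by (intro mult_mono jsn_sq_le_1) auto
    then have "k\<^sup>2 * ((jsn k (a - v))\<^sup>2 * (jsn k v)\<^sup>2) \<le> k\<^sup>2 * 1"
      by (intro mult_left_mono) auto
    then show ?thesis using k by (simp add: E_def mult.assoc)
  qed
  have sub: "((\<lambda>v. a - v) has_real_derivative -1) (at v)" for v
    by (auto intro!: derivative_eq_intros)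
  note D = jsn_deriv[OF k] jcn_deriv[OF k] jdn_deriv[OF k]
  note D' = DERIV_chain2[OF D(1) sub] DERIV_chain2[OF D(2) sub] DERIV_chain2[OF D(3) sub]
  have const: "N v / E v = N 0 / E 0" for v
  proof (rule DERIV_isconst_all[where f = "\<lambda>v. N v / E v", OF allI])
    fix v
    define s c d s' c' d' where abbr: "s = jsn k v" "c = jcn k v" "d = jdn k v"
      "s' = jsn k (a - v)" "c' = jcn k (a - v)" "d' = jdn k (a - v)"
    have rel: "c\<^sup>2 = 1 - s\<^sup>2" "d\<^sup>2 = 1 - k\<^sup>2 * s\<^sup>2" "c'\<^sup>2 = 1 - s'\<^sup>2" "d'\<^sup>2 = 1 - k\<^sup>2 * s'\<^sup>2"
      by (simp_all add: abbr jsn_jcn_sq jdn_sq[OF k])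
    have N: "(N has_real_derivative (- s * s' * d\<^sup>2 - k\<^sup>2 * s * s' * c\<^sup>2 + s * s' * d'\<^sup>2 + k\<^sup>2 * s * s' * c'\<^sup>2)) (at v)"
      unfolding N_def abbr
      by (rule derivative_eq_intros D D' refl)+ (simp add: algebra_simps power2_eq_square)
    have E: "(E has_real_derivative - k\<^sup>2 * (2 * s'\<^sup>2 * s * c * d - 2 * s' * c' * d' * s\<^sup>2)) (at v)"
      unfolding E_def abbr
      by (rule derivative_eq_intros D D' refl)+ (simp add: algebra_simps power2_eq_square)
    have "((\<lambda>v. N v / E v) has_real_derivative
      ((- s * s' * d\<^sup>2 - k\<^sup>2 * s * s' * c\<^sup>2 + s * s' * d'\<^sup>2 + k\<^sup>2 * s * s' * c'\<^sup>2) * E v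
        - N v * (- k\<^sup>2 * (2 * s'\<^sup>2 * s * c * d - 2 * s' * c' * d' * s\<^sup>2))) / (E v * E v)) (at v)"
      by (rule DERIV_divide[OF N E]) (use Epos[of v] in simp)
    moreover have "(- s * s' * d\<^sup>2 - k\<^sup>2 * s * s' * c\<^sup>2 + s * s' * d'\<^sup>2 + k\<^sup>2 * s * s' * c'\<^sup>2) * (1 - k\<^sup>2 * s'\<^sup>2 * s\<^sup>2)
        - (s' * c * d + s * c' * d') * (- k\<^sup>2 * (2 * s'\<^sup>2 * s * c * d - 2 * s' * c' * d' * s\<^sup>2)) = 0"
      using rel by algebra
    ultimately show "((\<lambda>v. N v / E v) has_real_derivative 0) (at v)"
      by (simp add: N_def E_def abbr)
  qed
  have "N v / E v = jsn k a"
    unfolding const[of v] by (simp add: N_def E_def jacobi_at_0[OF k])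
  then show ?thesis
    by (simp add: N_def E_def a_def mult_ac)
qed

text \<open>The formulas for \<open>u + v\<close> and \<open>u - v\<close> share their denominator,
  so the difference of squares is \<open>4 A B\<close> over its square. The result separates into a
  factor in \<open>u\<close> and a factor in \<open>v\<close>, the shape of \<open>phi1\<close>
  later on.\<close>

lemma jsn_sq_add_diff:
  assumes k: "k\<^sup>2 < 1"
  shows "(jsn k (u + v))\<^sup>2 - (jsn k (u - v))\<^sup>2 = 4 * (jsn k u * jcn k u * jdn k u) * (jsn k v * jcn k v * jdn k v)
    / (1 - k\<^sup>2 * (jsn k u)\<^sup>2 * (jsn k v)\<^sup>2)\<^sup>2"
proof -
  let ?A = "jsn k u * jcn k v * jdn k v" and ?B = "jsn k v * jcn k u * jdn k u"
    and ?E = "1 - k\<^sup>2 * (jsn k u)\<^sup>2 * (jsn k v)\<^sup>2"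
  have "jsn k (u - v) = (?A - ?B) / ?E"
    using jsn_add[OF k, of u "- v"] by (simp add: jsn_minus jcn_minus jdn_minus k)
  moreover have "jsn k (u + v) = (?A + ?B) / ?E"
    by (rule jsn_add[OF k])
  moreover have "(?A + ?B)\<^sup>2 - (?A - ?B)\<^sup>2 = 4 * (jsn k u * jcn k u * jdn k u) * (jsn k v * jcn k v * jdn k v)"
    by algebra
  ultimately show ?thesis
    by (simp only: power_divide flip: diff_divide_distrib)
qed

section \<open>Theta quotients as elliptic functions\<close>

text \<open>\<open>\<sigma>\<close> is the square of the direction of the line to which the thetas
  are restricted: 1 on the real axis, -1 on the imaginary axis.\<close>

definition theta_pair_ode :: "real \<Rightarrow> real \<Rightarrow> real \<Rightarrow> (real \<Rightarrow> real) \<Rightarrow> (real \<Rightarrow> real) \<Rightarrow> bool" where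
  "theta_pair_ode \<sigma> A B F G \<longleftrightarrow> (\<exists>F1 F2 G1 G2. \<forall>x.
    (F has_real_derivative F1 x) (at x) \<and> (F1 has_real_derivative F2 x) (at x) \<and>
    (G has_real_derivative G1 x) (at x) \<and> (G1 has_real_derivative G2 x) (at x) \<and>
    F x * F2 x - (F1 x)\<^sup>2 = \<sigma> * (A * (F x)\<^sup>2 + B * (G x)\<^sup>2) \<and>
    G x * G2 x - (G1 x)\<^sup>2 = \<sigma> * (A * (G x)\<^sup>2 + B * (F x)\<^sup>2))"

text \<open>The order of quantifiers matters: one pair \<open>A\<close>, \<open>B\<close> serves
  both axes, and the common \<open>B\<close> later yields the same frequency on both.\<close>

lemma theta_line_ode:
  assumes t: "t > 0"
  shows "\<exists>A B. \<forall>\<omega>\<in>{1, \<i>}. theta_pair_ode (Re (\<omega>\<^sup>2)) A B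
    (\<lambda>x. Re (th 0 t (\<omega> * of_real x))) (\<lambda>x. Re (th (1/2) t (\<omega> * of_real x)))"
proof -
  obtain A B where AB:
    "\<And>z. th 0 t z * deriv (deriv (th 0 t)) z - (deriv (th 0 t) z)\<^sup>2 = of_real A * (th 0 t z)\<^sup>2 + of_real B * (th (1/2) t z)\<^sup>2"
    "\<And>z. th (1/2) t z * deriv (deriv (th (1/2) t)) z - (deriv (th (1/2) t) z)\<^sup>2 = of_real A * (th (1/2) t z)\<^sup>2 + of_real B * (th 0 t z)\<^sup>2"
    using theta_second_deriv[OF t] by metis
  have main: "Re (H (\<omega> * of_real x)) * Re (\<omega>\<^sup>2 * deriv (deriv H) (\<omega> * of_real x)) - (Re (\<omega> * deriv H (\<omega> * of_real x)))\<^sup>2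
      = Re (\<omega>\<^sup>2) * (A * (Re (H (\<omega> * of_real x)))\<^sup>2 + B * (Re (L (\<omega> * of_real x)))\<^sup>2)"
    if \<omega>: "\<omega> \<in> {1, \<i>}" and H: "H holomorphic_on UNIV" "\<And>y. H (\<omega> * of_real y) \<in> \<real>" "\<And>y. L (\<omega> * of_real y) \<in> \<real>"
      and id: "\<And>z. H z * deriv (deriv H) z - (deriv H z)\<^sup>2 = of_real A * (H z)\<^sup>2 + of_real B * (L z)\<^sup>2" for \<omega> H L x
  proof -
    let ?z = "\<omega> * of_real x"
    obtain h l h1 h2 where r: "H ?z = of_real h" "L ?z = of_real l" "\<omega> * deriv H ?z = of_real h1"
        "\<omega>\<^sup>2 * deriv (deriv H) ?z = of_real h2"
      using H restrict_to_line(2)[OF H(1,2)] restrict_to_line2(2)[OF H(1,2)] by (metis Reals_cases)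
    have w: "\<omega>\<^sup>2 = of_real (Re (\<omega>\<^sup>2))" using \<omega> by auto
    have "H ?z * (\<omega>\<^sup>2 * deriv (deriv H) ?z) - (\<omega> * deriv H ?z)\<^sup>2 = \<omega>\<^sup>2 * (of_real A * (H ?z)\<^sup>2 + of_real B * (L ?z)\<^sup>2)"
      unfolding id[symmetric] by (simp add: algebra_simps power2_eq_square)
    then have "of_real (h * h2 - h1\<^sup>2) = (of_real (Re (\<omega>\<^sup>2) * (A * h\<^sup>2 + B * l\<^sup>2)) :: complex)"
      unfolding r by (subst (asm) w) simp
    then show ?thesis
      unfolding r Re_complex_of_real by (simp only: of_real_eq_iff)
  qed
  show ?thesis
  proof (rule exI[of _ A], rule exI[of _ B], rule ballI)
    fix \<omega> :: complex assume \<omega>: "\<omega> \<in> {1, \<i>}"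
    let ?F1 = "\<lambda>x. Re (\<omega> * deriv (th 0 t) (\<omega> * of_real x))"
      and ?F2 = "\<lambda>x. Re (\<omega>\<^sup>2 * deriv (deriv (th 0 t)) (\<omega> * of_real x))"
      and ?G1 = "\<lambda>x. Re (\<omega> * deriv (th (1/2) t) (\<omega> * of_real x))"
      and ?G2 = "\<lambda>x. Re (\<omega>\<^sup>2 * deriv (deriv (th (1/2) t)) (\<omega> * of_real x))"
    note holo = holomorphic_th[OF t] and real = th_real_on_axes[OF \<omega>]
    show "theta_pair_ode (Re (\<omega>\<^sup>2)) A B
        (\<lambda>x. Re (th 0 t (\<omega> * of_real x))) (\<lambda>x. Re (th (1/2) t (\<omega> * of_real x)))"
      unfolding theta_pair_ode_def
      by (intro exI[of _ ?F1] exI[of _ ?F2] exI[of _ ?G1] exI[of _ ?G2] allI conjI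
          restrict_to_line(1)[OF holo real(1)] restrict_to_line2(1)[OF holo real(1)]
          restrict_to_line(1)[OF holo real(2)] restrict_to_line2(1)[OF holo real(2)]
          main[OF \<omega> holo real(1,2) AB(1)] main[OF \<omega> holo real(2,1) AB(2)])
  qed
qed

text \<open>The coefficient \<open>A\<close> enters both second logarithmic derivatives equally and
  cancels in the quotient.\<close>

lemma quotient_ode:
  assumes "theta_pair_ode \<sigma> A B F G" and nz: "\<And>x. F x \<noteq> 0"
  obtains f1 f2 where "\<And>x. ((\<lambda>x. G x / F x) has_real_derivative f1 x) (at x)"
    "\<And>x. (f1 has_real_derivative f2 x) (at x)"
    "\<And>x. G x / F x * f2 x - (f1 x)\<^sup>2 = \<sigma> * B * (1 - (G x / F x) ^ 4)"
proof -
  obtain F1 F2 G1 G2 where F: "\<And>x. (F has_real_derivative F1 x) (at x)" "\<And>x. (F1 has_real_derivative F2 x) (at x)"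
    and G: "\<And>x. (G has_real_derivative G1 x) (at x)" "\<And>x. (G1 has_real_derivative G2 x) (at x)"
    and eq: "\<And>x. F x * F2 x - (F1 x)\<^sup>2 = \<sigma> * (A * (F x)\<^sup>2 + B * (G x)\<^sup>2)"
      "\<And>x. G x * G2 x - (G1 x)\<^sup>2 = \<sigma> * (A * (G x)\<^sup>2 + B * (F x)\<^sup>2)"
    using assms(1) unfolding theta_pair_ode_def by blast
  define f f1 f2 where d: "f = (\<lambda>x. G x / F x)" "f1 = (\<lambda>x. (G1 x - f x * F1 x) / F x)"
    "f2 = (\<lambda>x. (G2 x - 2 * f1 x * F1 x - f x * F2 x) / F x)"
  have f: "(f has_real_derivative f1 x) (at x)" for x
    unfolding d using nz[of x] by (auto intro!: derivative_eq_intros F G simp: field_simps)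
  have "(f1 has_real_derivative ((G2 x - (f1 x * F1 x + F2 x * f x)) * F x - (G1 x - f x * F1 x) * F1 x) / (F x * F x)) (at x)" for x
    by (subst d(2)) (rule DERIV_divide DERIV_diff DERIV_mult F G f nz)+
  moreover have "((G2 x - (f1 x * F1 x + F2 x * f x)) * F x - (G1 x - f x * F1 x) * F1 x) / (F x * F x) = f2 x" for x
  proof -
    have "G1 x - f x * F1 x = f1 x * F x" using nz[of x] by (simp add: d(2))
    then show ?thesis
      unfolding d(3) using nz[of x] by (simp add: field_simps)
  qed
  ultimately have f1: "(f1 has_real_derivative f2 x) (at x)" for x
    by simp
  have "f x * f2 x - (f1 x)\<^sup>2 = \<sigma> * B * (1 - f x ^ 4)" for x
  proof -
    have rel: "G x = f x * F x" "G1 x = f1 x * F x + f x * F1 x" "G2 x = f2 x * F x + 2 * f1 x * F1 x + f x * F2 x"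
      using nz[of x] by (simp_all add: d)
    have "(F x)\<^sup>2 * (f x * f2 x - (f1 x)\<^sup>2) = (F x)\<^sup>2 * (\<sigma> * B * (1 - f x ^ 4))"
      using eq(1)[of x] eq(2)[of x] unfolding rel by algebra
    then show ?thesis using nz[of x] by simp
  qed
  then show thesis
    using that[of f1 f2] f f1 by (simp add: d(1))
qed

section \<open>Model solutions built from sn and 1/dn\<close>

lemma scaled_sn_ode:
  fixes a :: real
  assumes k: "0 < k" "k < 1" and B: "B = - k * \<mu>\<^sup>2"
  defines "v \<equiv> (\<lambda>x. sqrt k * jsn k (a + \<mu> * x))"
  obtains v1 v2 where "\<And>x. (v has_real_derivative v1 x) (at x)" "\<And>x. (v1 has_real_derivative v2 x) (at x)"
    "\<And>x. v2 x = 0 + B * (k + 1 / k) * v x + (- 2 * B) * v x ^ 3" "v1 0 = sqrt k * \<mu> * jcn k a * jdn k a"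
proof -
  have k2: "k\<^sup>2 < 1" using k by (simp add: power_less_one_iff)
  have lin: "((\<lambda>x. a + \<mu> * x) has_real_derivative \<mu>) (at x)" for x
    by (auto intro!: derivative_eq_intros)
  note D = DERIV_chain2[OF jsn_deriv[OF k2] lin] DERIV_chain2[OF jcn_deriv[OF k2] lin] DERIV_chain2[OF jdn_deriv[OF k2] lin]
  define v1 where "v1 = (\<lambda>x. sqrt k * \<mu> * jcn k (a + \<mu> * x) * jdn k (a + \<mu> * x))"
  define v2 where "v2 = (\<lambda>x. sqrt k * \<mu>\<^sup>2 * (- (1 + k\<^sup>2) * jsn k (a + \<mu> * x) + 2 * k\<^sup>2 * jsn k (a + \<mu> * x) ^ 3))"
  have "(v has_real_derivative v1 x) (at x)" for x
    unfolding v_def v1_def by (rule derivative_eq_intros D refl)+ (simp add: mult_ac)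
  moreover have "(v1 has_real_derivative v2 x) (at x)" for x
  proof -
    let ?s = "jsn k (a + \<mu> * x)" and ?c = "jcn k (a + \<mu> * x)" and ?d = "jdn k (a + \<mu> * x)"
    have "(v1 has_real_derivative - (sqrt k * \<mu>\<^sup>2 * ?s * (?d\<^sup>2 + k\<^sup>2 * ?c\<^sup>2))) (at x)"
      unfolding v1_def by (rule derivative_eq_intros D refl)+ (simp add: algebra_simps power2_eq_square)
    also have "- (sqrt k * \<mu>\<^sup>2 * ?s * (?d\<^sup>2 + k\<^sup>2 * ?c\<^sup>2)) = v2 x"
      unfolding v2_def jsn_jcn_sq jdn_sq[OF k2] by (simp add: algebra_simps power2_eq_square power3_eq_cube)
    finally show ?thesis .
  qed
  moreover have "v2 x = 0 + B * (k + 1 / k) * v x + (- 2 * B) * v x ^ 3" for x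
  proof -
    have "sqrt k ^ 3 = k * sqrt k" using k by (simp add: power3_eq_cube)
    moreover have "B * (k + 1 / k) = - \<mu>\<^sup>2 * (1 + k\<^sup>2)"
      using k unfolding B by (simp add: field_simps power2_eq_square)
    ultimately show ?thesis
      unfolding v_def v2_def B by (simp add: power_mult_distrib algebra_simps power2_eq_square)
  qed
  moreover have "v1 0 = sqrt k * \<mu> * jcn k a * jdn k a"
    by (simp add: v1_def)
  ultimately show thesis by (rule that)
qed

text \<open>Counterpart of Jacobi's imaginary transformation: along the imaginary axis
  \<open>B\<close> changes sign and cd of modulus \<open>k\<close> becomes 1/dn of the complementary
  modulus. It is verified here by differentiation.\<close>

lemma scaled_nd_ode:
  assumes k: "0 < k" "k < 1" and B: "B = - k * \<mu>\<^sup>2" and k': "k' = sqrt (1 - k\<^sup>2)"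
  defines "v \<equiv> (\<lambda>x. sqrt k / jdn k' (\<mu> * x))"
  obtains v1 v2 where "\<And>x. (v has_real_derivative v1 x) (at x)" "\<And>x. (v1 has_real_derivative v2 x) (at x)"
    "\<And>x. v2 x = 0 + - B * (k + 1 / k) * v x + (- 2 * (- B)) * v x ^ 3" "v1 0 = 0"
proof -
  have "k\<^sup>2 < 1" using k by (simp add: power_less_one_iff)
  then have k'sq: "k'\<^sup>2 = 1 - k\<^sup>2" by (simp add: k')
  then have k2: "k'\<^sup>2 < 1" using k by simp
  have lin: "((\<lambda>x. \<mu> * x) has_real_derivative \<mu>) (at x)" for x
    by (auto intro!: derivative_eq_intros)
  note D = DERIV_chain2[OF jsn_deriv[OF k2] lin] DERIV_chain2[OF jcn_deriv[OF k2] lin] DERIV_chain2[OF jdn_deriv[OF k2] lin]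
  define v1 where "v1 = (\<lambda>x. sqrt k * \<mu> * k'\<^sup>2 * (jsn k' (\<mu> * x) * jcn k' (\<mu> * x) / (jdn k' (\<mu> * x))\<^sup>2))"
  define v2 where "v2 = (\<lambda>x. sqrt k * \<mu>\<^sup>2 * (((1 + k\<^sup>2) * (jdn k' (\<mu> * x))\<^sup>2 - 2 * k\<^sup>2) / jdn k' (\<mu> * x) ^ 3))"
  have dnz: "jdn k' (\<mu> * x) \<noteq> 0" for x
    using jdn_pos[OF k2, of "\<mu> * x"] by simp
  have "(v has_real_derivative v1 x) (at x)" for x
    unfolding v_def v1_def using dnz[of x]
    by (auto intro!: derivative_eq_intros D simp: power2_eq_square)
  moreover have "(v1 has_real_derivative v2 x) (at x)" for x
  proof -
    let ?s = "jsn k' (\<mu> * x)" and ?c = "jcn k' (\<mu> * x)" and ?d = "jdn k' (\<mu> * x)"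
    have num: "k'\<^sup>2 * ((?c\<^sup>2 - ?s\<^sup>2) * ?d\<^sup>2 + 2 * k'\<^sup>2 * ?s\<^sup>2 * ?c\<^sup>2) = (1 + k\<^sup>2) * ?d\<^sup>2 - 2 * k\<^sup>2"
      using jsn_jcn_sq[of k' "\<mu> * x"] jdn_sq[OF k2, of "\<mu> * x"] k'sq by algebra
    have "((\<lambda>x. jsn k' (\<mu> * x) * jcn k' (\<mu> * x) / (jdn k' (\<mu> * x))\<^sup>2) has_real_derivative
        \<mu> * (((?c\<^sup>2 - ?s\<^sup>2) * ?d\<^sup>2 + 2 * k'\<^sup>2 * ?s\<^sup>2 * ?c\<^sup>2) / ?d ^ 3)) (at x)"
    proof -
      have "((\<lambda>x. jsn k' (\<mu> * x) * jcn k' (\<mu> * x)) has_real_derivative \<mu> * (?c\<^sup>2 - ?s\<^sup>2) * ?d) (at x)"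
        by (rule derivative_eq_intros D refl)+ (simp add: algebra_simps power2_eq_square)
      moreover have "((\<lambda>x. (jdn k' (\<mu> * x))\<^sup>2) has_real_derivative - (2 * \<mu> * k'\<^sup>2 * ?s * ?c * ?d)) (at x)"
        by (rule derivative_eq_intros D refl)+ (simp add: algebra_simps power2_eq_square)
      ultimately have "((\<lambda>x. jsn k' (\<mu> * x) * jcn k' (\<mu> * x) / (jdn k' (\<mu> * x))\<^sup>2) has_real_derivative
          (\<mu> * (?c\<^sup>2 - ?s\<^sup>2) * ?d * ?d\<^sup>2 - ?s * ?c * - (2 * \<mu> * k'\<^sup>2 * ?s * ?c * ?d)) / (?d\<^sup>2 * ?d\<^sup>2)) (at x)"
        by (rule DERIV_divide) (use dnz[of x] in simp)
      also have "(\<mu> * (?c\<^sup>2 - ?s\<^sup>2) * ?d * ?d\<^sup>2 - ?s * ?c * - (2 * \<mu> * k'\<^sup>2 * ?s * ?c * ?d)) / (?d\<^sup>2 * ?d\<^sup>2)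
          = \<mu> * (((?c\<^sup>2 - ?s\<^sup>2) * ?d\<^sup>2 + 2 * k'\<^sup>2 * ?s\<^sup>2 * ?c\<^sup>2) / ?d ^ 3)"
        using dnz[of x] by (simp add: field_simps power2_eq_square power3_eq_cube)
      finally show ?thesis .
    qed
    then have "(v1 has_real_derivative sqrt k * \<mu> * k'\<^sup>2 * (\<mu> * (((?c\<^sup>2 - ?s\<^sup>2) * ?d\<^sup>2 + 2 * k'\<^sup>2 * ?s\<^sup>2 * ?c\<^sup>2) / ?d ^ 3))) (at x)"
      unfolding v1_def by (rule DERIV_cmult)
    also have "sqrt k * \<mu> * k'\<^sup>2 * (\<mu> * (((?c\<^sup>2 - ?s\<^sup>2) * ?d\<^sup>2 + 2 * k'\<^sup>2 * ?s\<^sup>2 * ?c\<^sup>2) / ?d ^ 3)) = v2 x"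
      unfolding v2_def num[symmetric] by (simp add: power2_eq_square)
    finally show ?thesis .
  qed
  moreover have "v2 x = 0 + - B * (k + 1 / k) * v x + (- 2 * (- B)) * v x ^ 3" for x
  proof -
    have "sqrt k ^ 3 = k * sqrt k" using k by (simp add: power3_eq_cube)
    moreover have "- B * (k + 1 / k) = \<mu>\<^sup>2 * (1 + k\<^sup>2)"
      using k unfolding B by (simp add: field_simps power2_eq_square)
    ultimately show ?thesis
      unfolding v_def v2_def B using dnz[of x] k
      by (simp add: power_divide field_simps power2_eq_square power3_eq_cube)
  qed
  moreover have "v1 0 = 0"
    by (simp add: v1_def jacobi_at_0[OF k2])
  ultimately show thesis by (rule that)
qed

text \<open>With \<open>\<mu>\<close> read off from \<open>B\<close>, uniqueness gives
  \<open>f x = sqrt k * jsn k (ellK k + \<mu> * x)\<close> up to pi/2. The first zero of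
  \<open>f\<close> is at pi/2, that of the model at \<open>\<mu> * x = ellK k\<close>, and equating
  them determines \<open>\<mu>\<close>.\<close>

lemma real_line_modulus:
  assumes k: "0 < k" "k < 1"
    and f: "\<And>x. (f has_real_derivative f1 x) (at x)" "\<And>x. (f1 has_real_derivative f2 x) (at x)"
    and eq: "\<And>x. f x * f2 x - (f1 x)\<^sup>2 = B * (1 - f x ^ 4)"
    and f0: "f 0 = sqrt k" and even: "\<And>x. f (- x) = f x"
    and pos: "\<And>x. \<bar>x\<bar> < pi/2 \<Longrightarrow> f x > 0" and zero: "f (pi/2) = 0"
  shows "B = - k * (2 * ellK k / pi)\<^sup>2"
    and "\<bar>x\<bar> \<le> pi/2 \<Longrightarrow> (f x)\<^sup>2 = k * (jsn k (ellK k + 2 * ellK k / pi * x))\<^sup>2"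
proof -
  have k2: "k\<^sup>2 < 1" using k by (simp add: power_less_one_iff)
  have f10: "f1 0 = 0" by (rule even_deriv_0[OF f(1) even])
  have f2: "f2 x = 0 + B * (k + 1 / k) * f x + (- 2 * B) * f x ^ 3" if "0 \<le> x" "x < pi/2" for x
  proof -
    have "f2 x = B * (k + 1 / k) * f x + (- 2 * B) * f x ^ 3"
    proof (rule first_integral[OF f eq f10, of k "{- (pi/2)<..<pi/2}"])
      show "f y > 0" if "y \<in> {- (pi/2)<..<pi/2}" for y
        using that by (intro pos) (auto simp only: abs_less_iff greaterThanLessThan_iff)
    qed (use that k f0 in auto)
    then show ?thesis by simp
  qed
  have "(f1 (pi/2))\<^sup>2 = - B" using eq[of "pi/2"] zero by simp
  then have "B \<le> 0" by (metis neg_0_le_iff_le zero_le_power2)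
  \<comment> \<open>For \<open>B = 0\<close> the solution would stay at its initial value
    \<open>sqrt k\<close> all the way to pi/2, where it vanishes.\<close>
  moreover have "B \<noteq> 0"
  proof
    assume "B = 0"
    have "f (pi/2) = sqrt k"
      by (rule cubic_ode_unique[where u = f and v = "\<lambda>_. sqrt k" and X = "pi/2" and b = 0 and p = 0 and r = 0, OF f DERIV_const DERIV_const])
         (use f2 f0 f10 \<open>B = 0\<close> in auto)
    then show False using zero k by simp
  qed
  ultimately have "B < 0" by simp
  define \<mu> where "\<mu> = sqrt (- B / k)"
  have "\<mu> > 0" using \<open>B < 0\<close> k by (simp add: \<mu>_def divide_neg_pos)
  have "\<mu>\<^sup>2 = - B / k"
    unfolding \<mu>_def using \<open>B < 0\<close> k by (intro real_sqrt_pow2 divide_nonneg_pos) auto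
  then have B: "B = - k * \<mu>\<^sup>2" using k by simp
  obtain v1 v2 where v: "\<And>x. ((\<lambda>x. sqrt k * jsn k (ellK k + \<mu> * x)) has_real_derivative v1 x) (at x)"
      "\<And>x. (v1 has_real_derivative v2 x) (at x)"
      "\<And>x. v2 x = 0 + B * (k + 1 / k) * (sqrt k * jsn k (ellK k + \<mu> * x)) + (- 2 * B) * (sqrt k * jsn k (ellK k + \<mu> * x)) ^ 3"
      "v1 0 = sqrt k * \<mu> * jcn k (ellK k) * jdn k (ellK k)"
    using scaled_sn_ode[OF k B, of "ellK k"] by blast
  have sol: "f x = sqrt k * jsn k (ellK k + \<mu> * x)" if "0 \<le> x" "x \<le> pi/2" for x
  proof (rule cubic_ode_unique[OF f v(1,2) f2 v(3) _ _ that])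
    show "f 0 = sqrt k * jsn k (ellK k + \<mu> * 0)" "f1 0 = v1 0"
      using k2 by (simp_all add: f0 f10 v(4) jsn_def jcn_def jam_K)
  qed
  \<comment> \<open>If the left side were smaller, sn would still be positive at pi/2; if larger, it
    would vanish inside the interval on which \<open>f > 0\<close>.\<close>
  have K: "\<mu> * (pi/2) = ellK k"
  proof (rule linorder_cases[of "\<mu> * (pi/2)" "ellK k"])
    assume less: "\<mu> * (pi/2) < ellK k"
    have "jam k (ellK k) < jam k (ellK k + \<mu> * (pi/2))" "jam k (ellK k + \<mu> * (pi/2)) < jam k (0 + 2 * ellK k)"
      using less \<open>\<mu> > 0\<close> strict_monoD[OF jam_strict_mono[OF k2]] by auto
    then have "jsn k (ellK k + \<mu> * (pi/2)) > 0"
      unfolding jsn_def jam_K[OF k2] jam_plus_2K[OF k2] jam_0[OF k2] by (intro sin_gt_zero) (auto simp: pi_half_gt_zero intro: less_trans[of 0 "pi/2"])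
    then show ?thesis using sol[of "pi/2"] zero k by simp
  next
    assume less: "ellK k < \<mu> * (pi/2)"
    define x where "x = ellK k / \<mu>"
    have x: "0 \<le> x" "x < pi/2" "\<mu> * x = ellK k"
      using less \<open>\<mu> > 0\<close> ellK_pos[OF k2] by (auto simp: x_def field_simps)
    have "jsn k (ellK k + \<mu> * x) = 0"
      using jam_plus_2K[OF k2, of 0] by (simp add: x(3) jsn_def k2)
    then show ?thesis using sol[of x] pos[of x] x by simp
  qed
  then have \<mu>: "\<mu> = 2 * ellK k / pi" by (simp add: field_simps)
  show "B = - k * (2 * ellK k / pi)\<^sup>2" using B \<mu> by simp
  assume x: "\<bar>x\<bar> \<le> pi/2"
  \<comment> \<open>The model is symmetric about the quarter period; this carries the result to
    negative \<open>x\<close>, where \<open>f\<close> is known by evenness.\<close>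
  have "(jsn k (ellK k + \<mu> * x))\<^sup>2 = (jsn k (ellK k + \<mu> * \<bar>x\<bar>))\<^sup>2"
  proof (cases "x \<ge> 0")
    case False
    have "jsn k (ellK k + \<mu> * x) = - jsn k (ellK k + \<mu> * \<bar>x\<bar> - 2 * ellK k)"
      using jsn_minus[OF k2, of "ellK k + \<mu> * \<bar>x\<bar> - 2 * ellK k"] False by (simp add: algebra_simps)
    also have "\<dots> = jsn k (ellK k + \<mu> * \<bar>x\<bar>)"
      using jsn_plus_2K[OF k2, of "ellK k + \<mu> * \<bar>x\<bar> - 2 * ellK k"] by simp
    finally show ?thesis by simp
  qed simp
  moreover have "f x = sqrt k * jsn k (ellK k + \<mu> * \<bar>x\<bar>)"
    using sol[of "\<bar>x\<bar>"] x even[of x] by (simp add: abs_if split: if_splits)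
  then have "(f x)\<^sup>2 = k * (jsn k (ellK k + \<mu> * \<bar>x\<bar>))\<^sup>2"
    using k by (simp add: power_mult_distrib)
  ultimately show "(f x)\<^sup>2 = k * (jsn k (ellK k + 2 * ellK k / pi * x))\<^sup>2"
    unfolding \<mu> by simp
qed

text \<open>The model \<open>sqrt k / jdn k' (\<mu> * x)\<close> starts at \<open>sqrt k\<close> and
  equals \<open>1 / sqrt k\<close> only where the square of sn is 1, for the first time at
  \<open>\<mu> * x = ellK k'\<close>. Comparing this with the first such point \<open>T\<close> of
  \<open>f\<close> gives the claim.\<close>

lemma imaginary_line_modulus:
  assumes k: "0 < k" "k < 1" and k': "k' = sqrt (1 - k\<^sup>2)" and B: "B = - k * \<mu>\<^sup>2" and "\<mu> > 0" "T > 0"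
    and f: "\<And>x. (f has_real_derivative f1 x) (at x)" "\<And>x. (f1 has_real_derivative f2 x) (at x)"
    and eq: "\<And>x. f x * f2 x - (f1 x)\<^sup>2 = - B * (1 - f x ^ 4)"
    and f0: "f 0 = sqrt k" and even: "\<And>x. f (- x) = f x"
    and pos: "\<And>x. f x > 0"
    and top: "f T = 1 / sqrt k" and less: "\<And>x. 0 \<le> x \<Longrightarrow> x < T \<Longrightarrow> f x \<noteq> 1 / sqrt k"
  shows "ellK k' = \<mu> * T"
proof -
  have "k\<^sup>2 < 1" using k by (simp add: power_less_one_iff)
  then have k'sq: "k'\<^sup>2 = 1 - k\<^sup>2" by (simp add: k')
  then have k2: "k'\<^sup>2 < 1" using k by simp
  have k'pos: "k'\<^sup>2 > 0" using k'sq \<open>k\<^sup>2 < 1\<close> by simp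
  have f10: "f1 0 = 0" by (rule even_deriv_0[OF f(1) even])
  have f2: "f2 x = 0 + - B * (k + 1 / k) * f x + (- 2 * (- B)) * f x ^ 3" for x
    using first_integral[OF f eq f10, of k UNIV x] k f0 pos by auto
  obtain v1 v2 where v: "\<And>x. ((\<lambda>x. sqrt k / jdn k' (\<mu> * x)) has_real_derivative v1 x) (at x)"
      "\<And>x. (v1 has_real_derivative v2 x) (at x)"
      "\<And>x. v2 x = 0 + - B * (k + 1 / k) * (sqrt k / jdn k' (\<mu> * x)) + (- 2 * (- B)) * (sqrt k / jdn k' (\<mu> * x)) ^ 3"
      "v1 0 = 0"
    using scaled_nd_ode[OF k B k'] by blast
  have sol: "f x = sqrt k / jdn k' (\<mu> * x)" if "0 \<le> x" for x
  proof (rule cubic_ode_unique[OF f v(1,2) f2 v(3) _ _ that order_refl])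
    show "f 0 = sqrt k / jdn k' (\<mu> * 0)" "f1 0 = v1 0"
      using k2 by (simp_all add: f0 f10 v(4) jacobi_at_0)
  qed
  have iff: "f x = 1 / sqrt k \<longleftrightarrow> (jsn k' (\<mu> * x))\<^sup>2 = 1" if "0 \<le> x" for x
  proof -
    let ?d = "jdn k' (\<mu> * x)"
    have "?d > 0" by (rule jdn_pos[OF k2])
    then have "f x = 1 / sqrt k \<longleftrightarrow> ?d = k"
      unfolding sol[OF that] using k by (simp add: field_simps)
    also have "\<dots> \<longleftrightarrow> ?d\<^sup>2 = k\<^sup>2"
      using \<open>?d > 0\<close> k by (simp add: power2_eq_iff_nonneg)
    also have "\<dots> \<longleftrightarrow> k'\<^sup>2 * (jsn k' (\<mu> * x))\<^sup>2 = k'\<^sup>2 * 1"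
      using k'sq unfolding jdn_sq[OF k2] mult_1_right by (intro iffI) linarith+
    also have "\<dots> \<longleftrightarrow> (jsn k' (\<mu> * x))\<^sup>2 = 1"
      using k'pos by simp
    finally show ?thesis .
  qed
  show ?thesis
  proof (rule linorder_cases[of "ellK k'" "\<mu> * T"])
    assume l: "ellK k' < \<mu> * T"
    define x where "x = ellK k' / \<mu>"
    have x: "0 \<le> x" "x < T" "\<mu> * x = ellK k'"
      using l \<open>\<mu> > 0\<close> ellK_pos[OF k2] by (auto simp: x_def field_simps)
    have "(jsn k' (\<mu> * x))\<^sup>2 = 1"
      by (simp add: x(3) jsn_def jam_K k2)
    then show ?thesis using iff[of x] less[of x] x by simp
  next
    assume g: "\<mu> * T < ellK k'"
    have "0 < \<mu> * T" using \<open>\<mu> > 0\<close> \<open>T > 0\<close> by simp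
    then have "jcn k' (\<mu> * T) > 0"
      by (rule jacobi_between[OF k2 _ g])
    then have "(jsn k' (\<mu> * T))\<^sup>2 \<noteq> 1"
      using jsn_jcn_sq[of k' "\<mu> * T"] by auto
    then show ?thesis using iff[of T] top \<open>T > 0\<close> by simp
  qed
qed

lemma periodic_reduction:
  fixes P :: "real \<Rightarrow> bool"
  assumes per: "\<And>z. P (z + p) \<longleftrightarrow> P z" and "p > 0" and base: "\<And>z. \<bar>z\<bar> \<le> p/2 \<Longrightarrow> P z"
  shows "P z"
proof -
  have shift: "P (z + of_int n * p) \<longleftrightarrow> P z" for z n
  proof (induction n rule: int_induct[where k = 0])
    case (step1 i)
    then show ?case using per[of "z + of_int i * p"] by (simp add: algebra_simps)
  next
    case (step2 i)
    then show ?case using per[of "z + of_int (i - 1) * p"] by (simp add: algebra_simps)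
  qed simp
  define n where "n = - \<lfloor>z / p + 1/2\<rfloor>"
  have "of_int (- n) \<le> z / p + 1/2" "z / p + 1/2 < of_int (- n) + 1"
    unfolding n_def by linarith+
  then have "of_int (- n) * p \<le> z + p/2" "z + p/2 < (of_int (- n) + 1) * p"
    using \<open>p > 0\<close> by (simp_all add: field_simps)
  then have "\<bar>z + of_int n * p\<bar> \<le> p/2"
    by (intro abs_leI) (simp_all add: algebra_simps)
  then show ?thesis using base shift by blast
qed

text \<open>The real axis gives \<open>B = - k * \<mu>^2\<close> with
  \<open>\<mu> = 2 K / pi\<close>, the imaginary axis with the same \<open>B\<close> gives
  \<open>K' = \<mu> * t / 2\<close>. Together \<open>pi * K' / K = t\<close>. The second claim
  rewrites theta_2 as a multiple of theta_3 through the quotient.\<close>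

lemma theta_modulus:
  assumes t: "t > 0" and k: "tmod t = k"
  defines "F \<equiv> \<lambda>x. Re (th 0 t (of_real x))"
  shows "nome k = exp (- t)"
    and "\<exists>F1 F2 A. \<forall>x. (F has_real_derivative F1 x) (at x) \<and> (F1 has_real_derivative F2 x) (at x) \<and>
      F x * F2 x - (F1 x)\<^sup>2 = (A - (2 * ellK k / pi)\<^sup>2 * k\<^sup>2 * (jsn k (ellK k + 2 * ellK k / pi * x))\<^sup>2) * (F x)\<^sup>2"
proof -
  have k01: "0 < k" "k < 1" using tmod_pos[OF t] tmod_less_1[OF t] k by auto
  have k2: "k\<^sup>2 < 1" using k01 by (simp add: power_less_one_iff)
  define G where "G = (\<lambda>x. Re (th (1/2) t (of_real x)))"
  define Fi Gi where FGi: "Fi = (\<lambda>x. Re (th 0 t (\<i> * of_real x)))" "Gi = (\<lambda>x. Re (th (1/2) t (\<i> * of_real x)))"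
  obtain A B where "\<forall>\<omega>\<in>{1, \<i>}. theta_pair_ode (Re (\<omega>\<^sup>2)) A B
      (\<lambda>x. Re (th 0 t (\<omega> * of_real x))) (\<lambda>x. Re (th (1/2) t (\<omega> * of_real x)))"
    using theta_line_ode[OF t] by blast
  then have real: "theta_pair_ode 1 A B F G" and imag: "theta_pair_ode (- 1) A B Fi Gi"
    by (simp_all add: F_def G_def FGi)
  obtain F1 F2 where F12: "\<And>x. (F has_real_derivative F1 x) (at x)" "\<And>x. (F1 has_real_derivative F2 x) (at x)"
      "\<And>x. F x * F2 x - (F1 x)\<^sup>2 = 1 * (A * (F x)\<^sup>2 + B * (G x)\<^sup>2)"
    using real unfolding theta_pair_ode_def by blast
  have Fpos: "F x > 0" for x unfolding F_def by (rule Re_th0_real_pos[OF t])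
  have Fipos: "Fi x > 0" "Gi x > 0" for x unfolding FGi by (rule Re_th_imag_pos[OF t])+
  obtain f1 f2 where f: "\<And>x. ((\<lambda>x. G x / F x) has_real_derivative f1 x) (at x)"
      "\<And>x. (f1 has_real_derivative f2 x) (at x)" "\<And>x. G x / F x * f2 x - (f1 x)\<^sup>2 = 1 * B * (1 - (G x / F x) ^ 4)"
    by (rule quotient_ode[OF real]) (use Fpos in \<open>auto simp: less_le\<close>)
  obtain h1 h2 where h: "\<And>x. ((\<lambda>x. Gi x / Fi x) has_real_derivative h1 x) (at x)"
      "\<And>x. (h1 has_real_derivative h2 x) (at x)" "\<And>x. Gi x / Fi x * h2 x - (h1 x)\<^sup>2 = - 1 * B * (1 - (Gi x / Fi x) ^ 4)"
    by (rule quotient_ode[OF imag]) (use Fipos in \<open>auto simp: less_le\<close>)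
  have f0: "G 0 / F 0 = sqrt k" "Gi 0 / Fi 0 = sqrt k"
    using sqrt_tmod[OF t] k by (simp_all add: F_def G_def FGi)
  have even: "G (- x) / F (- x) = G x / F x" "Gi (- x) / Fi (- x) = Gi x / Fi x" for x
    by (simp_all add: F_def G_def FGi)
  define \<mu> where "\<mu> = 2 * ellK k / pi"
  have "\<mu> > 0" using ellK_pos[OF k2] by (simp add: \<mu>_def)
  have Gzero: "G (pi/2) / F (pi/2) = 0"
    unfolding G_def th2_half_pi by simp
  have Gpos: "G x / F x > 0" if "\<bar>x\<bar> < pi/2" for x
    using Fpos[of x] Re_th2_real_pos[OF t that] by (simp add: G_def)
  note line = real_line_modulus[OF k01 f(1,2) f(3)[unfolded mult_1] f0(1) even(1) Gpos Gzero]
  have B: "B = - k * \<mu>\<^sup>2" using line(1) by (simp add: \<mu>_def)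
  have K': "ellK (sqrt (1 - k\<^sup>2)) = \<mu> * (t/2)"
  proof (rule imaginary_line_modulus[OF k01 refl B \<open>\<mu> > 0\<close> _ h(1,2) _ f0(2) even(2)])
    show "t/2 > 0" using t by simp
    show "Gi x / Fi x * h2 x - (h1 x)\<^sup>2 = - B * (1 - (Gi x / Fi x) ^ 4)" for x using h(3)[of x] by simp
    show "Gi x / Fi x > 0" for x using Fipos by simp
    have "Gi (t/2) = exp (t/4) * Re (th 0 t 0)" "Fi (t/2) = exp (t/4) * Re (th (1/2) t 0)"
      unfolding FGi th_plus_half_period using th_plus_one[of 0 t 0] by simp_all
    then show top: "Gi (t/2) / Fi (t/2) = 1 / sqrt k"
      unfolding k[symmetric] sqrt_tmod[OF t] by simp
    fix x assume x: "0 \<le> x" "x < t/2"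
    show "Gi x / Fi x \<noteq> 1 / sqrt k"
    proof
      assume "Gi x / Fi x = 1 / sqrt k"
      then have "Gi x * Re (th (1/2) t 0) = Fi x * Re (th 0 t 0)"
        unfolding k[symmetric] sqrt_tmod[OF t]
        using Fipos[of x] Re_th_zero_pos[OF t, of 0] Re_th_zero_pos[OF t, of "1/2"] by (simp add: field_simps)
      moreover have "of_real (Gi x) = th (1/2) t (\<i> * of_real x)" "of_real (Fi x) = th 0 t (\<i> * of_real x)"
        unfolding FGi using th_real(3,4) by (simp_all add: of_real_Re)
      ultimately have "th (1/2) t (\<i> * of_real x) * th (1/2) t 0 = th 0 t (\<i> * of_real x) * th 0 t 0"
        by (metis of_real_Re_th_zero of_real_mult)
      then have "(th 0 t (of_real (pi/2)))\<^sup>2 * (th 0 t (\<i> * of_real x + of_real (pi/2)))\<^sup>2 = 0"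
        unfolding th4_square[OF t] by algebra
      then show False
        using th0_real_neq_0[OF t, of "pi/2"] th4_imag_neq_0[OF t, of x] x by simp
    qed
  qed
  then have "ellK (sqrt (1 - k\<^sup>2)) / ellK k = t / pi"
    using ellK_pos[OF k2] by (simp add: \<mu>_def)
  then have "- pi * ellK (sqrt (1 - k\<^sup>2)) / ellK k = - t"
    using pi_gt_zero by (simp add: field_simps)
  then show "nome k = exp (- t)"
    by (simp add: nome_def)
  \<comment> \<open>The identity is known for \<open>|x| <= pi/2\<close>. Under translation by pi
    the quotient and sn change sign, so their squares are periodic.\<close>
  have sq: "(G x / F x)\<^sup>2 = k * (jsn k (ellK k + \<mu> * x))\<^sup>2" for x
  proof (rule periodic_reduction[where p = pi and P = "\<lambda>x. (G x / F x)\<^sup>2 = k * (jsn k (ellK k + \<mu> * x))\<^sup>2"])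
    fix z
    have "ellK k + \<mu> * (z + pi) = (ellK k + \<mu> * z) + 2 * ellK k"
      by (simp add: \<mu>_def field_simps)
    then have "(jsn k (ellK k + \<mu> * (z + pi)))\<^sup>2 = (jsn k (ellK k + \<mu> * z))\<^sup>2"
      by (simp only: jsn_plus_2K[OF k2] power2_minus)
    moreover have "G (z + pi) / F (z + pi) = - (G z / F z)"
      using th0_plus_pi[of t z] th2_plus_pi[of t z] by (simp add: F_def G_def)
    ultimately show "((G (z + pi) / F (z + pi))\<^sup>2 = k * (jsn k (ellK k + \<mu> * (z + pi)))\<^sup>2)
        = ((G z / F z)\<^sup>2 = k * (jsn k (ellK k + \<mu> * z))\<^sup>2)" by simp
  qed (use line(2) in \<open>auto simp: \<mu>_def\<close>)
  have "F x * F2 x - (F1 x)\<^sup>2 = (A - \<mu>\<^sup>2 * k\<^sup>2 * (jsn k (ellK k + \<mu> * x))\<^sup>2) * (F x)\<^sup>2" for x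
  proof -
    have "(G x)\<^sup>2 = k * (jsn k (ellK k + \<mu> * x))\<^sup>2 * (F x)\<^sup>2"
      using sq[of x] Fpos[of x] by (simp add: power_divide divide_eq_eq)
    then show ?thesis
      unfolding F12(3) B by algebra
  qed
  then show "\<exists>F1 F2 A. \<forall>x. (F has_real_derivative F1 x) (at x) \<and> (F1 has_real_derivative F2 x) (at x) \<and>
      F x * F2 x - (F1 x)\<^sup>2 = (A - (2 * ellK k / pi)\<^sup>2 * k\<^sup>2 * (jsn k (ellK k + 2 * ellK k / pi * x))\<^sup>2) * (F x)\<^sup>2"
    using F12(1,2) unfolding \<mu>_def by blast
qed

section \<open>The series in the nome, Theta and Z\<close>

lemma infsum_even_int:
  fixes g :: "int \<Rightarrow> real"
  assumes summ: "g summable_on UNIV" and even: "\<And>n. g (- n) = g n"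
  shows "infsum g UNIV = g 0 + 2 * (\<Sum>n. g (int (Suc n)))"
proof -
  let ?p = "\<lambda>n. int (Suc n)" and ?m = "\<lambda>n. - int (Suc n)"
  have inj: "inj ?p" "inj ?m" by (auto simp: inj_on_def)
  have summ': "g summable_on S" for S
    using summable_on_subset_banach[OF summ] by simp
  have "UNIV = {0} \<union> (range ?p \<union> range ?m)"
  proof (intro equalityI subsetI)
    fix n :: int
    show "n \<in> {0} \<union> (range ?p \<union> range ?m)"
      by (cases n rule: int_cases3) (auto simp: image_iff gr0_conv_Suc)
  qed auto
  then have "infsum g UNIV = infsum g ({0} \<union> (range ?p \<union> range ?m))" by simp
  also have "\<dots> = g 0 + (infsum g (range ?p) + infsum g (range ?m))"
    by (subst infsum_Un_disjoint, use summ' in \<open>force+\<close>)+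
  also have "infsum g (range ?m) = infsum g (range ?p)"
    unfolding infsum_reindex[OF inj(1)] infsum_reindex[OF inj(2)] by (simp only: o_def even)
  also have "infsum g (range ?p) = (\<Sum>n. g (int (Suc n)))"
  proof -
    have "(g \<circ> ?p) summable_on UNIV"
      using summ'[of "range ?p"] summable_on_reindex[OF inj(1)] by blast
    then have "(\<lambda>n. g (int (Suc n))) summable_on UNIV"
      by (simp only: o_def)
    from has_sum_imp_sums[OF has_sum_infsum[OF this]] show ?thesis
      unfolding infsum_reindex[OF inj(1)] o_def by (rule sums_unique)
  qed
  finally show ?thesis by simp
qed

text \<open>Terms \<open>n\<close> and \<open>-n\<close> pair up to a cosine, and the translation by
  pi/2 supplies the signs \<open>(-1) ^ n\<close>.\<close>

lemma theta4_eq_th: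
  assumes t: "t > 0" and q: "nome k = exp (- t)"
  shows "theta4 k y = Re (th 0 t (of_real (y + pi/2)))"
proof -
  let ?g = "\<lambda>n. Re (thterm 0 t (of_real (y + pi/2)) n)"
  have g: "?g n = exp (- (t * (real_of_int n)\<^sup>2)) * cos (2 * of_int n * y + of_int n * pi)" for n
    by (simp add: thterm_def Re_exp algebra_simps)
  have gn: "?g (int n) = (-1) ^ n * nome k ^ n\<^sup>2 * cos (2 * real n * y)" for n
  proof -
    have "nome k ^ n\<^sup>2 = exp (- (t * (real n)\<^sup>2))"
      by (simp add: q mult.commute flip: exp_of_nat_mult)
    moreover have "cos (2 * real n * y + real n * pi) = (-1) ^ n * cos (2 * real n * y)"
      by (simp add: cos_add)
    ultimately show ?thesis unfolding g by simp
  qed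
  have "Re (th 0 t (of_real (y + pi/2))) = infsum ?g UNIV"
    unfolding th_def by (rule infsum_Re[symmetric]) (rule summable_thterm[OF t])
  also have "\<dots> = ?g 0 + 2 * (\<Sum>n. ?g (int (Suc n)))"
  proof (rule infsum_even_int)
    show "?g summable_on UNIV" by (intro summable_on_Re summable_thterm t)
    have "cos (2 * of_int (- n) * y + of_int (- n) * pi) = cos (2 * of_int n * y + of_int n * pi)" for n
      by (subst cos_minus[symmetric]) simp
    then show "?g (- n) = ?g n" for n
      unfolding g by (simp only: of_int_minus power2_minus)
  qed
  also have "\<dots> = theta4 k y"
    unfolding gn theta4_def by (simp only: g) simp
  finally show ?thesis by simp
qed

text \<open>Collects the properties of \<open>jTheta\<close> from which the later facts are drawn.
  The translation by pi/2 from theta_3 to theta_4 turns the argument of sn into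
  \<open>x + 2 * ellK k\<close>, which leaves its square unchanged.\<close>

lemma jTheta_exists:
  assumes "0 < k" "k < 1"
  shows "\<exists>T1 T2 A. \<forall>x. jTheta k x > 0 \<and> jTheta k (- x) = jTheta k x \<and> jTheta k (x + 2 * ellK k) = jTheta k x \<and>
    (jTheta k has_real_derivative T1 x) (at x) \<and> (T1 has_real_derivative T2 x) (at x) \<and>
    jTheta k x * T2 x - (T1 x)\<^sup>2 = (A - k\<^sup>2 * (jsn k x)\<^sup>2) * (jTheta k x)\<^sup>2"
proof -
  have k2: "k\<^sup>2 < 1" using assms by (simp add: power_less_one_iff)
  obtain t where t: "t > 0" "tmod t = k" using tmod_surj[OF assms] .
  define F where "F = (\<lambda>x. Re (th 0 t (of_real x)))"
  define \<mu> where "\<mu> = 2 * ellK k / pi"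
  have "\<mu> > 0" using ellK_pos[OF k2] by (simp add: \<mu>_def)
  obtain F1 F2 A where F: "\<And>x. (F has_real_derivative F1 x) (at x)" "\<And>x. (F1 has_real_derivative F2 x) (at x)"
      "\<And>x. F x * F2 x - (F1 x)\<^sup>2 = (A - \<mu>\<^sup>2 * k\<^sup>2 * (jsn k (ellK k + \<mu> * x))\<^sup>2) * (F x)\<^sup>2"
    using theta_modulus(2)[OF t] unfolding F_def \<mu>_def by blast
  have T: "jTheta k = (\<lambda>x. F (x / \<mu> + pi/2))"
    unfolding jTheta_def theta4_eq_th[OF t(1) theta_modulus(1)[OF t]] F_def \<mu>_def by (simp add: mult.commute)
  have lin: "((\<lambda>x. x / \<mu> + pi/2) has_real_derivative 1 / \<mu>) (at x)" for x
    using \<open>\<mu> > 0\<close> by (auto intro!: derivative_eq_intros)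
  have per: "F (x + pi) = F x" for x
    using th0_plus_pi[of t x] by (simp add: F_def)
  have even: "F (- x) = F x" for x
    by (simp add: F_def)
  show ?thesis
  proof (rule exI[of _ "\<lambda>x. F1 (x / \<mu> + pi/2) / \<mu>"], rule exI[of _ "\<lambda>x. F2 (x / \<mu> + pi/2) / \<mu>\<^sup>2"],
      rule exI[of _ "A / \<mu>\<^sup>2"], intro allI conjI)
    fix x
    show "jTheta k x > 0"
      unfolding T F_def by (rule Re_th0_real_pos[OF t(1)])
    show "jTheta k (- x) = jTheta k x"
      using per[of "- x / \<mu> - pi/2"] even[of "x / \<mu> + pi/2"] by (simp add: T algebra_simps)
    show "jTheta k (x + 2 * ellK k) = jTheta k x"
      using per[of "x / \<mu> + pi/2"] ellK_pos[OF k2] by (simp add: T \<mu>_def field_simps)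
    show "(jTheta k has_real_derivative F1 (x / \<mu> + pi/2) / \<mu>) (at x)"
      unfolding T using DERIV_chain2[OF F(1) lin] by simp
    show "((\<lambda>x. F1 (x / \<mu> + pi/2) / \<mu>) has_real_derivative F2 (x / \<mu> + pi/2) / \<mu>\<^sup>2) (at x)"
      using DERIV_cdivide[OF DERIV_chain2[OF F(2) lin[of x]], where c = \<mu>] by (simp add: power2_eq_square)
    have "ellK k + \<mu> * (x / \<mu> + pi/2) = x + 2 * ellK k"
      using \<open>\<mu> > 0\<close> by (simp add: \<mu>_def field_simps)
    then have "(jsn k (ellK k + \<mu> * (x / \<mu> + pi/2)))\<^sup>2 = (jsn k x)\<^sup>2"
      by (simp only: jsn_plus_2K[OF k2] power2_minus)
    then show "jTheta k x * (F2 (x / \<mu> + pi/2) / \<mu>\<^sup>2) - (F1 (x / \<mu> + pi/2) / \<mu>)\<^sup>2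
        = (A / \<mu>\<^sup>2 - k\<^sup>2 * (jsn k x)\<^sup>2) * (jTheta k x)\<^sup>2"
      using F(3)[of "x / \<mu> + pi/2"] \<open>\<mu> > 0\<close> by (simp add: T field_simps)
  qed
qed

lemma jTheta_deriv:
  assumes "0 < k" "k < 1"
  shows "(jTheta k has_real_derivative jTheta k x * jZeta k x) (at x)"
proof -
  obtain T1 where "(jTheta k has_real_derivative T1 x) (at x)" "jTheta k x > 0"
    using jTheta_exists[OF assms] by blast
  then show ?thesis by (simp add: jZeta_def DERIV_imp_deriv)
qed

lemma jTheta_pos: "0 < k \<Longrightarrow> k < 1 \<Longrightarrow> jTheta k x > 0"
  using jTheta_exists by blast

lemma jTheta_plus_2K: "0 < k \<Longrightarrow> k < 1 \<Longrightarrow> jTheta k (x + 2 * ellK k) = jTheta k x"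
  using jTheta_exists by blast

lemma jTheta_minus: "0 < k \<Longrightarrow> k < 1 \<Longrightarrow> jTheta k (- x) = jTheta k x"
  using jTheta_exists by blast

lemma jZeta_minus:
  assumes k: "0 < k" "k < 1"
  shows "jZeta k (- x) = - jZeta k x"
proof -
  have "((\<lambda>x. jTheta k (- x)) has_real_derivative - (jTheta k (- x) * jZeta k (- x))) (at x)"
    using jTheta_deriv[OF k, of "- x"] by (simp flip: DERIV_mirror)
  then have "((\<lambda>x. jTheta k x) has_real_derivative - (jTheta k x * jZeta k (- x))) (at x)"
    by (simp add: jTheta_minus k)
  from DERIV_unique[OF jTheta_deriv[OF k] this]
  have "jTheta k x * jZeta k x = jTheta k x * - jZeta k (- x)" by simp
  then have "jZeta k x = - jZeta k (- x)"
    using jTheta_pos[OF k, of x] by (simp only: mult_cancel_left) simp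
  then show ?thesis by simp
qed

lemma jZeta_deriv:
  assumes "0 < k" "k < 1"
  obtains C where "\<And>x. (jZeta k has_real_derivative C - k\<^sup>2 * (jsn k x)\<^sup>2) (at x)"
proof -
  obtain T1 T2 A where T: "\<And>x. jTheta k x > 0" "\<And>x. (jTheta k has_real_derivative T1 x) (at x)"
    "\<And>x. (T1 has_real_derivative T2 x) (at x)"
    "\<And>x. jTheta k x * T2 x - (T1 x)\<^sup>2 = (A - k\<^sup>2 * (jsn k x)\<^sup>2) * (jTheta k x)\<^sup>2"
    using jTheta_exists[OF assms] by blast
  have Z: "jZeta k = (\<lambda>x. T1 x / jTheta k x)"
    using T(2) by (auto simp: jZeta_def fun_eq_iff DERIV_imp_deriv)
  have "(jZeta k has_real_derivative (A - k\<^sup>2 * (jsn k x)\<^sup>2)) (at x)" for x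
  proof -
    have "(jZeta k has_real_derivative (T2 x * jTheta k x - T1 x * T1 x) / (jTheta k x * jTheta k x)) (at x)"
      unfolding Z by (rule DERIV_divide[OF T(3,2)]) (use T(1)[of x] in simp)
    also have "(T2 x * jTheta k x - T1 x * T1 x) / (jTheta k x * jTheta k x) = A - k\<^sup>2 * (jsn k x)\<^sup>2"
      using T(1)[of x] T(4)[of x] by (simp add: divide_eq_eq power2_eq_square mult.commute)
    finally show ?thesis .
  qed
  then show thesis by (rule that)
qed

section \<open>Uniqueness on the whole line; bounds for periodic functions\<close>

lemma cubic_ode_unique_all:
  fixes u v :: "real \<Rightarrow> real"
  assumes u: "\<And>x. (u has_real_derivative u1 x) (at x)" "\<And>x. (u1 has_real_derivative b + p * u x + r * u x ^ 3) (at x)"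
    and v: "\<And>x. (v has_real_derivative v1 x) (at x)" "\<And>x. (v1 has_real_derivative b + p * v x + r * v x ^ 3) (at x)"
    and init: "u 0 = v 0" "u1 0 = v1 0"
  shows "u x = v x"
proof (cases "x \<ge> 0")
  case True
  show ?thesis
    by (rule cubic_ode_unique[OF u v refl refl init True order_refl])
next
  case False
  have flip: "((\<lambda>x. f (- x)) has_real_derivative - f' (- x)) (at x)" if "\<And>x. (f has_real_derivative f' x) (at x)" for f f' :: "real \<Rightarrow> real" and x
    using that[of "- x"] by (simp flip: DERIV_mirror)
  have flip2: "((\<lambda>x. - f (- x)) has_real_derivative f' (- x)) (at x)" if "\<And>x. (f has_real_derivative f' x) (at x)" for f f' :: "real \<Rightarrow> real" and x
    using DERIV_minus[OF flip[OF that]] by simp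
  have "u (- (- x)) = v (- (- x))"
    by (rule cubic_ode_unique[OF flip[OF u(1)] flip2[OF u(2)] flip[OF v(1)] flip2[OF v(2)] refl refl _ _ _ order_refl])
       (use init False in auto)
  then show ?thesis by simp
qed

lemma periodic_pos_bounds:
  fixes f :: "real \<Rightarrow> real"
  assumes cont: "continuous_on UNIV f" and pos: "\<And>x. f x > 0" and per: "\<And>x. f (x + p) = f x" and "p > 0"
  obtains l L where "l > 0" "\<And>x. l \<le> f x" "\<And>x. f x \<le> L"
proof -
  have ne: "{- (p/2)..p/2} \<noteq> {}" and comp: "compact {- (p/2)..p/2}" using \<open>p > 0\<close> by auto
  have c: "continuous_on {- (p/2)..p/2} f" by (rule continuous_on_subset[OF cont]) simp
  obtain a where a: "\<And>y. y \<in> {- (p/2)..p/2} \<Longrightarrow> f a \<le> f y"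
    using continuous_attains_inf[OF comp ne c] by blast
  obtain d where d: "\<And>y. y \<in> {- (p/2)..p/2} \<Longrightarrow> f y \<le> f d"
    using continuous_attains_sup[OF comp ne c] by blast
  have "f a \<le> f x \<and> f x \<le> f d" for x
  proof (rule periodic_reduction[where p = p and P = "\<lambda>x. f a \<le> f x \<and> f x \<le> f d"])
    fix z
    assume "\<bar>z\<bar> \<le> p/2"
    then have "z \<in> {- (p/2)..p/2}"
      unfolding abs_le_iff atLeastAtMost_iff by linarith
    then show "f a \<le> f z \<and> f z \<le> f d"
      using a d by blast
  qed (simp_all add: per \<open>p > 0\<close>)
  then show thesis using that pos by blast
qed

section \<open>Darboux transformation of travelling mKdV waves\<close>

text \<open>\<open>\<phi>\<close> and \<open>\<phi> - w\<close> solve the same Riccati equation, and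
  a logistic weight between two solutions gives a third. Using \<open>u_x = u^2 - V\<close>
  repeatedly makes every space derivative polynomial in \<open>u\<close>, \<open>V\<close> and
  derivatives of \<open>V\<close>; the mKdV equation is then met because the time derivative of
  \<open>n\<close> is \<open>2 V\<close> times its space derivative.\<close>

lemma mkdv_darboux:
  fixes \<phi> \<phi>1 :: "real \<Rightarrow> real" and n :: "real \<Rightarrow> real \<Rightarrow> real" and b c :: real
  defines "V \<equiv> \<lambda>\<xi>. (\<phi> \<xi>)\<^sup>2 - \<phi>1 \<xi>"
  defines "w \<equiv> \<lambda>\<xi>. 2 * b / (c - 2 * V \<xi>)"
  assumes \<phi>: "\<And>\<xi>. (\<phi> has_real_derivative \<phi>1 \<xi>) (at \<xi>)" "\<And>\<xi>. (\<phi>1 has_real_derivative 2 * \<phi> \<xi> ^ 3 - c * \<phi> \<xi> + b) (at \<xi>)"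
    and H: "\<And>\<xi>. c - 2 * V \<xi> \<noteq> 0"
    and n: "\<And>x t. ((\<lambda>x. n x t) has_real_derivative w (x + c * t) * n x t * (1 - n x t)) (at x)"
      "\<And>x t. ((\<lambda>t. n x t) has_real_derivative 2 * V (x + c * t) * w (x + c * t) * n x t * (1 - n x t)) (at t)"
  defines "u \<equiv> \<lambda>x t. \<phi> (x + c * t) - w (x + c * t) * n x t"
  shows "(\<lambda>y. u y t) differentiable (at x)" "deriv (\<lambda>y. u y t) differentiable (at x)"
    "deriv (deriv (\<lambda>y. u y t)) differentiable (at x)" "(\<lambda>s. u x s) differentiable (at t)"
    "deriv (\<lambda>s. u x s) t - 6 * (u x t)\<^sup>2 * deriv (\<lambda>y. u y t) x + deriv (deriv (deriv (\<lambda>y. u y t))) x = 0"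
proof -
  \<comment> \<open>\<open>V1\<close> and \<open>V2\<close> are the first two derivatives of
    \<open>V\<close>, with the second derivative of \<open>\<phi>\<close> eliminated by the profile
    equation.\<close>
  define V1 where "V1 = (\<lambda>\<xi>. \<phi> \<xi> * (c - 2 * V \<xi>) - b)"
  define V2 where "V2 = (\<lambda>\<xi>. \<phi>1 \<xi> * (c - 2 * V \<xi>) - 2 * \<phi> \<xi> * V1 \<xi>)"
  have \<phi>1: "\<phi>1 \<xi> = (\<phi> \<xi>)\<^sup>2 - V \<xi>" for \<xi> by (simp add: V_def)
  have wH: "w \<xi> * (c - 2 * V \<xi>) = 2 * b" for \<xi> using H[of \<xi>] by (simp add: w_def)
  have V: "(V has_real_derivative V1 \<xi>) (at \<xi>)" for \<xi>
  proof -
    have "(V has_real_derivative 2 * \<phi> \<xi> * \<phi>1 \<xi> - (2 * \<phi> \<xi> ^ 3 - c * \<phi> \<xi> + b)) (at \<xi>)"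
      unfolding V_def by (auto intro!: derivative_eq_intros \<phi>)
    also have "2 * \<phi> \<xi> * \<phi>1 \<xi> - (2 * \<phi> \<xi> ^ 3 - c * \<phi> \<xi> + b) = V1 \<xi>"
      unfolding V1_def \<phi>1 by algebra
    finally show ?thesis .
  qed
  have V1: "(V1 has_real_derivative V2 \<xi>) (at \<xi>)" for \<xi>
    unfolding V1_def V2_def[unfolded V1_def[symmetric]]
    by (rule derivative_eq_intros \<phi> V refl)+ (simp add: V1_def algebra_simps)
  have w: "(w has_real_derivative w \<xi> * (2 * \<phi> \<xi> - w \<xi>)) (at \<xi>)" for \<xi>
  proof -
    have "(w has_real_derivative (0 * (c - 2 * V \<xi>) - 2 * b * (0 - 2 * V1 \<xi>)) / ((c - 2 * V \<xi>) * (c - 2 * V \<xi>))) (at \<xi>)"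
      unfolding w_def by (intro DERIV_divide DERIV_const DERIV_diff DERIV_cmult V H)
    also have "(0 * (c - 2 * V \<xi>) - 2 * b * (0 - 2 * V1 \<xi>)) / ((c - 2 * V \<xi>) * (c - 2 * V \<xi>)) = w \<xi> * (2 * \<phi> \<xi> - w \<xi>)"
      unfolding V1_def w_def using H[of \<xi>] by (simp add: field_simps)
    finally show ?thesis .
  qed
  have sx: "((\<lambda>y. f (y + c * t)) has_real_derivative f' (x + c * t)) (at x)"
    if "\<And>\<xi>. (f has_real_derivative f' \<xi>) (at \<xi>)" for f f' :: "real \<Rightarrow> real" and x t
    using that[of "x + c * t"] by (simp add: DERIV_shift)
  have st: "((\<lambda>s. f (x + c * s)) has_real_derivative f' (x + c * t) * c) (at t)"
    if "\<And>\<xi>. (f has_real_derivative f' \<xi>) (at \<xi>)" for f f' :: "real \<Rightarrow> real" and x t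
    by (rule DERIV_chain2[OF that]) (auto intro!: derivative_eq_intros)
  have ux: "((\<lambda>y. u y t) has_real_derivative (u x t)\<^sup>2 - V (x + c * t)) (at x)" for x t
  proof -
    have "((\<lambda>y. u y t) has_real_derivative \<phi>1 (x + c * t) - (w (x + c * t) * (2 * \<phi> (x + c * t) - w (x + c * t)) * n x t
        + w (x + c * t) * n x t * (1 - n x t) * w (x + c * t))) (at x)"
      unfolding u_def by (intro DERIV_diff DERIV_mult sx[OF \<phi>(1)] sx[where f = w, OF w] n)
    also have "\<phi>1 (x + c * t) - (w (x + c * t) * (2 * \<phi> (x + c * t) - w (x + c * t)) * n x t
        + w (x + c * t) * n x t * (1 - n x t) * w (x + c * t)) = (u x t)\<^sup>2 - V (x + c * t)"
      unfolding \<phi>1 u_def by algebra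
    finally show ?thesis .
  qed
  have ut: "((\<lambda>s. u x s) has_real_derivative c * ((\<phi> (x + c * t))\<^sup>2 - V (x + c * t))
      - c * (w (x + c * t) * (2 * \<phi> (x + c * t) - w (x + c * t)) * n x t)
      - w (x + c * t) * (2 * V (x + c * t) * w (x + c * t) * n x t * (1 - n x t))) (at t)" for x t
  proof -
    have "((\<lambda>s. u x s) has_real_derivative \<phi>1 (x + c * t) * c - (w (x + c * t) * (2 * \<phi> (x + c * t) - w (x + c * t)) * c * n x t
        + 2 * V (x + c * t) * w (x + c * t) * n x t * (1 - n x t) * w (x + c * t))) (at t)"
      unfolding u_def by (intro DERIV_diff DERIV_mult st[OF \<phi>(1)] st[where f = w, OF w] n)
    then show ?thesis
      unfolding \<phi>1 by (simp add: algebra_simps)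
  qed
  have d1: "deriv (\<lambda>y. u y t) = (\<lambda>x. (u x t)\<^sup>2 - V (x + c * t))" for t
    using ux by (auto intro!: DERIV_imp_deriv)
  have uxx: "(deriv (\<lambda>y. u y t) has_real_derivative 2 * u x t * ((u x t)\<^sup>2 - V (x + c * t)) - V1 (x + c * t)) (at x)" for x t
    unfolding d1 by (rule derivative_eq_intros ux sx[OF V] refl)+ simp
  have d2: "deriv (deriv (\<lambda>y. u y t)) = (\<lambda>x. 2 * u x t * ((u x t)\<^sup>2 - V (x + c * t)) - V1 (x + c * t))" for t
    using uxx by (auto intro!: DERIV_imp_deriv)
  have uxxx: "(deriv (deriv (\<lambda>y. u y t)) has_real_derivative
      2 * ((u x t)\<^sup>2 - V (x + c * t))\<^sup>2 + 2 * u x t * (2 * u x t * ((u x t)\<^sup>2 - V (x + c * t)) - V1 (x + c * t)) - V2 (x + c * t)) (at x)" for x t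
    unfolding d2 by (rule derivative_eq_intros ux sx[OF V] sx[OF V1] refl)+ (simp add: algebra_simps power2_eq_square)
  show "(\<lambda>y. u y t) differentiable (at x)" "deriv (\<lambda>y. u y t) differentiable (at x)"
    "deriv (deriv (\<lambda>y. u y t)) differentiable (at x)" "(\<lambda>s. u x s) differentiable (at t)"
    using ux uxx uxxx ut real_differentiable_def by blast+
  have "deriv (\<lambda>s. u x s) t - 6 * (u x t)\<^sup>2 * deriv (\<lambda>y. u y t) x + deriv (deriv (deriv (\<lambda>y. u y t))) x
    = c * ((\<phi> (x + c * t))\<^sup>2 - V (x + c * t))
      - c * (w (x + c * t) * (2 * \<phi> (x + c * t) - w (x + c * t)) * n x t)
      - w (x + c * t) * (2 * V (x + c * t) * w (x + c * t) * n x t * (1 - n x t))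
      - 6 * (u x t)\<^sup>2 * ((u x t)\<^sup>2 - V (x + c * t))
      + (2 * ((u x t)\<^sup>2 - V (x + c * t))\<^sup>2 + 2 * u x t * (2 * u x t * ((u x t)\<^sup>2 - V (x + c * t)) - V1 (x + c * t)) - V2 (x + c * t))"
    unfolding DERIV_imp_deriv[OF ux] DERIV_imp_deriv[OF ut] DERIV_imp_deriv[OF uxxx] ..
  \<comment> \<open>Only \<open>\<phi>\<close>, \<open>V\<close>, \<open>w\<close> and
    \<open>n\<close> remain, tied by the single relation \<open>w (c - 2 V) = 2 b\<close>.\<close>
  also have "\<dots> = 0"
    using wH[of "x + c * t"] unfolding V2_def V1_def \<phi>1 u_def by algebra
  finally show "deriv (\<lambda>s. u x s) t - 6 * (u x t)\<^sup>2 * deriv (\<lambda>y. u y t) x + deriv (deriv (deriv (\<lambda>y. u y t))) x = 0" .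
qed

section \<open>The travelling wave and the Riccati denominator\<close>

locale kink_breather =
  fixes \<zeta>1 \<zeta>2 \<zeta>3 \<alpha> :: real
  assumes z3: "0 < \<zeta>3" and z32: "\<zeta>3 < \<zeta>2" and z21: "\<zeta>2 < \<zeta>1"
    and alpha_pos: "0 < \<alpha>"
    and alpha_lt: "\<alpha> < ellK (sqrt ((\<zeta>1\<^sup>2 - \<zeta>2\<^sup>2) / (\<zeta>1\<^sup>2 - \<zeta>3\<^sup>2)))"
    and alpha_sn: "jsn (sqrt ((\<zeta>1\<^sup>2 - \<zeta>2\<^sup>2) / (\<zeta>1\<^sup>2 - \<zeta>3\<^sup>2))) \<alpha> = sqrt ((\<zeta>1 - \<zeta>3) / (\<zeta>1 + \<zeta>2))"
begin

definition bb where "bb = 4 * \<zeta>1 * \<zeta>2 * \<zeta>3"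
definition cc where "cc = 2 * (\<zeta>1\<^sup>2 + \<zeta>2\<^sup>2 + \<zeta>3\<^sup>2)"
definition nu where "nu = sqrt (\<zeta>1\<^sup>2 - \<zeta>3\<^sup>2)"
definition kk where "kk = sqrt ((\<zeta>1\<^sup>2 - \<zeta>2\<^sup>2) / (\<zeta>1\<^sup>2 - \<zeta>3\<^sup>2))"
definition R where "R x = (\<zeta>1 + \<zeta>3) - (\<zeta>1 - \<zeta>2) * (jsn kk (nu * x))\<^sup>2"
definition phi where "phi x = 2 * (\<zeta>1 + \<zeta>3) * (\<zeta>2 + \<zeta>3) / R x - \<zeta>1 - \<zeta>2 - \<zeta>3"
definition phi1 where
  "phi1 x = 4 * nu * (\<zeta>1 + \<zeta>3) * (\<zeta>2 + \<zeta>3) * (\<zeta>1 - \<zeta>2) * (jsn kk (nu * x) * jcn kk (nu * x) * jdn kk (nu * x)) / (R x)\<^sup>2"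
definition s0 where "s0 = \<zeta>2 + \<zeta>3 - \<zeta>1 + 2 * nu * jZeta kk \<alpha>"
text \<open>This is \<open>cc - 2 V\<close> for the Miura potential \<open>V\<close> of
  \<open>phi\<close>, and the bracket in the denominator of the solution formula.\<close>

definition H where "H x = cc + 2 * phi1 x - 2 * (phi x)\<^sup>2"
definition theta_ratio where "theta_ratio x = (jTheta kk (nu * x - \<alpha>))\<^sup>2 / (jTheta kk (nu * x + \<alpha>))\<^sup>2"

lemma bb_pos: "bb > 0" and cc_pos: "cc > 0"
  using z3 z32 z21 by (auto simp: bb_def cc_def intro!: mult_pos_pos add_pos_pos)

lemma sq_less: "\<zeta>3\<^sup>2 < \<zeta>2\<^sup>2" "\<zeta>2\<^sup>2 < \<zeta>1\<^sup>2"
  using z3 z32 z21 by (auto intro!: power_strict_mono)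

lemma nu_pos: "nu > 0" and nu_sq: "nu\<^sup>2 = \<zeta>1\<^sup>2 - \<zeta>3\<^sup>2"
  using sq_less by (auto simp: nu_def)

lemma kk_sq: "kk\<^sup>2 = (\<zeta>1\<^sup>2 - \<zeta>2\<^sup>2) / (\<zeta>1\<^sup>2 - \<zeta>3\<^sup>2)"
  using sq_less by (simp add: kk_def)

lemma nu_kk_sq: "nu\<^sup>2 * kk\<^sup>2 = \<zeta>1\<^sup>2 - \<zeta>2\<^sup>2"
  using sq_less by (simp add: kk_sq nu_sq)

lemma kk: "0 < kk" "kk < 1" "kk\<^sup>2 < 1"
proof -
  show "0 < kk" using sq_less by (simp add: kk_def)
  show "kk\<^sup>2 < 1" using sq_less by (simp add: kk_sq)
  then show "kk < 1" using \<open>0 < kk\<close> by (simp add: power_less_one_iff)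
qed

lemma R_pos: "R x > 0"
proof -
  have "(\<zeta>1 - \<zeta>2) * (jsn kk (nu * x))\<^sup>2 \<le> (\<zeta>1 - \<zeta>2) * 1"
    using z21 by (intro mult_left_mono jsn_sq_le_1) auto
  then show ?thesis using z3 z32 by (simp add: R_def)
qed

lemma lin_deriv: "((\<lambda>x. nu * x) has_real_derivative nu) (at x)"
  by (auto intro!: derivative_eq_intros)

lemmas jacobi_lin_deriv =
  DERIV_chain2[OF jsn_deriv[OF kk(3)] lin_deriv]
  DERIV_chain2[OF jcn_deriv[OF kk(3)] lin_deriv]
  DERIV_chain2[OF jdn_deriv[OF kk(3)] lin_deriv]

lemma R_deriv: "(R has_real_derivative - 2 * nu * (\<zeta>1 - \<zeta>2) * (jsn kk (nu * x) * jcn kk (nu * x) * jdn kk (nu * x))) (at x)"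
  unfolding R_def by (rule derivative_eq_intros jacobi_lin_deriv refl)+ simp

lemma phi_deriv: "(phi has_real_derivative phi1 x) (at x)"
  unfolding phi_def phi1_def using R_pos[of x]
  by (auto intro!: derivative_eq_intros R_deriv simp: power2_eq_square)

text \<open>The profile equation cleared of the denominator \<open>R ^ 3\<close>, with
  \<open>S\<close> for the square of sn and with nu and the modulus already eliminated. Free
  variables keep it a pure polynomial identity.\<close>

lemma profile_ode_identity:
  fixes z1 z2 z3 S :: real
  shows "4 * (z1 + z3) * (z2 + z3) * (z1 - z2) *
    (((1 - S) * (z1\<^sup>2 - z3\<^sup>2 - (z1\<^sup>2 - z2\<^sup>2) * S) - S * (z1\<^sup>2 - z3\<^sup>2 - (z1\<^sup>2 - z2\<^sup>2) * S) - (z1\<^sup>2 - z2\<^sup>2) * S * (1 - S)) * (z1 + z3 - (z1 - z2) * S)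
      + 4 * (z1 - z2) * S * (1 - S) * (z1\<^sup>2 - z3\<^sup>2 - (z1\<^sup>2 - z2\<^sup>2) * S))
    = 2 * (2 * (z1 + z3) * (z2 + z3) - (z1 + z2 + z3) * (z1 + z3 - (z1 - z2) * S)) ^ 3
      - 2 * (z1\<^sup>2 + z2\<^sup>2 + z3\<^sup>2) * (2 * (z1 + z3) * (z2 + z3) - (z1 + z2 + z3) * (z1 + z3 - (z1 - z2) * S)) * (z1 + z3 - (z1 - z2) * S)\<^sup>2
      + 4 * z1 * z2 * z3 * (z1 + z3 - (z1 - z2) * S) ^ 3"
  by algebra

lemma phi1_deriv: "(phi1 has_real_derivative 2 * phi x ^ 3 - cc * phi x + bb) (at x)"
proof -
  let ?s = "jsn kk (nu * x)" and ?c = "jcn kk (nu * x)" and ?d = "jdn kk (nu * x)"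
  let ?P = "4 * (\<zeta>1 + \<zeta>3) * (\<zeta>2 + \<zeta>3) * (\<zeta>1 - \<zeta>2)"
  define N where "N = (?c\<^sup>2 * ?d\<^sup>2 - ?s\<^sup>2 * ?d\<^sup>2 - kk\<^sup>2 * ?s\<^sup>2 * ?c\<^sup>2) * R x + 4 * (\<zeta>1 - \<zeta>2) * ?s\<^sup>2 * ?c\<^sup>2 * ?d\<^sup>2"
  have scd: "((\<lambda>x. jsn kk (nu * x) * jcn kk (nu * x) * jdn kk (nu * x)) has_real_derivative
      nu * (?c\<^sup>2 * ?d\<^sup>2 - ?s\<^sup>2 * ?d\<^sup>2 - kk\<^sup>2 * ?s\<^sup>2 * ?c\<^sup>2)) (at x)"
    by (rule derivative_eq_intros jacobi_lin_deriv refl)+ (simp add: algebra_simps power2_eq_square)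
  have R2: "((\<lambda>x. (R x)\<^sup>2) has_real_derivative 2 * R x * (- 2 * nu * (\<zeta>1 - \<zeta>2) * (?s * ?c * ?d))) (at x)"
    by (rule derivative_eq_intros R_deriv refl)+ simp
  have "((\<lambda>x. jsn kk (nu * x) * jcn kk (nu * x) * jdn kk (nu * x) / (R x)\<^sup>2) has_real_derivative
      (nu * (?c\<^sup>2 * ?d\<^sup>2 - ?s\<^sup>2 * ?d\<^sup>2 - kk\<^sup>2 * ?s\<^sup>2 * ?c\<^sup>2) * (R x)\<^sup>2
        - ?s * ?c * ?d * (2 * R x * (- 2 * nu * (\<zeta>1 - \<zeta>2) * (?s * ?c * ?d)))) / ((R x)\<^sup>2 * (R x)\<^sup>2)) (at x)"
    using R_pos[of x] by (intro DERIV_divide scd R2) simp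
  also have "(nu * (?c\<^sup>2 * ?d\<^sup>2 - ?s\<^sup>2 * ?d\<^sup>2 - kk\<^sup>2 * ?s\<^sup>2 * ?c\<^sup>2) * (R x)\<^sup>2
        - ?s * ?c * ?d * (2 * R x * (- 2 * nu * (\<zeta>1 - \<zeta>2) * (?s * ?c * ?d)))) / ((R x)\<^sup>2 * (R x)\<^sup>2) = nu * N / R x ^ 3"
    using R_pos[of x] by (simp add: N_def field_simps power2_eq_square power3_eq_cube)
  finally have "((\<lambda>x. jsn kk (nu * x) * jcn kk (nu * x) * jdn kk (nu * x) / (R x)\<^sup>2) has_real_derivative nu * N / R x ^ 3) (at x)" .
  note cmult = DERIV_cmult[OF this, of "?P * nu"]
  have "phi1 = (\<lambda>x. ?P * nu * (jsn kk (nu * x) * jcn kk (nu * x) * jdn kk (nu * x) / (R x)\<^sup>2))"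
    by (rule ext) (simp only: phi1_def times_divide_eq_right mult_ac)
  moreover have "?P * nu * (nu * N / R x ^ 3) = ?P * (nu\<^sup>2 * N) / R x ^ 3"
    by (simp only: times_divide_eq_right power2_eq_square mult_ac)
  ultimately have "(phi1 has_real_derivative ?P * (nu\<^sup>2 * N) / R x ^ 3) (at x)"
    using cmult by (simp only:)
  also have "?P * (nu\<^sup>2 * N) / R x ^ 3 = 2 * phi x ^ 3 - cc * phi x + bb"
  proof -
    define S where "S = ?s\<^sup>2"
    have d: "nu\<^sup>2 * ?d\<^sup>2 = \<zeta>1\<^sup>2 - \<zeta>3\<^sup>2 - (\<zeta>1\<^sup>2 - \<zeta>2\<^sup>2) * S"
      unfolding jdn_sq[OF kk(3)] S_def nu_sq[symmetric] nu_kk_sq[symmetric] by (simp add: algebra_simps)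
    have c: "?c\<^sup>2 = 1 - S" by (simp add: jsn_jcn_sq S_def)
    have Rx: "R x = \<zeta>1 + \<zeta>3 - (\<zeta>1 - \<zeta>2) * S" by (simp add: R_def S_def)
    have N: "nu\<^sup>2 * N = (?c\<^sup>2 * (nu\<^sup>2 * ?d\<^sup>2) - S * (nu\<^sup>2 * ?d\<^sup>2) - (nu\<^sup>2 * kk\<^sup>2) * S * ?c\<^sup>2) * R x
        + 4 * (\<zeta>1 - \<zeta>2) * S * ?c\<^sup>2 * (nu\<^sup>2 * ?d\<^sup>2)"
      unfolding N_def S_def by algebra
    have pR: "2 * (\<zeta>1 + \<zeta>3) * (\<zeta>2 + \<zeta>3) - (\<zeta>1 + \<zeta>2 + \<zeta>3) * R x = phi x * R x"
      using R_pos[of x] by (simp add: phi_def field_simps)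
    have "?P * (nu\<^sup>2 * N) = 2 * (2 * (\<zeta>1 + \<zeta>3) * (\<zeta>2 + \<zeta>3) - (\<zeta>1 + \<zeta>2 + \<zeta>3) * R x) ^ 3
      - cc * (2 * (\<zeta>1 + \<zeta>3) * (\<zeta>2 + \<zeta>3) - (\<zeta>1 + \<zeta>2 + \<zeta>3) * R x) * (R x)\<^sup>2 + bb * R x ^ 3"
      unfolding N c d nu_kk_sq Rx cc_def bb_def by (rule profile_ode_identity)
    then have "?P * (nu\<^sup>2 * N) = (2 * phi x ^ 3 - cc * phi x + bb) * R x ^ 3"
      unfolding pR by algebra
    then show ?thesis using R_pos[of x] by (simp add: divide_eq_eq)
  qed
  finally show ?thesis .
qed

text \<open>The four factors of the quartic in \<open>phi1_sq\<close>. Over \<open>R\<close> they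
  reduce to multiples of 1 and of the squares of sn, cn and dn, which explains both the
  factorisation and the range of \<open>phi\<close>.\<close>

lemma phi_factors:
  defines "S \<equiv> \<lambda>x. (jsn kk (nu * x))\<^sup>2"
  shows "phi x + \<zeta>1 + \<zeta>2 + \<zeta>3 = 2 * (\<zeta>1 + \<zeta>3) * (\<zeta>2 + \<zeta>3) / R x"
    "phi x - (\<zeta>2 + \<zeta>3 - \<zeta>1) = 2 * (\<zeta>2 + \<zeta>3) * (\<zeta>1 - \<zeta>2) * S x / R x"
    "phi x - (\<zeta>1 + \<zeta>3 - \<zeta>2) = - (2 * (\<zeta>1 + \<zeta>3) * (\<zeta>1 - \<zeta>2) * (1 - S x) / R x)"
    "phi x - (\<zeta>1 + \<zeta>2 - \<zeta>3) = - (2 * (nu\<^sup>2 - nu\<^sup>2 * kk\<^sup>2 * S x) / R x)"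
proof -
  have R: "R x > 0" by (rule R_pos)
  have RS: "R x = (\<zeta>1 + \<zeta>3) - (\<zeta>1 - \<zeta>2) * S x" by (simp add: R_def S_def)
  have e: "p = q / R x" if "p * R x = q" for p q using that R by (simp add: field_simps)
  have pR: "phi x * R x = 2 * (\<zeta>1 + \<zeta>3) * (\<zeta>2 + \<zeta>3) - (\<zeta>1 + \<zeta>2 + \<zeta>3) * R x"
    using R by (simp add: phi_def field_simps)
  show "phi x + \<zeta>1 + \<zeta>2 + \<zeta>3 = 2 * (\<zeta>1 + \<zeta>3) * (\<zeta>2 + \<zeta>3) / R x"
    by (rule e) (use pR in algebra)
  show "phi x - (\<zeta>2 + \<zeta>3 - \<zeta>1) = 2 * (\<zeta>2 + \<zeta>3) * (\<zeta>1 - \<zeta>2) * S x / R x"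
    by (rule e) (use pR RS in algebra)
  show "phi x - (\<zeta>1 + \<zeta>3 - \<zeta>2) = - (2 * (\<zeta>1 + \<zeta>3) * (\<zeta>1 - \<zeta>2) * (1 - S x) / R x)"
    unfolding minus_divide_left by (rule e) (use pR RS in algebra)
  show "phi x - (\<zeta>1 + \<zeta>2 - \<zeta>3) = - (2 * (nu\<^sup>2 - nu\<^sup>2 * kk\<^sup>2 * S x) / R x)"
    unfolding minus_divide_left nu_kk_sq unfolding nu_sq by (rule e) (use pR RS in algebra)
qed

lemma phi1_sq: "(phi1 x)\<^sup>2 = (phi x + \<zeta>1 + \<zeta>2 + \<zeta>3) * (phi x - (\<zeta>2 + \<zeta>3 - \<zeta>1)) * (phi x - (\<zeta>1 + \<zeta>3 - \<zeta>2)) * (phi x - (\<zeta>1 + \<zeta>2 - \<zeta>3))"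
proof -
  have "(phi1 x)\<^sup>2 = 16 * nu\<^sup>2 * (\<zeta>1 + \<zeta>3)\<^sup>2 * (\<zeta>2 + \<zeta>3)\<^sup>2 * (\<zeta>1 - \<zeta>2)\<^sup>2 *
    ((jsn kk (nu * x))\<^sup>2 * (jcn kk (nu * x))\<^sup>2 * (jdn kk (nu * x))\<^sup>2) / R x ^ 4"
    unfolding phi1_def by (simp add: power_divide power_mult_distrib)
  also have "\<dots> = (phi x + \<zeta>1 + \<zeta>2 + \<zeta>3) * (phi x - (\<zeta>2 + \<zeta>3 - \<zeta>1)) * (phi x - (\<zeta>1 + \<zeta>3 - \<zeta>2)) * (phi x - (\<zeta>1 + \<zeta>2 - \<zeta>3))"
    unfolding phi_factors jsn_jcn_sq jdn_sq[OF kk(3)]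
    using R_pos[of x] by (simp add: field_simps power2_eq_square power4_eq_xxxx)
  finally show ?thesis .
qed

lemma phi_ge: "\<zeta>2 + \<zeta>3 - \<zeta>1 \<le> phi x"
proof -
  have "phi x - (\<zeta>2 + \<zeta>3 - \<zeta>1) \<ge> 0"
    unfolding phi_factors using R_pos[of x] z3 z32 z21 by simp
  then show ?thesis by simp
qed

lemma phi_le: "phi x \<le> \<zeta>1 + \<zeta>3 - \<zeta>2"
proof -
  have "2 * (\<zeta>1 + \<zeta>3) * (\<zeta>1 - \<zeta>2) * (1 - (jsn kk (nu * x))\<^sup>2) / R x \<ge> 0"
    using R_pos[of x] z3 z32 z21 jsn_sq_le_1[of kk "nu * x"] by (intro divide_nonneg_pos mult_nonneg_nonneg) auto
  then have "phi x - (\<zeta>1 + \<zeta>3 - \<zeta>2) \<le> 0"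
    unfolding phi_factors by simp
  then show ?thesis by simp
qed

text \<open>\<open>H'\<close> is \<open>H\<close> at \<open>- x\<close>, as \<open>phi\<close> is
  even and \<open>phi1\<close> odd. The quartic for \<open>phi1^2\<close> turns
  \<open>H x * H'\<close> into \<open>16 * om^2 + 8 * bb * (r - phi x)\<close>, where
  \<open>r\<close> bounds \<open>phi\<close> from above. Positive sum and product make both factors
  positive, and the upper bound for one becomes a lower bound for the other.\<close>

lemma H_bounds: "8 * (\<zeta>1 * \<zeta>2 - \<zeta>1 * \<zeta>3 + \<zeta>2 * \<zeta>3)\<^sup>2 / cc \<le> H x" "H x \<le> 2 * cc" "H x > 0"
proof -
  define om where "om = \<zeta>1 * \<zeta>2 - \<zeta>1 * \<zeta>3 + \<zeta>2 * \<zeta>3"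
  define r where "r = \<zeta>1 + \<zeta>3 - \<zeta>2"
  have "\<zeta>1 * \<zeta>3 < \<zeta>1 * \<zeta>2" "0 < \<zeta>2 * \<zeta>3" using z3 z32 z21 by auto
  then have "om > 0" by (simp add: om_def)
  \<comment> \<open>The lower bound of \<open>phi\<close> is \<open>2 * \<zeta>3 - r\<close>, above
    \<open>- r\<close>; the aim is \<open>phi^2 <= r^2\<close>.\<close>
  have "(phi x - (2 * \<zeta>3 - r)) * (phi x - r) \<le> 0"
    using phi_ge[of x] phi_le[of x] by (intro mult_nonneg_nonpos) (auto simp: r_def)
  moreover have "2 * \<zeta>3 * phi x \<le> 2 * \<zeta>3 * r"
    using phi_le[of x] z3 by (simp add: r_def)
  ultimately have "(phi x)\<^sup>2 \<le> r\<^sup>2"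
    by (simp add: algebra_simps power2_eq_square)
  moreover have "cc - 2 * r\<^sup>2 = 4 * om"
    unfolding cc_def r_def om_def by algebra
  ultimately have Q: "cc - 2 * (phi x)\<^sup>2 > 0" using \<open>om > 0\<close> by simp
  define H' where "H' = cc - 2 * phi1 x - 2 * (phi x)\<^sup>2"
  have sum: "H x + H' = 2 * (cc - 2 * (phi x)\<^sup>2)" by (simp add: H_def H'_def)
  have "H x * H' = (cc - 2 * (phi x)\<^sup>2)\<^sup>2 - 4 * (phi1 x)\<^sup>2"
    unfolding H_def H'_def by algebra
  also have "\<dots> = 16 * om\<^sup>2 + 8 * bb * (r - phi x)"
    unfolding phi1_sq cc_def bb_def r_def om_def by algebra
  finally have prod: "H x * H' \<ge> 16 * om\<^sup>2"
    using phi_le[of x] bb_pos by (simp add: r_def)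
  then have "H x * H' > 0" using \<open>om > 0\<close> by (smt (verit) zero_less_power)
  then show pos: "H x > 0"
    using sum Q by (smt (verit) mult_pos_neg mult_neg_neg mult_neg_pos zero_less_mult_iff)
  then have "H' > 0" using \<open>H x * H' > 0\<close> by (simp add: zero_less_mult_iff)
  have "2 * (cc - 2 * (phi x)\<^sup>2) \<le> 2 * cc" by simp
  then show "H x \<le> 2 * cc" using sum \<open>H' > 0\<close> by linarith
  have "H' \<le> 2 * cc" using sum pos \<open>2 * (cc - 2 * (phi x)\<^sup>2) \<le> 2 * cc\<close> by linarith
  then have "H x * H' \<le> H x * (2 * cc)" using pos by (intro mult_left_mono) auto
  with prod have "8 * om\<^sup>2 \<le> H x * cc" by simp
  then show "8 * (\<zeta>1 * \<zeta>2 - \<zeta>1 * \<zeta>3 + \<zeta>2 * \<zeta>3)\<^sup>2 / cc \<le> H x"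
    using cc_pos by (simp add: om_def pos_divide_le_eq)
qed

lemma H_lower: obtains h where "h > 0" "\<And>x. h \<le> H x"
proof
  have "\<zeta>1 * \<zeta>3 < \<zeta>1 * \<zeta>2" "0 < \<zeta>2 * \<zeta>3" using z3 z32 z21 by auto
  then show "8 * (\<zeta>1 * \<zeta>2 - \<zeta>1 * \<zeta>3 + \<zeta>2 * \<zeta>3)\<^sup>2 / cc > 0"
    using cc_pos by (intro divide_pos_pos mult_pos_pos zero_less_power) auto
qed (rule H_bounds)

lemma H_deriv: "(H has_real_derivative 2 * bb - 2 * phi x * H x) (at x)"
proof -
  have "(H has_real_derivative 2 * (2 * phi x ^ 3 - cc * phi x + bb) - 2 * (2 * phi x * phi1 x)) (at x)"
    unfolding H_def by (auto intro!: derivative_eq_intros phi_deriv phi1_deriv)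
  also have "2 * (2 * phi x ^ 3 - cc * phi x + bb) - 2 * (2 * phi x * phi1 x) = 2 * bb - 2 * phi x * H x"
    unfolding H_def by algebra
  finally show ?thesis .
qed

section \<open>The parameter \<open>\<alpha>\<close> and the zeta representation of the
  profile\<close>

lemma sn_alpha: "jsn kk \<alpha> = sqrt ((\<zeta>1 - \<zeta>3) / (\<zeta>1 + \<zeta>2))" "jsn kk \<alpha> > 0" "jcn kk \<alpha> > 0"
  using alpha_sn jacobi_between[OF kk(3) alpha_pos] alpha_lt by (simp_all add: kk_def)

lemma sn_alpha_sq: "(\<zeta>1 + \<zeta>2) * (jsn kk \<alpha>)\<^sup>2 = \<zeta>1 - \<zeta>3"
  unfolding sn_alpha(1) using z3 z32 z21 by simp

lemma kk_sn_alpha_sq: "(\<zeta>1 + \<zeta>3) * (kk\<^sup>2 * (jsn kk \<alpha>)\<^sup>2) = \<zeta>1 - \<zeta>2"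
proof -
  have "nu\<^sup>2 * (\<zeta>1 + \<zeta>2) * ((\<zeta>1 + \<zeta>3) * (kk\<^sup>2 * (jsn kk \<alpha>)\<^sup>2)) = nu\<^sup>2 * (\<zeta>1 + \<zeta>2) * (\<zeta>1 - \<zeta>2)"
    using sn_alpha_sq nu_kk_sq nu_sq by algebra
  then show ?thesis using nu_pos z3 z32 z21 by simp
qed

text \<open>Both sides are nonnegative because \<open>\<alpha>\<close> lies between 0 and K, and
  their squares agree by the relations for sn at \<open>\<alpha>\<close>.\<close>

lemma cn_dn_alpha: "nu * jcn kk \<alpha> * jdn kk \<alpha> = (\<zeta>2 + \<zeta>3) * jsn kk \<alpha>"
proof (rule power2_eq_imp_eq)
  have "(\<zeta>1 + \<zeta>2) * (nu * jcn kk \<alpha> * jdn kk \<alpha>)\<^sup>2 = (\<zeta>1 + \<zeta>2) * ((\<zeta>2 + \<zeta>3) * jsn kk \<alpha>)\<^sup>2"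
    using sn_alpha_sq kk_sn_alpha_sq nu_sq jsn_jcn_sq[of kk \<alpha>] jdn_sq[OF kk(3), of \<alpha>] by algebra
  then show "(nu * jcn kk \<alpha> * jdn kk \<alpha>)\<^sup>2 = ((\<zeta>2 + \<zeta>3) * jsn kk \<alpha>)\<^sup>2"
    using z3 z32 z21 by simp
qed (use nu_pos sn_alpha jdn_pos[OF kk(3)] z3 z32 in \<open>simp_all add: less_imp_le\<close>)

text \<open>This is the purpose of \<open>\<alpha>\<close>: by \<open>kk_sn_alpha_sq\<close>,
  \<open>R x\<close> is \<open>\<zeta>1 + \<zeta>3\<close> times the denominator of the addition
  formula at \<open>nu * x\<close> and \<open>\<alpha>\<close>, and \<open>cn_dn_alpha\<close>
  matches the numerators.\<close>

lemma phi1_sn: "phi1 x = nu\<^sup>2 * (kk\<^sup>2 * ((jsn kk (nu * x + \<alpha>))\<^sup>2 - (jsn kk (nu * x - \<alpha>))\<^sup>2))"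
proof -
  define E where "E = 1 - kk\<^sup>2 * (jsn kk (nu * x))\<^sup>2 * (jsn kk \<alpha>)\<^sup>2"
  define X Y where XY: "X = jsn kk (nu * x) * jcn kk (nu * x) * jdn kk (nu * x)" "Y = jsn kk \<alpha> * jcn kk \<alpha> * jdn kk \<alpha>"
  have RE: "R x = (\<zeta>1 + \<zeta>3) * E"
    unfolding R_def E_def kk_sn_alpha_sq[symmetric] by algebra
  have P: "\<zeta>1 + \<zeta>3 \<noteq> 0" using z3 z32 z21 by simp
  have E: "E \<noteq> 0" using R_pos[of x] RE by auto
  have key: "nu * (\<zeta>2 + \<zeta>3) * (\<zeta>1 - \<zeta>2) = nu\<^sup>2 * kk\<^sup>2 * Y * (\<zeta>1 + \<zeta>3)"
    unfolding XY using cn_dn_alpha kk_sn_alpha_sq by algebra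
  have "phi1 x = 4 * (\<zeta>1 + \<zeta>3) * (nu * (\<zeta>2 + \<zeta>3) * (\<zeta>1 - \<zeta>2)) * X / ((\<zeta>1 + \<zeta>3) * E)\<^sup>2"
    unfolding phi1_def RE XY by simp
  also have "\<dots> = nu\<^sup>2 * (kk\<^sup>2 * (4 * X * Y / E\<^sup>2))"
  proof -
    have "4 * p * (r * Y * p) * X / (p * E)\<^sup>2 = r * (4 * X * Y / E\<^sup>2)" if "p \<noteq> 0" for p r :: real
      using that E by (simp add: field_simps power2_eq_square)
    from this[OF P, of "nu\<^sup>2 * kk\<^sup>2"] show ?thesis
      unfolding key by (simp only: mult.assoc)
  qed
  also have "4 * X * Y / E\<^sup>2 = (jsn kk (nu * x + \<alpha>))\<^sup>2 - (jsn kk (nu * x - \<alpha>))\<^sup>2"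
    unfolding jsn_sq_add_diff[OF kk(3)] XY E_def ..
  finally show ?thesis .
qed

lemma phi_0: "phi 0 = \<zeta>2 + \<zeta>3 - \<zeta>1"
proof -
  have "R 0 = \<zeta>1 + \<zeta>3" by (simp add: R_def jacobi_at_0[OF kk(3)])
  moreover have "\<zeta>1 + \<zeta>3 \<noteq> 0" using z3 z32 z21 by simp
  ultimately show ?thesis by (simp add: phi_def field_simps)
qed

lemma shift_deriv:
  assumes "\<And>x. (f has_real_derivative f' x) (at x)"
  shows "((\<lambda>x. f (nu * x + a)) has_real_derivative f' (nu * x + a) * nu) (at x)"
  by (rule DERIV_chain2[OF assms]) (auto intro!: derivative_eq_intros)

lemmas shift_deriv' = shift_deriv[where a = "- a" for a, unfolded add_uminus_conv_diff]

text \<open>The unknown constant \<open>C\<close> in the derivative of Z cancels between the two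
  translates, so \<open>phi1_sn\<close> makes the difference constant. At 0 the value of
  \<open>phi\<close> and the oddness of Z give exactly \<open>s0\<close>.\<close>

lemma phi_zeta: "phi x = s0 - nu * (jZeta kk (nu * x + \<alpha>) - jZeta kk (nu * x - \<alpha>))"
proof -
  obtain C where Z: "\<And>x. (jZeta kk has_real_derivative C - kk\<^sup>2 * (jsn kk x)\<^sup>2) (at x)"
    using jZeta_deriv[OF kk(1,2)] by blast
  let ?g = "\<lambda>x. phi x + nu * (jZeta kk (nu * x + \<alpha>) - jZeta kk (nu * x - \<alpha>))"
  have "?g x = ?g 0"
  proof (rule DERIV_isconst_all[where f = ?g, OF allI])
    fix x
    have "(?g has_real_derivative phi1 x + nu * ((C - kk\<^sup>2 * (jsn kk (nu * x + \<alpha>))\<^sup>2) * nu - (C - kk\<^sup>2 * (jsn kk (nu * x - \<alpha>))\<^sup>2) * nu)) (at x)"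
      by (intro DERIV_add DERIV_cmult DERIV_diff phi_deriv shift_deriv[OF Z] shift_deriv'[OF Z])
    also have "phi1 x + nu * ((C - kk\<^sup>2 * (jsn kk (nu * x + \<alpha>))\<^sup>2) * nu - (C - kk\<^sup>2 * (jsn kk (nu * x - \<alpha>))\<^sup>2) * nu) = 0"
      unfolding phi1_sn by algebra
    finally show "(?g has_real_derivative 0) (at x)" .
  qed
  then show ?thesis
    by (simp add: phi_0 s0_def jZeta_minus kk)
qed

lemma theta_ratio_pos: "theta_ratio x > 0"
  unfolding theta_ratio_def using jTheta_pos[OF kk(1,2)] by (intro divide_pos_pos zero_less_power)

lemma theta_ratio_deriv: "(theta_ratio has_real_derivative theta_ratio x * (2 * phi x - 2 * s0)) (at x)"
proof -
  let ?p = "jTheta kk (nu * x + \<alpha>)" and ?m = "jTheta kk (nu * x - \<alpha>)"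
  note T = jTheta_deriv[OF kk(1,2)]
  have pos: "?p > 0" "?m > 0" using jTheta_pos[OF kk(1,2)] by auto
  have "((\<lambda>x. (jTheta kk (nu * x - \<alpha>))\<^sup>2) has_real_derivative 2 * ?m * (?m * jZeta kk (nu * x - \<alpha>) * nu)) (at x)"
    by (rule derivative_eq_intros shift_deriv'[OF T] refl)+ simp
  moreover have "((\<lambda>x. (jTheta kk (nu * x + \<alpha>))\<^sup>2) has_real_derivative 2 * ?p * (?p * jZeta kk (nu * x + \<alpha>) * nu)) (at x)"
    by (rule derivative_eq_intros shift_deriv[OF T] refl)+ simp
  ultimately have "(theta_ratio has_real_derivative
      (2 * ?m * (?m * jZeta kk (nu * x - \<alpha>) * nu) * ?p\<^sup>2 - ?m\<^sup>2 * (2 * ?p * (?p * jZeta kk (nu * x + \<alpha>) * nu))) / (?p\<^sup>2 * ?p\<^sup>2)) (at x)"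
    unfolding theta_ratio_def using pos by (intro DERIV_divide) auto
  also have "(2 * ?m * (?m * jZeta kk (nu * x - \<alpha>) * nu) * ?p\<^sup>2 - ?m\<^sup>2 * (2 * ?p * (?p * jZeta kk (nu * x + \<alpha>) * nu))) / (?p\<^sup>2 * ?p\<^sup>2)
      = theta_ratio x * (2 * phi x - 2 * s0)"
    unfolding theta_ratio_def phi_zeta using pos by (simp add: field_simps power2_eq_square)
  finally show ?thesis .
qed

section \<open>Periodicity and the sign of \<open>s0\<close>\<close>

definition period where "period = 2 * ellK kk / nu"

lemma period_pos: "period > 0"
  using nu_pos ellK_pos[OF kk(3)] by (simp add: period_def)

lemma nu_period: "nu * (x + period) = nu * x + 2 * ellK kk"
  using nu_pos by (simp add: period_def field_simps)

lemma theta_ratio_period: "theta_ratio (x + period) = theta_ratio x"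
proof -
  have "nu * (x + period) + \<alpha> = (nu * x + \<alpha>) + 2 * ellK kk" "nu * (x + period) - \<alpha> = (nu * x - \<alpha>) + 2 * ellK kk"
    unfolding nu_period by simp_all
  then show ?thesis
    unfolding theta_ratio_def by (simp only: jTheta_plus_2K[OF kk(1,2)])
qed

lemma H_period: "H (x + period) = H x"
  unfolding H_def phi_def phi1_def R_def nu_period
  by (simp add: jsn_plus_2K jcn_plus_2K jdn_plus_2K kk)

text \<open>Up to the exponential and a factor 1/4, the ratio of the two terms in the denominator of
  the solution formula.\<close>

definition gain where "gain x = theta_ratio x * H x"

lemma gain_pos: "gain x > 0"
  by (simp add: gain_def theta_ratio_pos H_bounds)

text \<open>The \<open>phi\<close> terms in the logarithmic derivatives of
  \<open>theta_ratio\<close> and \<open>H\<close> cancel.\<close>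

lemma gain_deriv: "(gain has_real_derivative 2 * bb * theta_ratio x - 2 * s0 * gain x) (at x)"
proof -
  have "(gain has_real_derivative theta_ratio x * (2 * phi x - 2 * s0) * H x + (2 * bb - 2 * phi x * H x) * theta_ratio x) (at x)"
    unfolding gain_def by (intro DERIV_mult theta_ratio_deriv H_deriv)
  also have "theta_ratio x * (2 * phi x - 2 * s0) * H x + (2 * bb - 2 * phi x * H x) * theta_ratio x = 2 * bb * theta_ratio x - 2 * s0 * gain x"
    unfolding gain_def by algebra
  finally show ?thesis .
qed

text \<open>\<open>e\<^bsup>2 s\<^sub>0 x\<^esup> gain x\<close> is strictly increasing while \<open>gain\<close> is periodic.\<close>

lemma s0_pos: "s0 > 0"
proof -
  have "exp (2 * s0 * 0) * gain 0 < exp (2 * s0 * period) * gain period"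
  proof (rule DERIV_pos_imp_increasing[OF period_pos])
    fix x
    have "((\<lambda>x. exp (2 * s0 * x) * gain x) has_real_derivative exp (2 * s0 * x) * (2 * bb * theta_ratio x)) (at x)"
      by (rule derivative_eq_intros gain_deriv refl)+ (simp add: algebra_simps)
    moreover have "exp (2 * s0 * x) * (2 * bb * theta_ratio x) > 0"
      using bb_pos theta_ratio_pos by simp
    ultimately show "\<exists>d. ((\<lambda>x. exp (2 * s0 * x) * gain x) has_real_derivative d) (at x) \<and> 0 < d" by blast
  qed
  moreover have "gain period = gain 0"
    using theta_ratio_period[of 0] H_period[of 0] by (simp add: gain_def)
  ultimately have "exp (2 * s0 * period) > 1"
    using gain_pos[of 0] by simp
  then show ?thesis
    using period_pos by (simp add: zero_less_mult_iff)
qed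

section \<open>The second Riccati solution as a translate of the profile\<close>

lemma phi_minus: "phi (- x) = phi x"
  by (simp add: phi_def R_def jsn_minus kk)

lemma phi1_minus: "phi1 (- x) = - phi1 x"
  by (simp add: phi1_def R_def jsn_minus jcn_minus jdn_minus kk)

text \<open>Explicitly, \<open>phi\<close> is \<open>\<zeta>2 * \<zeta>3 / \<zeta>1\<close> and
  \<open>H\<close> is \<open>4 * \<zeta>1^2\<close> at this point. The product \<open>bb\<close>
  means that \<open>phi - 2 * bb / H\<close> equals \<open>- phi\<close> there, the initial value
  for the uniqueness argument below.\<close>

lemma phi_H_at_alpha: "phi (\<alpha> / nu) * H (\<alpha> / nu) = bb"
proof -
  let ?a = "\<alpha> / nu"
  have na: "nu * ?a = \<alpha>" using nu_pos by simp
  have ne: "\<zeta>1 > 0" "\<zeta>1 + \<zeta>2 > 0" "\<zeta>2 + \<zeta>3 > 0" using z3 z32 z21 by auto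
  have R: "(\<zeta>1 + \<zeta>2) * R ?a = 2 * \<zeta>1 * (\<zeta>2 + \<zeta>3)"
    unfolding R_def na using sn_alpha_sq by algebra
  have p: "\<zeta>1 * phi ?a = \<zeta>2 * \<zeta>3"
  proof -
    have "phi ?a * R ?a = 2 * (\<zeta>1 + \<zeta>3) * (\<zeta>2 + \<zeta>3) - (\<zeta>1 + \<zeta>2 + \<zeta>3) * R ?a"
      using R_pos[of ?a] by (simp add: phi_def field_simps)
    then have "2 * (\<zeta>2 + \<zeta>3) * (\<zeta>1 * phi ?a) = 2 * (\<zeta>2 + \<zeta>3) * (\<zeta>2 * \<zeta>3)"
      using R by algebra
    then show ?thesis using ne by simp
  qed
  have p1: "\<zeta>1\<^sup>2 * phi1 ?a = (\<zeta>1\<^sup>2 - \<zeta>2\<^sup>2) * (\<zeta>1\<^sup>2 - \<zeta>3\<^sup>2)"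
  proof -
    have "phi1 ?a * (R ?a)\<^sup>2 = 4 * nu * (\<zeta>1 + \<zeta>3) * (\<zeta>2 + \<zeta>3) * (\<zeta>1 - \<zeta>2) * (jsn kk \<alpha> * jcn kk \<alpha> * jdn kk \<alpha>)"
      using R_pos[of ?a] by (simp add: phi1_def na)
    then have "phi1 ?a * (R ?a)\<^sup>2 = 4 * (\<zeta>1 + \<zeta>3) * (\<zeta>2 + \<zeta>3)\<^sup>2 * (\<zeta>1 - \<zeta>2) * (jsn kk \<alpha>)\<^sup>2"
      using cn_dn_alpha by algebra
    then have "4 * (\<zeta>2 + \<zeta>3)\<^sup>2 * (\<zeta>1\<^sup>2 * phi1 ?a) = 4 * (\<zeta>2 + \<zeta>3)\<^sup>2 * ((\<zeta>1\<^sup>2 - \<zeta>2\<^sup>2) * (\<zeta>1\<^sup>2 - \<zeta>3\<^sup>2))"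
      using R sn_alpha_sq by algebra
    then show ?thesis using ne by simp
  qed
  have "\<zeta>1\<^sup>2 * H ?a = \<zeta>1\<^sup>2 * (4 * \<zeta>1\<^sup>2)"
    unfolding H_def cc_def using p p1 by algebra
  then have "H ?a = 4 * \<zeta>1\<^sup>2" using ne by simp
  then have "\<zeta>1 * (phi ?a * H ?a) = \<zeta>1 * bb"
    unfolding bb_def using p by algebra
  then show ?thesis using ne by simp
qed

text \<open>Both sides satisfy the profile equation with \<open>b\<close> replaced by \<open>-b\<close>, and agree to first order at \<open>\<alpha> / \<nu>\<close>.\<close>

lemma riccati_partner_shift: "phi x - 2 * bb / H x = - phi (x - 2 * \<alpha> / nu)"
proof -
  let ?a = "\<alpha> / nu"
  define \<psi> where "\<psi> = (\<lambda>x. phi x - 2 * bb / H x)"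
  define V where "V = (\<lambda>x. (phi x)\<^sup>2 - phi1 x)"
  have HV: "H x = cc - 2 * V x" for x by (simp add: H_def V_def)
  have \<psi>H: "(phi x - \<psi> x) * H x = 2 * bb" for x
    using H_bounds(3)[of x] by (simp add: \<psi>_def)
  have V: "(V has_real_derivative phi x * H x - bb) (at x)" for x
  proof -
    have "(V has_real_derivative 2 * phi x * phi1 x - (2 * phi x ^ 3 - cc * phi x + bb)) (at x)"
      unfolding V_def by (auto intro!: derivative_eq_intros phi_deriv phi1_deriv)
    also have "2 * phi x * phi1 x - (2 * phi x ^ 3 - cc * phi x + bb) = phi x * H x - bb"
      unfolding H_def by algebra
    finally show ?thesis .
  qed
  have \<psi>: "(\<psi> has_real_derivative (\<psi> x)\<^sup>2 - V x) (at x)" for x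
  proof -
    have H: "H x \<noteq> 0" using H_bounds(3)[of x] by simp
    have "(\<psi> has_real_derivative phi1 x - (0 * H x - 2 * bb * (2 * bb - 2 * phi x * H x)) / (H x * H x)) (at x)"
      unfolding \<psi>_def by (intro DERIV_diff DERIV_divide DERIV_const phi_deriv H_deriv H)
    also have "phi1 x - (0 * H x - 2 * bb * (2 * bb - 2 * phi x * H x)) / (H x * H x) = (\<psi> x)\<^sup>2 - V x"
      unfolding \<psi>_def V_def using H by (simp add: field_simps power2_eq_square)
    finally show ?thesis .
  qed
  have \<psi>1: "((\<lambda>x. (\<psi> x)\<^sup>2 - V x) has_real_derivative - bb + - cc * \<psi> x + 2 * \<psi> x ^ 3) (at x)" for x
  proof -
    have "((\<lambda>x. (\<psi> x)\<^sup>2 - V x) has_real_derivative 2 * \<psi> x * ((\<psi> x)\<^sup>2 - V x) - (phi x * H x - bb)) (at x)"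
      by (rule derivative_eq_intros \<psi> V refl)+ simp
    also have "2 * \<psi> x * ((\<psi> x)\<^sup>2 - V x) - (phi x * H x - bb) = - bb + - cc * \<psi> x + 2 * \<psi> x ^ 3"
      using \<psi>H[of x] HV[of x] by algebra
    finally show ?thesis .
  qed
  have shift: "((\<lambda>x. f (x + a)) has_real_derivative f' (x + a)) (at x)"
    if "\<And>x. (f has_real_derivative f' x) (at x)" for f f' :: "real \<Rightarrow> real" and a x
    using that[of "x + a"] by (simp add: DERIV_shift)
  have "\<psi> ((x - ?a) + ?a) = - phi ((x - ?a) + (- ?a))"
  proof (rule cubic_ode_unique_all[OF shift[where a = ?a, OF \<psi>] shift[where a = ?a, OF \<psi>1]])
    show "((\<lambda>x. - phi (x + - ?a)) has_real_derivative - phi1 (y + - ?a)) (at y)" for y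
      by (rule DERIV_minus[OF shift[OF phi_deriv]])
    show "((\<lambda>x. - phi1 (x + - ?a)) has_real_derivative - bb + - cc * - phi (y + - ?a) + 2 * (- phi (y + - ?a)) ^ 3) (at y)" for y
      using DERIV_minus[OF shift[OF phi1_deriv, of "- ?a" y]] by (simp add: power3_eq_cube algebra_simps)
    have H: "H ?a \<noteq> 0" using H_bounds(3)[of ?a] by simp
    have at: "\<psi> ?a = - phi ?a"
    proof -
      have "(\<psi> ?a + phi ?a) * H ?a = 0"
        using \<psi>H[of ?a] phi_H_at_alpha by algebra
      then show ?thesis using H by simp
    qed
    then show "\<psi> (0 + ?a) = - phi (0 + - ?a)"
      by (simp add: phi_minus)
    show "(\<psi> (0 + ?a))\<^sup>2 - V (0 + ?a) = - phi1 (0 + - ?a)"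
      using at by (simp add: V_def phi1_minus)
  qed
  then show ?thesis by (simp add: \<psi>_def)
qed

definition cb where "cb = cc - bb / s0"

lemma s0_cb: "s0 * (cc - cb) = bb"
  using s0_pos by (simp add: cb_def)

lemma cb_less: "cb < cc"
  using s0_pos bb_pos by (simp add: cb_def)

section \<open>The kink breather: equation, bounds and limits\<close>

context
  fixes \<eta>0 :: real
begin

definition weight where "weight x t = exp (2 * (s0 * (x + cb * t) + \<eta>0)) * gain (x + cc * t) / 4"
definition frac where "frac x t = weight x t / (1 + weight x t)"
definition sol where "sol x t = phi (x + cc * t) - 2 * bb / H (x + cc * t) * frac x t"

lemma weight_pos: "weight x t > 0"
  by (simp add: weight_def gain_pos)

text \<open>In \<open>x\<close> the exponential contributes \<open>2 * s0\<close> to the logarithmic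
  derivative and \<open>gain\<close> contributes \<open>2 * bb / H - 2 * s0\<close>. In
  \<open>t\<close> the sum is \<open>2 * bb * cc / H - 2 * s0 * (cc - cb)\<close>, and
  \<open>s0_cb\<close> turns it into \<open>cc - H = 2 V\<close> times the \<open>x\<close>-rate, as
  \<open>mkdv_darboux\<close> requires.\<close>

lemma weight_deriv:
  "((\<lambda>x. weight x t) has_real_derivative 2 * bb / H (x + cc * t) * weight x t) (at x)"
  "((\<lambda>t. weight x t) has_real_derivative (cc - H (x + cc * t)) * (2 * bb / H (x + cc * t)) * weight x t) (at t)"
proof -
  let ?\<xi> = "x + cc * t" and ?E = "exp (2 * (s0 * (x + cb * t) + \<eta>0))"
  have H: "H ?\<xi> \<noteq> 0" using H_bounds(3)[of ?\<xi>] by simp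
  have gx: "((\<lambda>x. gain (x + cc * t)) has_real_derivative 2 * bb * theta_ratio ?\<xi> - 2 * s0 * gain ?\<xi>) (at x)"
    using gain_deriv[of ?\<xi>] by (simp add: DERIV_shift)
  have gt: "((\<lambda>t. gain (x + cc * t)) has_real_derivative (2 * bb * theta_ratio ?\<xi> - 2 * s0 * gain ?\<xi>) * cc) (at t)"
    by (rule DERIV_chain2[OF gain_deriv]) (auto intro!: derivative_eq_intros)
  have Ex: "((\<lambda>x. exp (2 * (s0 * (x + cb * t) + \<eta>0))) has_real_derivative ?E * (2 * s0)) (at x)"
    by (auto intro!: derivative_eq_intros)
  have Et: "((\<lambda>t. exp (2 * (s0 * (x + cb * t) + \<eta>0))) has_real_derivative ?E * (2 * (s0 * cb))) (at t)"
    by (auto intro!: derivative_eq_intros)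
  have "((\<lambda>x. weight x t) has_real_derivative
      (?E * (2 * s0) * gain ?\<xi> + (2 * bb * theta_ratio ?\<xi> - 2 * s0 * gain ?\<xi>) * ?E) / 4) (at x)"
    unfolding weight_def by (intro DERIV_cdivide DERIV_mult Ex gx)
  also have "?E * (2 * s0) * gain ?\<xi> + (2 * bb * theta_ratio ?\<xi> - 2 * s0 * gain ?\<xi>) * ?E = ?E * (2 * bb * theta_ratio ?\<xi>)"
    by algebra
  also have "?E * (2 * bb * theta_ratio ?\<xi>) / 4 = 2 * bb / H ?\<xi> * weight x t"
    using H by (simp add: weight_def gain_def)
  finally show "((\<lambda>x. weight x t) has_real_derivative 2 * bb / H ?\<xi> * weight x t) (at x)" .
  have "((\<lambda>t. weight x t) has_real_derivative
      (?E * (2 * (s0 * cb)) * gain ?\<xi> + (2 * bb * theta_ratio ?\<xi> - 2 * s0 * gain ?\<xi>) * cc * ?E) / 4) (at t)"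
    unfolding weight_def by (intro DERIV_cdivide DERIV_mult Et gt)
  also have "?E * (2 * (s0 * cb)) * gain ?\<xi> + (2 * bb * theta_ratio ?\<xi> - 2 * s0 * gain ?\<xi>) * cc * ?E
      = ?E * (2 * (s0 * cb) * gain ?\<xi> + (2 * bb * theta_ratio ?\<xi> - 2 * s0 * gain ?\<xi>) * cc)"
    by algebra
  also have "2 * (s0 * cb) * gain ?\<xi> + (2 * bb * theta_ratio ?\<xi> - 2 * s0 * gain ?\<xi>) * cc
      = 2 * bb * (cc - H ?\<xi>) * theta_ratio ?\<xi>"
    unfolding gain_def s0_cb[symmetric] by (simp add: algebra_simps)
  also have "?E * (2 * bb * (cc - H ?\<xi>) * theta_ratio ?\<xi>) / 4 = (cc - H ?\<xi>) * (2 * bb / H ?\<xi>) * weight x t"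
    using H by (simp add: weight_def gain_def field_simps)
  finally show "((\<lambda>t. weight x t) has_real_derivative (cc - H ?\<xi>) * (2 * bb / H ?\<xi>) * weight x t) (at t)" .
qed

lemma logistic_deriv:
  fixes m :: "real \<Rightarrow> real"
  assumes "(m has_real_derivative r * m x) (at x)" "m x > 0"
  shows "((\<lambda>x. m x / (1 + m x)) has_real_derivative r * (m x / (1 + m x)) * (1 - m x / (1 + m x))) (at x)"
proof -
  have "((\<lambda>x. m x / (1 + m x)) has_real_derivative (r * m x * (1 + m x) - m x * (0 + r * m x)) / ((1 + m x) * (1 + m x))) (at x)"
    using assms by (intro DERIV_divide DERIV_add DERIV_const) auto
  also have "(r * m x * (1 + m x) - m x * (0 + r * m x)) / ((1 + m x) * (1 + m x)) = r * (m x / (1 + m x)) * (1 - m x / (1 + m x))"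
  proof -
    have "1 + m x \<noteq> 0" using assms(2) by simp
    then show ?thesis by (simp add: field_simps)
  qed
  finally show ?thesis .
qed

lemma sol_mkdv:
  "(\<lambda>y. sol y t) differentiable (at x)" "deriv (\<lambda>y. sol y t) differentiable (at x)"
  "deriv (deriv (\<lambda>y. sol y t)) differentiable (at x)" "(\<lambda>s. sol x s) differentiable (at t)"
  "deriv (\<lambda>s. sol x s) t - 6 * (sol x t)\<^sup>2 * deriv (\<lambda>y. sol y t) x + deriv (deriv (deriv (\<lambda>y. sol y t))) x = 0"
proof -
  have HV: "cc - 2 * ((phi \<xi>)\<^sup>2 - phi1 \<xi>) = H \<xi>" for \<xi> by (simp add: H_def)
  have V2: "2 * ((phi \<xi>)\<^sup>2 - phi1 \<xi>) = cc - H \<xi>" for \<xi> by (simp add: H_def)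
  have n1: "((\<lambda>x. frac x t) has_real_derivative 2 * bb / (cc - 2 * ((phi (x + cc * t))\<^sup>2 - phi1 (x + cc * t))) * frac x t * (1 - frac x t)) (at x)" for x t
    unfolding frac_def HV by (rule logistic_deriv[OF weight_deriv(1) weight_pos])
  have n2: "((\<lambda>t. frac x t) has_real_derivative 2 * ((phi (x + cc * t))\<^sup>2 - phi1 (x + cc * t)) *
      (2 * bb / (cc - 2 * ((phi (x + cc * t))\<^sup>2 - phi1 (x + cc * t)))) * frac x t * (1 - frac x t)) (at t)" for x t
    unfolding frac_def HV unfolding V2 by (rule logistic_deriv[OF weight_deriv(2) weight_pos])
  have nz: "cc - 2 * ((phi \<xi>)\<^sup>2 - phi1 \<xi>) \<noteq> 0" for \<xi>
    unfolding HV using H_bounds(3)[of \<xi>] by simp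
  note D = mkdv_darboux[OF phi_deriv phi1_deriv nz n1 n2, unfolded HV, folded sol_def]
  show "(\<lambda>y. sol y t) differentiable (at x)" "deriv (\<lambda>y. sol y t) differentiable (at x)"
    "deriv (deriv (\<lambda>y. sol y t)) differentiable (at x)" "(\<lambda>s. sol x s) differentiable (at t)"
    "deriv (\<lambda>s. sol x s) t - 6 * (sol x t)\<^sup>2 * deriv (\<lambda>y. sol y t) x + deriv (deriv (deriv (\<lambda>y. sol y t))) x = 0"
    by (rule D)+
qed

text \<open>The solution measured from the second Riccati solution, with the complementary weight;
  this is the form suited to large positive phase.\<close>

lemma sol_alt: "sol x t = - phi (x + cc * t - 2 * \<alpha> / nu) + 2 * bb / H (x + cc * t) / (1 + weight x t)"
proof -
  have "1 + weight x t \<noteq> 0" using weight_pos[of x t] by simp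
  then have "1 - frac x t = 1 / (1 + weight x t)" by (simp add: frac_def field_simps)
  then have "2 * bb / H (x + cc * t) * (1 - frac x t) = 2 * bb / H (x + cc * t) / (1 + weight x t)"
    by simp
  then show ?thesis
    unfolding riccati_partner_shift[symmetric] sol_def right_diff_distrib mult_1_right by linarith
qed

lemma coefficient_bounds:
  obtains W where "W > 0" "\<And>x. 0 < 2 * bb / H x" "\<And>x. 2 * bb / H x \<le> W"
proof -
  obtain h where h: "h > 0" "\<And>x. h \<le> H x" using H_lower by blast
  show thesis
  proof (rule that[of "2 * bb / h"])
    show "2 * bb / h > 0" using h bb_pos by simp
    show "0 < 2 * bb / H x" for x using H_bounds(3)[of x] bb_pos by simp
    show "2 * bb / H x \<le> 2 * bb / h" for x
      using h bb_pos by (intro divide_left_mono mult_pos_pos H_bounds) auto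
  qed
qed

text \<open>\<open>gain\<close> is continuous, positive and periodic, hence pinched between positive
  constants. The weight is thus comparable to its exponential uniformly in \<open>x\<close> and
  \<open>t\<close>, so the limits depend on the phase alone.\<close>

lemma weight_bounds:
  obtains l L where "l > 0" "L > 0"
    "\<And>x t. l * exp (2 * (s0 * (x + cb * t) + \<eta>0)) \<le> weight x t"
    "\<And>x t. weight x t \<le> L * exp (2 * (s0 * (x + cb * t) + \<eta>0))"
proof -
  have cont: "continuous_on UNIV gain"
    by (rule DERIV_continuous_on[OF has_field_derivative_at_within[OF gain_deriv]])
  have per: "gain (x + period) = gain x" for x
    by (simp add: gain_def theta_ratio_period H_period)
  obtain l L where l: "l > 0" "\<And>x. l \<le> gain x" "\<And>x. gain x \<le> L"
    by (rule periodic_pos_bounds[OF cont gain_pos per period_pos]) (rule that)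
  have "L > 0" using l(1) l(2)[of 0] l(3)[of 0] by linarith
  then show thesis
    using that[of "l/4" "L/4"] l by (simp add: weight_def mult.commute)
qed

lemma frac_bounds: "0 < frac x t" "frac x t \<le> 1" "frac x t \<le> weight x t"
  using weight_pos[of x t] by (simp_all add: frac_def divide_le_eq)

lemma sol_bounded: "\<exists>M. \<forall>x t. \<bar>sol x t\<bar> \<le> M"
proof -
  obtain W where W: "W > 0" "\<And>x. 0 < 2 * bb / H x" "\<And>x. 2 * bb / H x \<le> W"
    by (rule coefficient_bounds) (rule that)
  have "\<bar>sol x t\<bar> \<le> (\<zeta>1 + \<zeta>2 + \<zeta>3) + W * 1" for x t
  proof -
    let ?w = "2 * bb / H (x + cc * t)"
    have "\<bar>phi (x + cc * t)\<bar> \<le> \<zeta>1 + \<zeta>2 + \<zeta>3"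
      using phi_ge[of "x + cc * t"] phi_le[of "x + cc * t"] z3 z32 z21 by (simp add: abs_le_iff)
    moreover have "?w * frac x t \<le> W * 1" "0 \<le> ?w * frac x t"
      using W(2,3)[of "x + cc * t"] frac_bounds[of x t] \<open>W > 0\<close> by (intro mult_mono mult_nonneg_nonneg; simp)+
    ultimately show ?thesis unfolding sol_def by linarith
  qed
  then show ?thesis by blast
qed

lemma sol_limit_minus:
  assumes "\<epsilon> > 0"
  shows "\<exists>N. \<forall>x t. s0 * (x + cb * t) < N \<longrightarrow> \<bar>sol x t - phi (x + cc * t)\<bar> < \<epsilon>"
proof -
  obtain W where W: "W > 0" "\<And>x. 0 < 2 * bb / H x" "\<And>x. 2 * bb / H x \<le> W"
    by (rule coefficient_bounds) (rule that)
  obtain l L where "l > 0" and L: "L > 0"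
    and "\<And>x t. l * exp (2 * (s0 * (x + cb * t) + \<eta>0)) \<le> weight x t"
    and L2: "\<And>x t. weight x t \<le> L * exp (2 * (s0 * (x + cb * t) + \<eta>0))"
    by (rule weight_bounds) (rule that)
  \<comment> \<open>Solves \<open>W * L * exp (2 * (N + \<eta>0)) = \<epsilon>\<close>, where
    \<open>W\<close> bounds \<open>2 * bb / H\<close> and \<open>L\<close> times the exponential
    bounds the weight.\<close>
  define N where "N = ln (\<epsilon> / (W * L)) / 2 - \<eta>0"
  have "\<bar>sol x t - phi (x + cc * t)\<bar> < \<epsilon>" if "s0 * (x + cb * t) < N" for x t
  proof -
    let ?w = "2 * bb / H (x + cc * t)"
    have "2 * (s0 * (x + cb * t) + \<eta>0) < ln (\<epsilon> / (W * L))"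
    proof -
      have "2 * (y + \<eta>0) < r" if "y < r / 2 - \<eta>0" for y r :: real using that by simp
      from this[OF that[unfolded N_def]] show ?thesis .
    qed
    then have "exp (2 * (s0 * (x + cb * t) + \<eta>0)) < \<epsilon> / (W * L)"
      using assms W(1) L by (metis divide_pos_pos exp_less_cancel_iff exp_ln mult_pos_pos)
    then have "W * (L * exp (2 * (s0 * (x + cb * t) + \<eta>0))) < \<epsilon>"
      using W(1) L by (simp add: field_simps)
    moreover have "?w * frac x t \<le> W * (L * exp (2 * (s0 * (x + cb * t) + \<eta>0)))"
    proof (rule mult_mono)
      show "frac x t \<le> L * exp (2 * (s0 * (x + cb * t) + \<eta>0))"
        using frac_bounds(3) L2 by (rule order_trans)
    qed (use W frac_bounds(1)[of x t] in \<open>auto simp: less_imp_le\<close>)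
    moreover have "0 \<le> ?w * frac x t"
      using W(2)[of "x + cc * t"] frac_bounds(1)[of x t] by (intro mult_nonneg_nonneg) auto
    ultimately show ?thesis unfolding sol_def by linarith
  qed
  then show ?thesis by blast
qed

lemma sol_limit_plus:
  assumes "\<epsilon> > 0"
  shows "\<exists>N. \<forall>x t. s0 * (x + cb * t) > N \<longrightarrow> \<bar>sol x t - (- phi (x + cc * t - 2 * \<alpha> / nu))\<bar> < \<epsilon>"
proof -
  obtain W where W: "W > 0" "\<And>x. 0 < 2 * bb / H x" "\<And>x. 2 * bb / H x \<le> W"
    by (rule coefficient_bounds) (rule that)
  obtain l L where l: "l > 0" and "L > 0"
    and l2: "\<And>x t. l * exp (2 * (s0 * (x + cb * t) + \<eta>0)) \<le> weight x t"
    and "\<And>x t. weight x t \<le> L * exp (2 * (s0 * (x + cb * t) + \<eta>0))"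
    by (rule weight_bounds) (rule that)
  \<comment> \<open>Solves \<open>W = \<epsilon> * l * exp (2 * (N + \<eta>0))\<close>; beyond it
    \<open>2 * bb / H\<close> stays below \<open>\<epsilon>\<close> times the weight.\<close>
  define N where "N = ln (W / (l * \<epsilon>)) / 2 - \<eta>0"
  have "\<bar>sol x t - (- phi (x + cc * t - 2 * \<alpha> / nu))\<bar> < \<epsilon>" if "s0 * (x + cb * t) > N" for x t
  proof -
    let ?w = "2 * bb / H (x + cc * t)"
    have "2 * (s0 * (x + cb * t) + \<eta>0) > ln (W / (l * \<epsilon>))"
    proof -
      have "2 * (y + \<eta>0) > r" if "y > r / 2 - \<eta>0" for y r :: real using that by simp
      from this[OF that[unfolded N_def]] show ?thesis .
    qed
    then have "exp (2 * (s0 * (x + cb * t) + \<eta>0)) > W / (l * \<epsilon>)"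
      using assms W(1) l by (metis divide_pos_pos exp_less_cancel_iff exp_ln mult_pos_pos)
    then have "W < \<epsilon> * (l * exp (2 * (s0 * (x + cb * t) + \<eta>0)))"
      using assms l by (simp add: field_simps)
    also have "\<dots> \<le> \<epsilon> * (1 + weight x t)"
      using l2[of x t] assms by (intro mult_left_mono) auto
    finally have "?w < \<epsilon> * (1 + weight x t)"
      using W(3)[of "x + cc * t"] by simp
    then have "?w / (1 + weight x t) < \<epsilon>"
      using weight_pos[of x t] by (subst pos_divide_less_eq) auto
    moreover have "0 \<le> ?w / (1 + weight x t)"
      by (rule less_imp_le[OF divide_pos_pos[OF W(2)]]) (use weight_pos[of x t] in simp)
    moreover have "sol x t - (- phi (x + cc * t - 2 * \<alpha> / nu)) = ?w / (1 + weight x t)"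
      unfolding sol_alt by simp
    ultimately show ?thesis by (simp only: abs_of_nonneg)
  qed
  then show ?thesis by blast
qed

text \<open>With the profile equation in place of the second derivative, the numerator is
  \<open>phi * D - 2 * bb * E * B\<close> for the denominator \<open>D\<close>, and
  \<open>E * B * H / D\<close> is \<open>frac\<close>.\<close>

lemma sol_eq:
  fixes x t :: real
  defines "\<xi> \<equiv> x + cc * t" and "E \<equiv> exp (2 * (s0 * (x + cb * t) + \<eta>0))"
  defines "A \<equiv> (jTheta kk (nu * \<xi> + \<alpha>))\<^sup>2" and "B \<equiv> (jTheta kk (nu * \<xi> - \<alpha>))\<^sup>2"
  shows "(4 * phi \<xi> * A + E * B * (2 * phi \<xi> * deriv phi \<xi> - deriv (deriv phi) \<xi> - bb))
      / (4 * A + E * B * (cc + 2 * deriv phi \<xi> - 2 * (phi \<xi>)\<^sup>2)) = sol x t"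
proof -
  have d1: "deriv phi = phi1"
    using phi_deriv by (auto intro!: DERIV_imp_deriv)
  have d2: "deriv phi1 \<xi> = 2 * phi \<xi> ^ 3 - cc * phi \<xi> + bb"
    by (rule DERIV_imp_deriv[OF phi1_deriv])
  have pos: "A > 0" "B > 0" "E > 0" "H \<xi> > 0"
    unfolding A_def B_def E_def by (intro zero_less_power jTheta_pos kk exp_gt_zero H_bounds)+
  define D where "D = 4 * A + E * B * H \<xi>"
  have "E * B * H \<xi> > 0" using pos by simp
  then have "D > 0" unfolding D_def using pos by (intro add_pos_pos) auto
  have "weight x t = E * B * H \<xi> / (4 * A)"
    by (simp add: weight_def gain_def theta_ratio_def E_def A_def B_def \<xi>_def)
  then have wt: "E * B * H \<xi> = 4 * A * weight x t"
    using pos by simp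
  have "1 + weight x t \<noteq> 0" using weight_pos[of x t] by simp
  then have "frac x t * (4 * A * (1 + weight x t)) = 4 * A * weight x t"
    by (simp add: frac_def)
  then have "frac x t * D = E * B * H \<xi>"
    unfolding D_def wt by (simp add: distrib_left)
  then have "frac x t = E * B * H \<xi> / D"
    using \<open>D > 0\<close> by (simp add: eq_divide_eq)
  then have "sol x t * D = phi \<xi> * D - 2 * bb * (E * B)"
    using pos \<open>D > 0\<close> unfolding sol_def \<xi>_def[symmetric] by (simp add: field_simps)
  also have "\<dots> = 4 * phi \<xi> * A + E * B * (2 * phi \<xi> * phi1 \<xi> - (2 * phi \<xi> ^ 3 - cc * phi \<xi> + bb) - bb)"
    unfolding D_def H_def by algebra
  finally have "sol x t = (4 * phi \<xi> * A + E * B * (2 * phi \<xi> * phi1 \<xi> - (2 * phi \<xi> ^ 3 - cc * phi \<xi> + bb) - bb)) / D"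
    using \<open>D > 0\<close> by (simp add: eq_divide_eq)
  then show ?thesis
    unfolding d1 d2 D_def H_def ..
qed

end

end

theorem theorem2:
  fixes \<zeta>1 \<zeta>2 \<zeta>3 \<alpha> \<eta>0 :: real
    and b c \<nu> k s0 cb :: real
    and \<phi> :: "real \<Rightarrow> real"
    and u :: "real \<Rightarrow> real \<Rightarrow> real"
  assumes z3: "0 < \<zeta>3" and z32: "\<zeta>3 < \<zeta>2" and z21: "\<zeta>2 < \<zeta>1"
  defines "b \<equiv> 4 * \<zeta>1 * \<zeta>2 * \<zeta>3"
    and "c \<equiv> 2 * (\<zeta>1\<^sup>2 + \<zeta>2\<^sup>2 + \<zeta>3\<^sup>2)"
    and "\<nu> \<equiv> sqrt (\<zeta>1\<^sup>2 - \<zeta>3\<^sup>2)"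
    and "k \<equiv> sqrt ((\<zeta>1\<^sup>2 - \<zeta>2\<^sup>2) / (\<zeta>1\<^sup>2 - \<zeta>3\<^sup>2))"
  assumes alpha_pos: "0 < \<alpha>" and alpha_lt: "\<alpha> < ellK k"
    and alpha_sn: "jsn k \<alpha> = sqrt ((\<zeta>1 - \<zeta>3) / (\<zeta>1 + \<zeta>2))"
  defines "\<phi> \<equiv> (\<lambda>x. 2 * (\<zeta>1 + \<zeta>3) * (\<zeta>2 + \<zeta>3)
                    / ((\<zeta>1 + \<zeta>3) - (\<zeta>1 - \<zeta>2) * (jsn k (\<nu> * x))\<^sup>2)
                  - \<zeta>1 - \<zeta>2 - \<zeta>3)"
    and "s0 \<equiv> \<zeta>2 + \<zeta>3 - \<zeta>1 + 2 * sqrt (\<zeta>1\<^sup>2 - \<zeta>3\<^sup>2) * jZeta k \<alpha>"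
    and "cb \<equiv> 2 * (\<zeta>1\<^sup>2 + \<zeta>2\<^sup>2 + \<zeta>3\<^sup>2)
              - 4 * \<zeta>1 * \<zeta>2 * \<zeta>3 / (\<zeta>2 + \<zeta>3 - \<zeta>1 + 2 * sqrt (\<zeta>1\<^sup>2 - \<zeta>3\<^sup>2) * jZeta k \<alpha>)"
    and "u \<equiv> (\<lambda>x t. let \<xi> = x + c * t; \<eta> = s0 * (x + cb * t);
                       E = exp (2 * (\<eta> + \<eta>0));
                       A = (jTheta k (\<nu> * \<xi> + \<alpha>))\<^sup>2;
                       B = (jTheta k (\<nu> * \<xi> - \<alpha>))\<^sup>2
                   in (4 * \<phi> \<xi> * A + E * B * (2 * \<phi> \<xi> * deriv \<phi> \<xi> - deriv (deriv \<phi>) \<xi> - b))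
                      / (4 * A + E * B * (c + 2 * deriv \<phi> \<xi> - 2 * (\<phi> \<xi>)\<^sup>2)))"
  shows "(\<forall>x t. (\<lambda>y. u y t) differentiable (at x)
              \<and> deriv (\<lambda>y. u y t) differentiable (at x)
              \<and> deriv (deriv (\<lambda>y. u y t)) differentiable (at x)
              \<and> (\<lambda>s. u x s) differentiable (at t)
              \<and> deriv (\<lambda>s. u x s) t - 6 * (u x t)\<^sup>2 * deriv (\<lambda>y. u y t) x
                  + deriv (deriv (deriv (\<lambda>y. u y t))) x = 0)
       \<and> (\<exists>M. \<forall>x t. \<bar>u x t\<bar> \<le> M)
       \<and> cb < c \<and> s0 > 0
       \<and> (\<forall>\<epsilon>>0. \<exists>N. \<forall>x t. s0 * (x + cb * t) < N \<longrightarrow> \<bar>u x t - \<phi> (x + c * t)\<bar> < \<epsilon>)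
       \<and> (\<forall>\<epsilon>>0. \<exists>N. \<forall>x t. s0 * (x + cb * t) > N \<longrightarrow>
              \<bar>u x t - (- \<phi> (x + c * t - 2 * \<alpha> / \<nu>))\<bar> < \<epsilon>)"
proof -
  interpret kb: kink_breather \<zeta>1 \<zeta>2 \<zeta>3 \<alpha>
    by unfold_locales (use z3 z32 z21 alpha_pos alpha_lt alpha_sn in \<open>simp_all only: k_def\<close>)
  have b: "b = kb.bb" and c: "c = kb.cc" and \<nu>: "\<nu> = kb.nu" and k: "k = kb.kk"
    by (simp_all only: b_def c_def \<nu>_def k_def kb.bb_def kb.cc_def kb.nu_def kb.kk_def)
  have s0: "s0 = kb.s0"
    by (simp only: s0_def kb.s0_def kb.nu_def k)
  have cb: "cb = kb.cb"
    by (simp only: cb_def kb.cb_def kb.s0_def kb.cc_def kb.bb_def kb.nu_def k)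
  have \<phi>: "\<phi> = kb.phi"
    by (rule ext) (simp only: \<phi>_def kb.phi_def kb.R_def k \<nu>)
  have u: "u = kb.sol \<eta>0"
    by (intro ext) (simp only: u_def Let_def s0 cb \<phi> b c \<nu> k kb.sol_eq)
  show ?thesis
    unfolding s0 cb \<phi> u c \<nu>
    by (intro conjI allI impI kb.sol_mkdv kb.sol_bounded kb.cb_less kb.s0_pos kb.sol_limit_minus kb.sol_limit_plus)
qed

end
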